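(* Let $\mu(\mathfrak g)$ denote the least $N$ such that the real Lie algebra $\mathfrak g$ has a faithful representation in $\mathfrak{gl}(N,\mathbb R)$. Then $\mu=5$ for each of the eight-dimensional Lie algebras $L_{8.1}$, $L_{8.3}$, $L_{8.4}$, $L_{8.7}$, $L_{8.8}$, $L_{8.9}$, $L_{8.10}$, $L_{8.11}$, $L_{8.12}$ (with $p\neq 0,1$), $L_{8.20}$ and $L_{8.22}$ defined in the context, for all permitted values of the parameters.
   Context: Each of the following is the real Lie algebra (under the commutator) of all matrices of the displayed form, where the letters $a,b,c,d,e,f,g,h$ run over all real numbers and $p,q$ are fixed real parameters. $L_{8.1}$ ($p\ne0$): $\begin{pmatrix}h&c&-b&0&d\\ -c&h&a&0&e\\ b&-a&h&0&f\\ 0&0&0&ph&pg\\ 0&0&0&0&0\end{pmatrix}$; $L_{8.3}$: $\begin{pmatrix}0&-\frac b2&-\frac c2&-\frac a2&d\\ \frac b2&0&-\frac a2&\frac c2&e\\ \frac c2&\frac a2&0&-\frac b2&f\\ \frac a2&-\frac c2&\frac b2&0&g\\ 0&0&0&0&h\end{pmatrix}$; $L_{8.4}$: $\begin{pmatrix}ph&b&c+h&a&d\\ -b&ph&a&h-c&e\\ -c-h&-a&ph&b&f\\ -a&c-h&-b&ph&g\\ 0&0&0&0&0\end{pmatrix}$; $L_{8.7}$ ($pq\ne0$): $\begin{pmatrix}h+a&b&0&0&d\\ c&h-a&0&0&e\\ 0&0&ph&0&f\\ 0&0&0&qh&g\\ 0&0&0&0&0\end{pmatrix}$; $L_{8.8}$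 ($p$ arbitrary): $\begin{pmatrix}a+h&b&0&0&d\\ c&h-a&0&0&e\\ 0&0&ph&h&f\\ 0&0&0&ph&g\\ 0&0&0&0&0\end{pmatrix}$; $L_{8.9}$ ($q\neq0$): $\begin{pmatrix}a+h&b&0&0&d\\ c&h-a&0&0&e\\ 0&0&ph&qh&f\\ 0&0&-qh&ph&g\\ 0&0&0&0&0\end{pmatrix}$; $L_{8.10}$ ($p\ne0$): $\begin{pmatrix}a+h&b&0&0&d\\ c&h-a&0&0&e\\ -e&d&2h&0&f\\ 0&0&0&ph&pg\\ 0&0&0&0&0\end{pmatrix}$; $L_{8.11}$: $\begin{pmatrix}a+h&b&0&0&d\\ c&h-a&0&0&e\\ -e&d&2h&h&f\\ 0&0&0&2h&g\\ 0&0&0&0&0\end{pmatrix}$; $L_{8.12}$ ($p\neq0$): $\begin{pmatrix}h+2a&2b&0&0&d\\ c&h&b&0&e\\ 0&2c&h-2a&0&f\\ 0&0&0&ph&g\\ 0&0&0&0&0\end{pmatrix}$; $L_{8.20}$: $\begin{pmatrix}h+3a&3b&0&0&d\\ c&h+a&2b&0&e\\ 0&2c&h-a&b&f\\ 0&0&3c&h-3a&g\\ 0&0&0&0&0\end{pmatrix}$; $L_{8.22}$: $\begin{pmatrix}a&b&d&e&g\\ c&-a&f&-d&h\\ 0&0&a&b&0\\ 0&0&c&-a&0\\ 0&0&0&0&0\end{pmatrix}$. *)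

theory Defs
  imports "HOL-Analysis.Analysis" "Jordan_Normal_Form.Matrix"
begin

(* "$" is kept for the components of real^n; JNF vectors are not used here. *)
no_notation vec_index (infixl "$" 100)

definition lie_algebra :: "'a::real_vector set \<Rightarrow> ('a \<Rightarrow> 'a \<Rightarrow> 'a) \<Rightarrow> bool" where
  "lie_algebra L br \<longleftrightarrow>
     subspace L \<and>
     (\<forall>x\<in>L. \<forall>y\<in>L. br x y \<in> L) \<and>
     (\<forall>x\<in>L. \<forall>y\<in>L. \<forall>z\<in>L. br (x + y) z = br x z + br y z) \<and>
     (\<forall>x\<in>L. \<forall>y\<in>L. \<forall>z\<in>L. br x (y + z) = br x y + br x z) \<and>
     (\<forall>r. \<forall>x\<in>L. \<forall>y\<in>L. br (r *\<^sub>R x) y = r *\<^sub>R br x y) \<and>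
     (\<forall>r. \<forall>x\<in>L. \<forall>y\<in>L. br x (r *\<^sub>R y) = r *\<^sub>R br x y) \<and>
     (\<forall>x\<in>L. br x x = 0) \<and>
     (\<forall>x\<in>L. \<forall>y\<in>L. \<forall>z\<in>L. br x (br y z) + br y (br z x) + br z (br x y) = 0)"

(* The dimension of the representation varies inside the definition of mu, so the target
   gl(N,R) is carrier_mat N N, whose matrices carry their size as a value. *)
definition lie_representation ::
    "'a::real_vector set \<Rightarrow> ('a \<Rightarrow> 'a \<Rightarrow> 'a) \<Rightarrow> nat \<Rightarrow> ('a \<Rightarrow> real mat) \<Rightarrow> bool" where
  "lie_representation L br N \<rho> \<longleftrightarrow>
     (\<forall>x\<in>L. \<rho> x \<in> carrier_mat N N) \<and>
     (\<forall>x\<in>L. \<forall>y\<in>L. \<rho> (x + y) = \<rho> x + \<rho> y) \<and>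
     (\<forall>r. \<forall>x\<in>L. \<rho> (r *\<^sub>R x) = r \<cdot>\<^sub>m \<rho> x) \<and>
     (\<forall>x\<in>L. \<forall>y\<in>L. \<rho> (br x y) = \<rho> x * \<rho> y - \<rho> y * \<rho> x)"

definition faithful_lie_representation ::
    "'a::real_vector set \<Rightarrow> ('a \<Rightarrow> 'a \<Rightarrow> 'a) \<Rightarrow> nat \<Rightarrow> ('a \<Rightarrow> real mat) \<Rightarrow> bool" where
  "faithful_lie_representation L br N \<rho> \<longleftrightarrow> lie_representation L br N \<rho> \<and> inj_on \<rho> L"

definition mu :: "'a::real_vector set \<Rightarrow> ('a \<Rightarrow> 'a \<Rightarrow> 'a) \<Rightarrow> nat" where
  "mu L br = (LEAST N. \<exists>\<rho>. faithful_lie_representation L br N \<rho>)"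

definition commutator :: "real^'n^'n \<Rightarrow> real^'n^'n \<Rightarrow> real^'n^'n" where
  "commutator A B = A ** B - B ** A"

lemma lie_algebra_commutatorI:
  fixes L :: "(real^'n^'n) set"
  assumes "subspace L" and "\<And>A B. A \<in> L \<Longrightarrow> B \<in> L \<Longrightarrow> commutator A B \<in> L"
  shows "lie_algebra L commutator"
proof -
  have s: "(r *\<^sub>R A) ** B = r *\<^sub>R (A ** B)" "A ** (r *\<^sub>R B) = r *\<^sub>R (A ** B)"
    for r and A B :: "real^'n^'n"
    by (simp_all add: scalar_matrix_assoc matrix_scalar_ac)
  have d: "A ** (B - C) = A ** B - A ** C" "(B - C) ** A = B ** A - C ** A"
    for A B C :: "real^'n^'n"
    by (simp_all add: matrix_matrix_mult_def Finite_Cartesian_Product.vec_eq_iff sum_subtractf left_diff_distrib right_diff_distrib)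
  have a: "A ** (B + C) = A ** B + A ** C" "(B + C) ** A = B ** A + C ** A"
    for A B C :: "real^'n^'n"
    by (simp_all add: matrix_matrix_mult_def Finite_Cartesian_Product.vec_eq_iff sum.distrib
        distrib_left distrib_right)
  show ?thesis
    using assms unfolding lie_algebra_def
    by (simp add: commutator_def s d a matrix_mul_assoc
        scaleR_diff_right)
qed

lemma exhaust_5:
  fixes x :: 5
  shows "x = 1 \<or> x = 2 \<or> x = 3 \<or> x = 4 \<or> x = 5"
proof (induct x)
  case (of_int z)
  then have "z = 0 \<or> z = 1 \<or> z = 2 \<or> z = 3 \<or> z = 4" by fastforce
  then show ?case by auto
qed

lemma forall_5: "(\<forall>i::5. P i) \<longleftrightarrow> P 1 \<and> P 2 \<and> P 3 \<and> P 4 \<and> P 5"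
  by (metis exhaust_5)

lemma UNIV_5: "(UNIV :: 5 set) = {1, 2, 3, 4, 5}"
  using exhaust_5 by auto

lemma sum_5: "sum f (UNIV :: 5 set) = f 1 + f 2 + f 3 + f 4 + f 5"
  unfolding UNIV_5 by (simp add: ac_simps)

lemma vector_5 [simp]:
  "(vector [u, v, w, x, y] :: ('a::zero)^5) $ 1 = u"
  "(vector [u, v, w, x, y] :: ('a::zero)^5) $ 2 = v"
  "(vector [u, v, w, x, y] :: ('a::zero)^5) $ 3 = w"
  "(vector [u, v, w, x, y] :: ('a::zero)^5) $ 4 = x"
  "(vector [u, v, w, x, y] :: ('a::zero)^5) $ 5 = y"
  unfolding vector_def by simp_all

lemma ex_tuple_8:
  "(\<exists>v :: 'a \<times> 'b \<times> 'c \<times> 'd \<times> 'e \<times> 'f \<times> 'g \<times> 'h. P v) \<longleftrightarrow>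
    (\<exists>a b c d e f g h. P (a, b, c, d, e, f, g, h))"
  by (simp only: split_paired_Ex)

lemma lie_algebra_paramI:
  fixes \<Phi> :: "real \<Rightarrow> real \<Rightarrow> real \<Rightarrow> real \<Rightarrow> real \<Rightarrow> real \<Rightarrow> real \<Rightarrow> real \<Rightarrow> real^'n^'n"
  assumes L: "L = {\<Phi> a b c d e f g h | a b c d e f g h. True}"
    and add: "\<And>a b c d e f g h a' b' c' d' e' f' g' h'.
      \<Phi> (a + a') (b + b') (c + c') (d + d') (e + e') (f + f') (g + g') (h + h') =
      \<Phi> a b c d e f g h + \<Phi> a' b' c' d' e' f' g' h'"
    and scale: "\<And>r a b c d e f g h.
      \<Phi> (r * a) (r * b) (r * c) (r * d) (r * e) (r * f) (r * g) (r * h) = r *\<^sub>R \<Phi> a b c d e f g h"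
    and inv: "\<And>a b c d e f g h. \<Psi> (\<Phi> a b c d e f g h) = (a, b, c, d, e, f, g, h)"
    and comm: "\<And>a b c d e f g h a' b' c' d' e' f' g' h' C.
      C = commutator (\<Phi> a b c d e f g h) (\<Phi> a' b' c' d' e' f' g' h') \<Longrightarrow>
      (case \<Psi> C of (a, b, c, d, e, f, g, h) \<Rightarrow> \<Phi> a b c d e f g h) = C"
  shows "lie_algebra L commutator \<and> dim L = 8"
proof
  define F where "F = (\<lambda>(a, b, c, d, e, f, g, h). \<Phi> a b c d e f g h)"
  have LF: "L = range F"
    unfolding L F_def by (simp add: image_def ex_tuple_8)
  have lin: "linear F"
    by (rule linearI) (auto simp: F_def add scale split: prod.splits)
  have "\<Psi> (F v) = v" for v
    by (auto simp: F_def inv split: prod.splits)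
  then have "inj F"
    by (metis injI)
  then show "dim L = 8"
    unfolding LF using dim_image_eq[OF lin, of UNIV] by simp
  show "lie_algebra L commutator"
  proof (rule lie_algebra_commutatorI)
    show "subspace L"
      unfolding LF by (rule linear_subspace_image[OF lin subspace_UNIV])
    show "commutator A B \<in> L" if AB: "A \<in> L" "B \<in> L" for A B
    proof -
      obtain a b c d e f g h a' b' c' d' e' f' g' h' where
        "A = \<Phi> a b c d e f g h" "B = \<Phi> a' b' c' d' e' f' g' h'"
        using AB unfolding L by blast
      then have "F (\<Psi> (commutator A B)) = commutator A B"
        unfolding F_def by (simp only: comm)
      then show ?thesis
        unfolding LF by (metis rangeI)
    qed
  qed
qed

lemmas param_simps = commutator_def matrix_matrix_mult_def sum_5 Finite_Cartesian_Product.vec_eq_iff forall_5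

definition L8_1 :: "real \<Rightarrow> (real^5^5) set" where
  "L8_1 p = {vector [
      vector [h, c, -b, 0, d],
      vector [-c, h, a, 0, e],
      vector [b, -a, h, 0, f],
      vector [0, 0, 0, p*h, p*g],
      vector [0, 0, 0, 0, 0]]
    | a b c d e f g h. True}"

definition L8_3 :: "(real^5^5) set" where
  "L8_3 = {vector [
      vector [0, -(b/2), -(c/2), -(a/2), d],
      vector [b/2, 0, -(a/2), c/2, e],
      vector [c/2, a/2, 0, -(b/2), f],
      vector [a/2, -(c/2), b/2, 0, g],
      vector [0, 0, 0, 0, h]]
    | a b c d e f g h. True}"

definition L8_4 :: "real \<Rightarrow> (real^5^5) set" where
  "L8_4 p = {vector [
      vector [p*h, b, c+h, a, d],
      vector [-b, p*h, a, h-c, e],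
      vector [-c-h, -a, p*h, b, f],
      vector [-a, c-h, -b, p*h, g],
      vector [0, 0, 0, 0, 0]]
    | a b c d e f g h. True}"

definition L8_7 :: "real \<Rightarrow> real \<Rightarrow> (real^5^5) set" where
  "L8_7 p q = {vector [
      vector [h+a, b, 0, 0, d],
      vector [c, h-a, 0, 0, e],
      vector [0, 0, p*h, 0, f],
      vector [0, 0, 0, q*h, g],
      vector [0, 0, 0, 0, 0]]
    | a b c d e f g h. True}"

definition L8_8 :: "real \<Rightarrow> (real^5^5) set" where
  "L8_8 p = {vector [
      vector [a+h, b, 0, 0, d],
      vector [c, h-a, 0, 0, e],
      vector [0, 0, p*h, h, f],
      vector [0, 0, 0, p*h, g],
      vector [0, 0, 0, 0, 0]]
    | a b c d e f g h. True}"

definition L8_9 :: "real \<Rightarrow> real \<Rightarrow> (real^5^5) set" where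
  "L8_9 p q = {vector [
      vector [a+h, b, 0, 0, d],
      vector [c, h-a, 0, 0, e],
      vector [0, 0, p*h, q*h, f],
      vector [0, 0, -(q*h), p*h, g],
      vector [0, 0, 0, 0, 0]]
    | a b c d e f g h. True}"

definition L8_10 :: "real \<Rightarrow> (real^5^5) set" where
  "L8_10 p = {vector [
      vector [a+h, b, 0, 0, d],
      vector [c, h-a, 0, 0, e],
      vector [-e, d, 2*h, 0, f],
      vector [0, 0, 0, p*h, p*g],
      vector [0, 0, 0, 0, 0]]
    | a b c d e f g h. True}"

definition L8_11 :: "(real^5^5) set" where
  "L8_11 = {vector [
      vector [a+h, b, 0, 0, d],
      vector [c, h-a, 0, 0, e],
      vector [-e, d, 2*h, h, f],
      vector [0, 0, 0, 2*h, g],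
      vector [0, 0, 0, 0, 0]]
    | a b c d e f g h. True}"

definition L8_12 :: "real \<Rightarrow> (real^5^5) set" where
  "L8_12 p = {vector [
      vector [h+2*a, 2*b, 0, 0, d],
      vector [c, h, b, 0, e],
      vector [0, 2*c, h-2*a, 0, f],
      vector [0, 0, 0, p*h, g],
      vector [0, 0, 0, 0, 0]]
    | a b c d e f g h. True}"

definition L8_20 :: "(real^5^5) set" where
  "L8_20 = {vector [
      vector [h+3*a, 3*b, 0, 0, d],
      vector [c, h+a, 2*b, 0, e],
      vector [0, 2*c, h-a, b, f],
      vector [0, 0, 3*c, h-3*a, g],
      vector [0, 0, 0, 0, 0]]
    | a b c d e f g h. True}"

definition L8_22 :: "(real^5^5) set" where
  "L8_22 = {vector [
      vector [a, b, d, e, g],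
      vector [c, -a, f, -d, h],
      vector [0, 0, a, b, 0],
      vector [0, 0, c, -a, 0],
      vector [0, 0, 0, 0, 0]]
    | a b c d e f g h. True}"

lemma lie_algebra_L8_1:
  assumes "p \<noteq> 0"
  shows "lie_algebra (L8_1 p) commutator \<and> dim (L8_1 p) = 8"
  by (rule lie_algebra_paramI[OF L8_1_def, where
        \<Psi> = "\<lambda>M. (M $ 2 $ 3, M $ 3 $ 1, M $ 1 $ 2, M $ 1 $ 5, M $ 2 $ 5, M $ 3 $ 5, M $ 4 $ 5 / p, M $ 1 $ 1)"])
    (use assms in \<open>simp_all add: param_simps\<close>, (simp_all add: field_simps)?)

lemma lie_algebra_L8_3:
  shows "lie_algebra L8_3 commutator \<and> dim L8_3 = 8"
  by (rule lie_algebra_paramI[OF L8_3_def, where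
        \<Psi> = "\<lambda>M. (2*M $ 4 $ 1, 2*M $ 2 $ 1, 2*M $ 3 $ 1, M $ 1 $ 5, M $ 2 $ 5, M $ 3 $ 5, M $ 4 $ 5, M $ 5 $ 5)"])
    (simp_all add: param_simps, (simp_all add: field_simps)?)

lemma lie_algebra_L8_4:
  shows "lie_algebra (L8_4 p) commutator \<and> dim (L8_4 p) = 8"
  by (rule lie_algebra_paramI[OF L8_4_def, where
        \<Psi> = "\<lambda>M. (M $ 1 $ 4, M $ 1 $ 2, (M $ 1 $ 3 - M $ 2 $ 4)/2, M $ 1 $ 5, M $ 2 $ 5, M $ 3 $ 5, M $ 4 $ 5, (M $ 1 $ 3 + M $ 2 $ 4)/2)"])
    (simp_all add: param_simps, (simp_all add: field_simps)?)

lemma lie_algebra_L8_7: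
  shows "lie_algebra (L8_7 p q) commutator \<and> dim (L8_7 p q) = 8"
  by (rule lie_algebra_paramI[OF L8_7_def, where
        \<Psi> = "\<lambda>M. ((M $ 1 $ 1 - M $ 2 $ 2)/2, M $ 1 $ 2, M $ 2 $ 1, M $ 1 $ 5, M $ 2 $ 5, M $ 3 $ 5, M $ 4 $ 5, (M $ 1 $ 1 + M $ 2 $ 2)/2)"])
    (simp_all add: param_simps, (simp_all add: field_simps)?)

lemma lie_algebra_L8_8:
  shows "lie_algebra (L8_8 p) commutator \<and> dim (L8_8 p) = 8"
  by (rule lie_algebra_paramI[OF L8_8_def, where
        \<Psi> = "\<lambda>M. ((M $ 1 $ 1 - M $ 2 $ 2)/2, M $ 1 $ 2, M $ 2 $ 1, M $ 1 $ 5, M $ 2 $ 5, M $ 3 $ 5, M $ 4 $ 5, (M $ 1 $ 1 + M $ 2 $ 2)/2)"])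
    (simp_all add: param_simps, (simp_all add: field_simps)?)

lemma lie_algebra_L8_9:
  shows "lie_algebra (L8_9 p q) commutator \<and> dim (L8_9 p q) = 8"
  by (rule lie_algebra_paramI[OF L8_9_def, where
        \<Psi> = "\<lambda>M. ((M $ 1 $ 1 - M $ 2 $ 2)/2, M $ 1 $ 2, M $ 2 $ 1, M $ 1 $ 5, M $ 2 $ 5, M $ 3 $ 5, M $ 4 $ 5, (M $ 1 $ 1 + M $ 2 $ 2)/2)"])
    (simp_all add: param_simps, (simp_all add: field_simps)?)

lemma lie_algebra_L8_10:
  assumes "p \<noteq> 0"
  shows "lie_algebra (L8_10 p) commutator \<and> dim (L8_10 p) = 8"
  by (rule lie_algebra_paramI[OF L8_10_def, where
        \<Psi> = "\<lambda>M. ((M $ 1 $ 1 - M $ 2 $ 2)/2, M $ 1 $ 2, M $ 2 $ 1, M $ 1 $ 5, M $ 2 $ 5, M $ 3 $ 5, M $ 4 $ 5 / p, (M $ 1 $ 1 + M $ 2 $ 2)/2)"])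
    (use assms in \<open>simp_all add: param_simps\<close>, (simp_all add: field_simps)?)

lemma lie_algebra_L8_11:
  shows "lie_algebra L8_11 commutator \<and> dim L8_11 = 8"
  by (rule lie_algebra_paramI[OF L8_11_def, where
        \<Psi> = "\<lambda>M. ((M $ 1 $ 1 - M $ 2 $ 2)/2, M $ 1 $ 2, M $ 2 $ 1, M $ 1 $ 5, M $ 2 $ 5, M $ 3 $ 5, M $ 4 $ 5, (M $ 1 $ 1 + M $ 2 $ 2)/2)"])
    (simp_all add: param_simps, (simp_all add: field_simps)?)

lemma lie_algebra_L8_12:
  shows "lie_algebra (L8_12 p) commutator \<and> dim (L8_12 p) = 8"
  by (rule lie_algebra_paramI[OF L8_12_def, where
        \<Psi> = "\<lambda>M. ((M $ 1 $ 1 - M $ 2 $ 2)/2, M $ 2 $ 3, M $ 2 $ 1, M $ 1 $ 5, M $ 2 $ 5, M $ 3 $ 5, M $ 4 $ 5, M $ 2 $ 2)"])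
    (simp_all add: param_simps, (simp_all add: field_simps)?)

lemma lie_algebra_L8_20:
  shows "lie_algebra L8_20 commutator \<and> dim L8_20 = 8"
  by (rule lie_algebra_paramI[OF L8_20_def, where
        \<Psi> = "\<lambda>M. ((M $ 1 $ 1 - M $ 2 $ 2)/2, M $ 3 $ 4, M $ 2 $ 1, M $ 1 $ 5, M $ 2 $ 5, M $ 3 $ 5, M $ 4 $ 5, (M $ 2 $ 2 + M $ 3 $ 3)/2)"])
    (simp_all add: param_simps, (simp_all add: field_simps)?)

lemma lie_algebra_L8_22:
  shows "lie_algebra L8_22 commutator \<and> dim L8_22 = 8"
  by (rule lie_algebra_paramI[OF L8_22_def, where
        \<Psi> = "\<lambda>M. (M $ 1 $ 1, M $ 1 $ 2, M $ 2 $ 1, M $ 1 $ 3, M $ 1 $ 4, M $ 2 $ 3, M $ 1 $ 5, M $ 2 $ 5)"])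
    (simp_all add: param_simps, (simp_all add: field_simps)?)

end

theory Submission
  imports Defs
begin

text \<open>
  Complexify a representation of degree at most 4 to complex 4 by 4 matrices.  Each algebra contains
  \<open>sl\<^sub>2\<close> or \<open>so\<^sub>3\<close>, so the complexified image contains an \<open>sl\<^sub>2\<close>-triple, under which the 4-dimensional module has
  irreducible constituents of dimensions 4, 3+1, 2+2, 2+1+1 or 1+1+1+1.  The radical must embed into
  \<open>gl\<^sub>4\<close> with the adjoint action.  There the weight 3 does not occur, and the weight 1 occurs only for
  2+1+1, where the elements commuting with \<open>sl\<^sub>2\<close> and with a vector of weight 1 form too small an
  algebra, and where the only three-dimensional constituent is not abelian.  An abelian
  three-dimensional constituent, together with two noncommuting elements that commute with \<open>sl\<^sub>2\<close>,
  requires 2+2, and then \<open>p = 1\<close>.  For the algebras over \<open>so\<^sub>3\<close> the types 2+1+1 and 2+2 do arise over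
  the complex numbers; over the reals the quaternions then act on the module without the trivial
  constituents.  So this has dimension divisible by 4, which excludes 2+1+1, and for 2+2 it is
  irreducible, so that the common kernel of the nilpotent abelian constituent is everything.
\<close>

section \<open>Commutators and nilpotent elements of the 4 by 4 matrices\<close>

text \<open>The classification of the triples uses neither eigenvectors nor complete reducibility.
  Nilpotency of \<open>E\<close> yields highest weight vectors directly: the values of the last
  nonzero power of \<open>E\<close> all have one known weight. In dimension 4 the remaining
  complement is small enough to be corrected by hand. The exception \<open>p = 1\<close> for
  \<open>L8_12\<close> is genuine. There the algebra acts faithfully on the tensor product of two
  planes: by sl2 on the first plane, by gl2 on the first tensored with a nilpotent N on the second,
  and by a diagonal element of the second plane whose bracket with N is N. \<open>L8_1\<close> with
  \<open>p = 1\<close> has the same complexification, so no argument about complex matrices alone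
  can exclude it. This is why the compact case returns to real matrices, where a sum of squares
  vanishes only if every term does.\<close>

definition cm :: "complex^4^4 \<Rightarrow> complex^4^4 \<Rightarrow> complex^4^4" where
  "cm X Y = X ** Y - Y ** X"

lemma mat_diff_distrib:
  fixes A B C :: "'a::ring_1^'n^'n"
  shows "A ** (B - C) = A ** B - A ** C" "(B - C) ** A = B ** A - C ** A"
  by (simp_all add: matrix_matrix_mult_def Finite_Cartesian_Product.vec_eq_iff sum_subtractf left_diff_distrib right_diff_distrib)

lemma mat_add_distrib:
  fixes A B C :: "'a::ring_1^'n^'n"
  shows "A ** (B + C) = A ** B + A ** C" "(B + C) ** A = B ** A + C ** A"
  by (simp_all add: matrix_matrix_mult_def Finite_Cartesian_Product.vec_eq_iff sum.distrib distrib_left distrib_right)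

text \<open>Complex scalars act as products with scalar matrices, because \<open>*\<^sub>R\<close>
  admits only real factors.\<close>

abbreviation Mat :: "'a::zero \<Rightarrow> 'a^4^4" where "Mat \<equiv> Finite_Cartesian_Product.mat"

lemma cayley_hamilton_4:
  fixes X :: "complex^4^4"
  shows "\<exists>a b c d. X ** X ** X ** X = Mat a ** (X ** X ** X) + Mat b ** (X ** X) + Mat c ** X + Mat d"
proof -
  let ?x = "\<lambda>i j. X $ i $ j"
  \<comment> \<open>The coefficients are, up to sign, the sums of the principal minors:
    \<open>a\<close> is the trace, \<open>s\<close> and \<open>t\<close> are the principal minors of
    orders 2 and 3, and \<open>m\<close> gives the minors in the expansion of the determinant
    \<open>-d\<close> along the first row.\<close>
  define a where "a = ?x 1 1 + ?x 2 2 + ?x 3 3 + ?x 4 4"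
  define s where "s i j = ?x i i * ?x j j - ?x i j * ?x j i" for i j
  define b where "b = -(s 1 2 + s 1 3 + s 1 4 + s 2 3 + s 2 4 + s 3 4)"
  define t where "t i j k = ?x i i * (?x j j * ?x k k - ?x j k * ?x k j) - ?x i j * (?x j i * ?x k k - ?x j k * ?x k i)
     + ?x i k * (?x j i * ?x k j - ?x j j * ?x k i)" for i j k
  define c where "c = t 1 2 3 + t 1 2 4 + t 1 3 4 + t 2 3 4"
  define m where "m i j k = ?x 2 i * (?x 3 j * ?x 4 k - ?x 3 k * ?x 4 j) - ?x 2 j * (?x 3 i * ?x 4 k - ?x 3 k * ?x 4 i)
     + ?x 2 k * (?x 3 i * ?x 4 j - ?x 3 j * ?x 4 i)" for i j k
  define d where "d = - (?x 1 1 * m 2 3 4 - ?x 1 2 * m 1 3 4 + ?x 1 3 * m 1 2 4 - ?x 1 4 * m 1 2 3)"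
  have e: "(A ** B) $ i $ j = A $ i $ 1 * B $ 1 $ j + A $ i $ 2 * B $ 2 $ j + A $ i $ 3 * B $ 3 $ j + A $ i $ 4 * B $ 4 $ j"
    for A B :: "complex^4^4" and i j
    by (simp add: matrix_matrix_mult_def sum_4)
  have f: "(Mat a ** A) $ i $ j = a * A $ i $ j" for A a i j
    by (simp add: matrix_matrix_mult_def Finite_Cartesian_Product.mat_def if_distrib if_distribR sum.delta cong: if_cong)
  have "(X ** X ** X ** X) $ i $ j = (Mat a ** (X ** X ** X) + Mat b ** (X ** X) + Mat c ** X + Mat d) $ i $ j" for i j
    using exhaust_4[of i] exhaust_4[of j]
    unfolding vector_add_component f e Finite_Cartesian_Product.mat_def a_def b_def c_def d_def t_def m_def s_def
    by (elim disjE) (simp_all add: algebra_simps)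
  then show ?thesis unfolding Finite_Cartesian_Product.vec_eq_iff by blast
qed

lemma cm_mult_right: "cm H (X ** Y) = cm H X ** Y + X ** cm H Y"
  by (simp add: cm_def mat_diff_distrib matrix_mul_assoc)

lemma scaleR_mult_mat:
  fixes A B :: "complex^4^4"
  shows "(k *\<^sub>R A) ** B = k *\<^sub>R (A ** B)" "A ** (k *\<^sub>R B) = k *\<^sub>R (A ** B)"
  by (simp_all add: scalar_matrix_assoc matrix_scalar_ac)

lemma scaleR_complex: "k *\<^sub>R z = complex_of_real k * z"
  by (rule scaleR_conv_of_real)

lemma cm_add_right: "cm H (X + Y) = cm H X + cm H Y"
  by (simp add: cm_def mat_add_distrib)

lemma Mat_mult_nth: "(Mat a ** A) $ i $ j = a * A $ i $ j" for A :: "complex^4^4"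
  by (simp add: matrix_matrix_mult_def Finite_Cartesian_Product.mat_def if_distrib if_distribR sum.delta cong: if_cong)

lemma mult_Mat_nth: "(A ** Mat a) $ i $ j = a * A $ i $ j" for A :: "complex^4^4"
  by (simp add: matrix_matrix_mult_def Finite_Cartesian_Product.mat_def if_distrib if_distribR sum.delta cong: if_cong)

lemma Mat_commute: "Mat a ** A = A ** Mat a" for A :: "complex^4^4"
  by (simp add: Finite_Cartesian_Product.vec_eq_iff Mat_mult_nth mult_Mat_nth)

lemma cm_Mat [simp]: "cm H (Mat a) = 0"
  by (simp add: cm_def Mat_commute)

text \<open>Since \<open>cm H\<close> scales \<open>X\<^sup>j\<close> by \<open>j * k\<close>, applying it repeatedly to the Cayley-Hamilton relation
  gives a Vandermonde system that isolates \<open>X\<^sup>4\<close>.\<close>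

lemma weight_nilpotent:
  assumes w: "cm H X = k *\<^sub>R X" and k: "k \<noteq> 0"
  shows "X ** X ** X ** X = 0"
proof -
  have w2: "cm H (X ** X) = (2*k) *\<^sub>R (X ** X)"
    by (simp add: cm_mult_right w scaleR_mult_mat scaleR_add_left[symmetric])
  have w3: "cm H (X ** X ** X) = (3*k) *\<^sub>R (X ** X ** X)"
    by (simp add: cm_mult_right[of H "X ** X"] w2 w scaleR_mult_mat scaleR_add_left[symmetric])
  have w4: "cm H (X ** X ** X ** X) = (4*k) *\<^sub>R (X ** X ** X ** X)"
    by (simp add: cm_mult_right[of H "X ** X ** X"] w3 w scaleR_mult_mat scaleR_add_left[symmetric])
  obtain a b c d where ch: "X ** X ** X ** X = Mat a ** (X ** X ** X) + Mat b ** (X ** X) + Mat c ** X + Mat d"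
    using cayley_hamilton_4 by blast
  have s: "cm H (Mat e ** M) = Mat e ** cm H M" for e M
    by (simp add: cm_mult_right)
  have r: "cm H (r *\<^sub>R M) = r *\<^sub>R cm H M" for r M
    by (simp add: cm_def scaleR_mult_mat scaleR_diff_right)
  have d1: "(4*k) *\<^sub>R (X ** X ** X ** X) = Mat a ** ((3*k) *\<^sub>R (X ** X ** X)) + Mat b ** ((2*k) *\<^sub>R (X ** X)) + Mat c ** (k *\<^sub>R X)"
    using arg_cong[OF ch, of "cm H"] by (simp add: cm_add_right s w w2 w3 w4)
  have d2: "(4*k) *\<^sub>R (4*k) *\<^sub>R (X ** X ** X ** X)
    = Mat a ** ((3*k) *\<^sub>R (3*k) *\<^sub>R (X ** X ** X))
      + Mat b ** ((2*k) *\<^sub>R (2*k) *\<^sub>R (X ** X))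
      + Mat c ** (k *\<^sub>R k *\<^sub>R X)"
    using arg_cong[OF d1, of "cm H"] by (simp only: cm_add_right s r w w2 w3 w4)
  have d3: "(4*k) *\<^sub>R (4*k) *\<^sub>R (4*k) *\<^sub>R (X ** X ** X ** X)
    = Mat a ** ((3*k) *\<^sub>R (3*k) *\<^sub>R (3*k) *\<^sub>R (X ** X ** X))
      + Mat b ** ((2*k) *\<^sub>R (2*k) *\<^sub>R (2*k) *\<^sub>R (X ** X))
      + Mat c ** (k *\<^sub>R k *\<^sub>R k *\<^sub>R X)"
    using arg_cong[OF d2, of "cm H"] by (simp only: cm_add_right s r w w2 w3 w4)
  have d4: "(4*k) *\<^sub>R (4*k) *\<^sub>R (4*k) *\<^sub>R (4*k) *\<^sub>R (X ** X ** X ** X)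
    = Mat a ** ((3*k) *\<^sub>R (3*k) *\<^sub>R (3*k) *\<^sub>R (3*k) *\<^sub>R (X ** X ** X))
      + Mat b ** ((2*k) *\<^sub>R (2*k) *\<^sub>R (2*k) *\<^sub>R (2*k) *\<^sub>R (X ** X))
      + Mat c ** (k *\<^sub>R k *\<^sub>R k *\<^sub>R k *\<^sub>R X)"
    using arg_cong[OF d3, of "cm H"] by (simp only: cm_add_right s r w w2 w3 w4)
  have "(X ** X ** X ** X) $ i $ j = 0" for i j
  proof -
    define u v w x where "u = (X ** X ** X ** X) $ i $ j" and "v = a * (X ** X ** X) $ i $ j"
      and "w = b * (X ** X) $ i $ j" and "x = c * X $ i $ j"
    have *: "M = N \<Longrightarrow> M $ i $ j = N $ i $ j" for M N :: "complex^4^4" by simp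
    have "complex_of_real k * (4 * u - 3 * v - 2 * w - x) = 0"
      using *[OF d1] by (simp add: Mat_mult_nth u_def v_def w_def x_def scaleR_complex algebra_simps)
    then have 1: "4 * u - 3 * v - 2 * w - x = 0" using k by simp
    have "complex_of_real k ^ 2 * (16 * u - 9 * v - 4 * w - x) = 0"
      using *[OF d2] by (simp add: Mat_mult_nth u_def v_def w_def x_def scaleR_complex algebra_simps power2_eq_square)
    then have 2: "16 * u - 9 * v - 4 * w - x = 0" using k by simp
    have "complex_of_real k ^ 3 * (64 * u - 27 * v - 8 * w - x) = 0"
      using *[OF d3] by (simp add: Mat_mult_nth u_def v_def w_def x_def scaleR_complex algebra_simps power3_eq_cube)
    then have 3: "64 * u - 27 * v - 8 * w - x = 0" using k by simp
    have "complex_of_real k ^ 4 * (256 * u - 81 * v - 16 * w - x) = 0"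
      using *[OF d4] by (simp add: Mat_mult_nth u_def v_def w_def x_def scaleR_complex algebra_simps power4_eq_xxxx)
    then have 4: "256 * u - 81 * v - 16 * w - x = 0" using k by simp
    \<comment> \<open>The coefficients 1, -6, 11, -6 are those of t(t - 1)(t - 2)(t - 3), which
      vanishes at 1, 2, 3 and equals 24 at 4.\<close>
    have "24 * u = (256 * u - 81 * v - 16 * w - x) - 6 * (64 * u - 27 * v - 8 * w - x)
        + 11 * (16 * u - 9 * v - 4 * w - x) - 6 * (4 * u - 3 * v - 2 * w - x)"
      by (simp add: algebra_simps)
    then show ?thesis unfolding 1 2 3 4 by (simp add: u_def)
  qed
  then show ?thesis by (simp add: Finite_Cartesian_Product.vec_eq_iff)
qed

section \<open>Bases and change of basis in dimension 4\<close>

lemma fourth_vector: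
  fixes v1 v2 v3 :: "complex^4"
  shows "\<exists>u. u \<notin> vec.span {v1, v2, v3}"
proof (rule ccontr)
  assume "\<not> ?thesis"
  then have "vec.span {v1, v2, v3} = (UNIV :: (complex^4) set)" by auto
  then have "vec.dim (UNIV :: (complex^4) set) \<le> card {v1, v2, v3}"
    by (intro vec.dim_le_card) auto
  also have "\<dots> \<le> 3"
    by (simp add: card_insert_if)
  finally have "CARD(4) \<le> 3" unfolding vec_dim_card .
  then show False by simp
qed

definition indep4 :: "'a::field^4 \<Rightarrow> 'a^4 \<Rightarrow> 'a^4 \<Rightarrow> 'a^4 \<Rightarrow> bool" where
  "indep4 v1 v2 v3 v4 \<longleftrightarrow>
    (\<forall>a b c d. a *s v1 + b *s v2 + c *s v3 + d *s v4 = 0 \<longrightarrow> a = 0 \<and> b = 0 \<and> c = 0 \<and> d = 0)"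

definition matrix_wrt ::
  "'a::field^4 \<Rightarrow> 'a^4 \<Rightarrow> 'a^4 \<Rightarrow> 'a^4 \<Rightarrow> 'a^4^4 \<Rightarrow> 'a^4^4 \<Rightarrow> bool" where
  "matrix_wrt v1 v2 v3 v4 M M0 \<longleftrightarrow>
    M *v v1 = M0 $ 1 $ 1 *s v1 + M0 $ 2 $ 1 *s v2 + M0 $ 3 $ 1 *s v3 + M0 $ 4 $ 1 *s v4 \<and>
    M *v v2 = M0 $ 1 $ 2 *s v1 + M0 $ 2 $ 2 *s v2 + M0 $ 3 $ 2 *s v3 + M0 $ 4 $ 2 *s v4 \<and>
    M *v v3 = M0 $ 1 $ 3 *s v1 + M0 $ 2 $ 3 *s v2 + M0 $ 3 $ 3 *s v3 + M0 $ 4 $ 3 *s v4 \<and>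
    M *v v4 = M0 $ 1 $ 4 *s v1 + M0 $ 2 $ 4 *s v2 + M0 $ 3 $ 4 *s v3 + M0 $ 4 $ 4 *s v4"

text \<open>Independence says that the matrix \<open>P\<close> with these columns has trivial
  kernel, hence is invertible; \<open>matrix_wrt\<close> is \<open>M ** P = P ** M0\<close> read
  column by column. The field is arbitrary because both the complex normal forms and the real
  quaternion span rely on it.\<close>

lemma basis_change:
  fixes v1 v2 v3 v4 :: "'a::field^4"
  assumes indep: "indep4 v1 v2 v3 v4"
  obtains P Q where "P ** Q = Mat 1" "Q ** P = Mat 1"
    "\<And>M M0. matrix_wrt v1 v2 v3 v4 M M0 \<Longrightarrow> Q ** M ** P = M0"
    "\<And>x. \<exists>a b c d. x = a *s v1 + b *s v2 + c *s v3 + d *s v4"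
proof -
  define w :: "4 \<Rightarrow> 'a^4" where "w j = (if j = 1 then v1 else if j = 2 then v2 else if j = 3 then v3 else v4)" for j
  define P :: "'a^4^4" where "P = (\<chi> i j. w j $ i)"
  have w: "w 1 = v1" "w 2 = v2" "w 3 = v3" "w 4 = v4"
    by (simp_all add: w_def)
  have Pv: "P *v x = x $ 1 *s v1 + x $ 2 *s v2 + x $ 3 *s v3 + x $ 4 *s v4" for x
    by (simp add: Finite_Cartesian_Product.vec_eq_iff matrix_vector_mult_def P_def sum_4 w mult.commute)
  have "\<forall>x. P *v x = 0 \<longrightarrow> x = 0"
  proof (intro allI impI)
    fix x assume "P *v x = 0"
    then show "x = 0"
      using indep unfolding Pv indep4_def
      by (metis (no_types) exhaust_4 Finite_Cartesian_Product.vec_eq_iff zero_index)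
  qed
  then have "\<exists>Q. Q ** P = Mat 1"
    by (rule matrix_left_invertible_ker[THEN iffD2])
  then obtain Q where Q: "Q ** P = Mat 1" by blast
  then have Q': "P ** Q = Mat 1"
    by (rule matrix_left_right_inverse[THEN iffD1])
  have col: "(M ** P) $ i $ j = (M *v w j) $ i" for M :: "'a^4^4" and i j
    by (simp add: matrix_matrix_mult_def matrix_vector_mult_def P_def)
  have col': "(P ** M0) $ i $ j = M0 $ 1 $ j * v1 $ i + M0 $ 2 $ j * v2 $ i + M0 $ 3 $ j * v3 $ i + M0 $ 4 $ j * v4 $ i" for M0 :: "'a^4^4" and i j
    by (simp add: matrix_matrix_mult_def sum_4 P_def w mult.commute)
  show ?thesis
  proof (rule that[OF Q' Q])
    fix M M0 :: "'a^4^4"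
    assume "matrix_wrt v1 v2 v3 v4 M M0"
    then have "(M ** P) $ i $ j = (P ** M0) $ i $ j" for i j
      using exhaust_4[of j] unfolding col col' matrix_wrt_def by (elim disjE) (simp_all add: w)
    then have "M ** P = P ** M0"
      by (simp add: Finite_Cartesian_Product.vec_eq_iff)
    then have "Q ** (M ** P) = Q ** (P ** M0)" by simp
    then show "Q ** M ** P = M0"
      by (simp add: matrix_mul_assoc Q)
  next
    fix x
    have "P *v (Q *v x) = x" by (simp add: matrix_vector_mul_assoc Q')
    then show "\<exists>a b c d. x = a *s v1 + b *s v2 + c *s v3 + d *s v4"
      unfolding Pv by metis
  qed
qed

section \<open>Classification of the triples\<close>

lemma vector_4 [simp]:
  "(vector [u, v, w, x] :: ('a::zero)^4) $ 1 = u"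
  "(vector [u, v, w, x] :: ('a::zero)^4) $ 2 = v"
  "(vector [u, v, w, x] :: ('a::zero)^4) $ 3 = w"
  "(vector [u, v, w, x] :: ('a::zero)^4) $ 4 = x"
  unfolding vector_def by simp_all

definition sl2_triple :: "complex^4^4 \<Rightarrow> complex^4^4 \<Rightarrow> complex^4^4 \<Rightarrow> bool" where
  "sl2_triple E F H \<longleftrightarrow> cm H E = 2 *\<^sub>R E \<and> cm H F = (-2) *\<^sub>R F \<and> cm E F = H"

definition diag4 :: "complex \<Rightarrow> complex \<Rightarrow> complex \<Rightarrow> complex \<Rightarrow> complex^4^4" where
  "diag4 a b c d = vector [vector [a, 0, 0, 0], vector [0, b, 0, 0], vector [0, 0, c, 0], vector [0, 0, 0, d]]"

definition sup4 :: "complex \<Rightarrow> complex \<Rightarrow> complex \<Rightarrow> complex^4^4" where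
  "sup4 a b c = vector [vector [0, a, 0, 0], vector [0, 0, b, 0], vector [0, 0, 0, c], vector [0, 0, 0, 0]]"

definition sub4 :: "complex \<Rightarrow> complex \<Rightarrow> complex \<Rightarrow> complex^4^4" where
  "sub4 a b c = vector [vector [0, 0, 0, 0], vector [a, 0, 0, 0], vector [0, b, 0, 0], vector [0, 0, c, 0]]"

text \<open>In the basis v, F v, F^2 v, ... of an irreducible module of highest weight n,
  \<open>F\<close> has entries 1 and \<open>E\<close> has the entries k(n - k + 1): 3, 4, 3 for n =
  3 and 2, 2 for n = 2. A zero on the secondary diagonal separates two constituents.\<close>

definition type_4 where "type_4 E F H \<longleftrightarrow> E = sup4 3 4 3 \<and> F = sub4 1 1 1 \<and> H = diag4 3 1 (-1) (-3)"
definition type_31 where "type_31 E F H \<longleftrightarrow> E = sup4 2 2 0 \<and> F = sub4 1 1 0 \<and> H = diag4 2 0 (-2) 0"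
definition type_22 where "type_22 E F H \<longleftrightarrow> E = sup4 1 0 1 \<and> F = sub4 1 0 1 \<and> H = diag4 1 (-1) 1 (-1)"
definition type_211 where "type_211 E F H \<longleftrightarrow> E = sup4 1 0 0 \<and> F = sub4 1 0 0 \<and> H = diag4 1 (-1) 0 0"

lemma scaleR_mat_vec:
  fixes A :: "complex^4^4"
  shows "(k *\<^sub>R A) *v x = complex_of_real k *s (A *v x)"
  by (simp add: Finite_Cartesian_Product.vec_eq_iff matrix_vector_mult_def sum_distrib_left mult.assoc scaleR_complex)

lemmas vec_component = vector_add_component vector_minus_component vector_smult_component zero_index vector_uminus_component

lemma mult_vec_neg: "A *v (- x) = - (A *v x)" for A :: "complex^4^4"
  by (simp add: Finite_Cartesian_Product.vec_eq_iff matrix_vector_mult_def sum_negf)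

lemma indep4_span:
  assumes u: "u \<notin> vec.span {v1, v2, v3}"
    and *: "\<And>a b c. a *s v1 + b *s v2 + c *s v3 = 0 \<Longrightarrow> a = 0 \<and> b = 0 \<and> c = 0"
  shows "indep4 v1 v2 v3 u"
  unfolding indep4_def
proof (intro allI impI)
  fix a b c d assume that: "a *s v1 + b *s v2 + c *s v3 + d *s u = 0"
  have sp: "v1 \<in> vec.span {v1, v2, v3}" "v2 \<in> vec.span {v1, v2, v3}" "v3 \<in> vec.span {v1, v2, v3}"
    by (simp_all add: vec.span_base)
  have d: "d = 0"
  proof (rule ccontr)
    assume "d \<noteq> 0"
    have "d *s u = - (a *s v1 + b *s v2 + c *s v3)"
      using that by (simp add: add_eq_0_iff)
    also have "\<dots> \<in> vec.span {v1, v2, v3}"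
      by (intro vec.span_neg vec.span_add vec.span_scale sp)
    finally have "(1 / d) *s (d *s u) \<in> vec.span {v1, v2, v3}"
      by (rule vec.span_scale)
    with \<open>d \<noteq> 0\<close> u show False by simp
  qed
  with that *[of a b c] show "a = 0 \<and> b = 0 \<and> c = 0 \<and> d = 0" by simp
qed

lemma sl2_triple_vec:
  assumes "sl2_triple E F H"
  shows "H *v (E *v x) = E *v (H *v x) + 2 *s (E *v x)"
    "H *v (F *v x) = F *v (H *v x) - 2 *s (F *v x)"
    "E *v (F *v x) = F *v (E *v x) + H *v x"
proof -
  have *: "cm X Y *v x = X *v (Y *v x) - Y *v (X *v x)" for X Y
    by (simp add: cm_def matrix_vector_mult_diff_rdistrib matrix_vector_mul_assoc)
  have s: "cm H E = 2 *\<^sub>R E" "cm H F = (-2) *\<^sub>R F" "cm E F = H"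
    using assms by (auto simp: sl2_triple_def)
  show "H *v (E *v x) = E *v (H *v x) + 2 *s (E *v x)"
    using *[of H E] unfolding s scaleR_mat_vec by (simp add: algebra_simps)
  show "E *v (F *v x) = F *v (E *v x) + H *v x"
    using *[of E F] unfolding s by (simp add: algebra_simps)
  have "(-2) *s (F *v x) = - (2 *s (F *v x))"
    by (simp add: Finite_Cartesian_Product.vec_eq_iff)
  then show "H *v (F *v x) = F *v (H *v x) - 2 *s (F *v x)"
    using *[of H F] unfolding s scaleR_mat_vec by (simp add: algebra_simps)
qed

lemma sl2_nilpotent:
  assumes "sl2_triple E F H"
  shows "E *v (E *v (E *v (E *v x))) = 0" "F *v (F *v (F *v (F *v x))) = 0"
proof -
  have "E ** E ** E ** E = 0" "F ** F ** F ** F = 0"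
    by (rule weight_nilpotent[of H _ 2] weight_nilpotent[of H _ "-2"]; use assms in \<open>simp add: sl2_triple_def\<close>)+
  then show "E *v (E *v (E *v (E *v x))) = 0" "F *v (F *v (F *v (F *v x))) = 0"
    by (metis matrix_vector_mul_assoc matrix_vector_mult_0)+
qed

lemma vec_eqI:
  fixes x y :: "'a^'n"
  shows "(\<And>i. x $ i = y $ i) \<Longrightarrow> x = y"
  by (simp add: Finite_Cartesian_Product.vec_eq_iff)

lemma numeral_mult_vec: "numeral n * (x :: complex^4) = numeral n *s x"
  by (rule vec_eqI) simp

lemma comp_eq:
  fixes x y :: "complex^4"
  assumes "x = y"
  shows "x $ i = y $ i"
  using assms by simp

text \<open>In general E^(n+1) F x = F E^(n+1) x + (n+1) E^n (H + n) x. If E^(n+1) = 0, then v = E^n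
  x satisfies E^n H x = -n v, and therefore H v = n v. Here n = 3, and v with its images under
  \<open>F\<close> fills the space.\<close>

lemma sl2_type_4:
  assumes sl: "sl2_triple E F H" and x: "E *v (E *v (E *v x)) \<noteq> 0"
  shows "\<exists>P Q. P ** Q = Mat 1 \<and> Q ** P = Mat 1 \<and> type_4 (Q ** E ** P) (Q ** F ** P) (Q ** H ** P)"
proof -
  note r = sl2_triple_vec[OF sl] and n = sl2_nilpotent[OF sl]
  note ds = numeral_mult_vec mult_vec_neg vector_scalar_commute matrix_vector_right_distrib matrix_vector_mult_diff_distrib
  define v where "v = E *v (E *v (E *v x))"
  have v0: "v \<noteq> 0" using x by (simp add: v_def)
  have Ev: "E *v v = 0" by (simp add: v_def n)
  define a where "a = E *v (E *v (E *v (H *v x)))"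
  have "E *v (E *v (E *v (E *v (F *v x)))) = 4 *s (a + 3 *s v)" 
    by (simp add: r(3) ds n r(1) a_def v_def Finite_Cartesian_Product.vec_eq_iff)
  then have "0 = 4 *s (a + 3 *s v)"
    unfolding n .
  then have e: "a + 3 *s v = 0"
    by (metis vec.scale_eq_0_iff zero_neq_numeral)
  have H0: "H *v v = a + 6 *s v"
    by (simp add: r(1) ds a_def v_def Finite_Cartesian_Product.vec_eq_iff)
  have Hv: "H *v v = 3 *s v"
  proof (rule vec_eqI)
    fix i
    show "(H *v v) $ i = (3 *s v) $ i"
      using comp_eq[OF e, of i] comp_eq[OF H0, of i] unfolding vec_component by (auto simp: complex_eq_iff)
  qed
  define v1 v2 v3 where "v1 = F *v v" and "v2 = F *v v1" and "v3 = F *v v2"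
  have F: "F *v v = v1" "F *v v1 = v2" "F *v v2 = v3" "F *v v3 = 0"
    by (simp_all add: v1_def v2_def v3_def n)
  have H: "H *v v1 = 1 *s v1" "H *v v2 = (-1) *s v2" "H *v v3 = (-3) *s v3"
    by (simp_all add: v1_def v2_def v3_def r(2) ds Hv Finite_Cartesian_Product.vec_eq_iff)
  have E: "E *v v1 = 3 *s v" "E *v v2 = 4 *s v1" "E *v v3 = 3 *s v2"
    by (simp_all add: v1_def v2_def v3_def r(2) r(3) ds Hv Ev Finite_Cartesian_Product.vec_eq_iff)
  have indep: "indep4 v v1 v2 v3"
    unfolding indep4_def
  proof (intro allI impI)
    fix a b c d assume that: "a *s v + b *s v1 + c *s v2 + d *s v3 = 0"
    \<comment> \<open>Applying \<open>E\<close> three times, twice and once isolates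
      \<open>d\<close>, \<open>c\<close> and \<open>b\<close> in turn.\<close>
    have 1: "E *v (a *s v + b *s v1 + c *s v2 + d *s v3) = (3*b) *s v + (4*c) *s v1 + (3*d) *s v2"
      by (simp add: ds E Ev mult.commute)
    have 2: "E *v ((3*b) *s v + (4*c) *s v1 + (3*d) *s v2) = (12*c) *s v + (12*d) *s v1"
      by (simp add: ds E Ev mult.commute)
    have 3: "E *v ((12*c) *s v + (12*d) *s v1) = (36*d) *s v"
      by (simp add: ds E Ev mult.commute)
    have "d = 0" using 1 2 3 v0 unfolding that by simp
    moreover have "c = 0" using 1 2 v0 \<open>d = 0\<close> unfolding that by simp
    moreover have "b = 0" using 1 v0 \<open>d = 0\<close> \<open>c = 0\<close> unfolding that by simp
    moreover have "a = 0" using that v0 calculation by simp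
    ultimately show "a = 0 \<and> b = 0 \<and> c = 0 \<and> d = 0" by blast
  qed
  obtain P Q where PQ: "P ** Q = Mat 1" "Q ** P = Mat 1"
    "\<And>M M0. matrix_wrt v v1 v2 v3 M M0 \<Longrightarrow> Q ** M ** P = M0"
    by (rule basis_change[OF indep]) blast
  have "type_4 (Q ** E ** P) (Q ** F ** P) (Q ** H ** P)"
    unfolding type_4_def by (intro conjI; rule PQ(3)) (simp_all add: matrix_wrt_def sup4_def sub4_def diag4_def E F H Hv Ev)
  then show ?thesis using PQ by blast
qed

text \<open>The same computation with n = 2 gives a submodule of dimension 3. An invariant
  complement is found by writing the images of an arbitrary outside vector with unknown coordinates:
  the relations of the triple force these images to be those of a vector of the submodule, which is
  then subtracted.\<close>

lemma sl2_type_31: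
  assumes sl: "sl2_triple E F H" and E3: "\<And>x. E *v (E *v (E *v x)) = 0" and x: "E *v (E *v x) \<noteq> 0"
  shows "\<exists>P Q. P ** Q = Mat 1 \<and> Q ** P = Mat 1 \<and> type_31 (Q ** E ** P) (Q ** F ** P) (Q ** H ** P)"
proof -
  note r = sl2_triple_vec[OF sl] and n = sl2_nilpotent[OF sl]
  note ds = numeral_mult_vec mult_vec_neg vector_scalar_commute matrix_vector_right_distrib matrix_vector_mult_diff_distrib
  define v where "v = E *v (E *v x)"
  have v0: "v \<noteq> 0" using x by (simp add: v_def)
  have Ev: "E *v v = 0" by (simp add: v_def E3)
  define a where "a = E *v (E *v (H *v x))"
  have "E *v (E *v (E *v (F *v x))) = 3 *s (a + 2 *s v)" 
    by (simp add: r(3) ds E3 r(1) a_def v_def Finite_Cartesian_Product.vec_eq_iff)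
  then have "0 = 3 *s (a + 2 *s v)"
    unfolding E3 .
  then have e: "a + 2 *s v = 0"
    by (metis vec.scale_eq_0_iff zero_neq_numeral)
  have H0: "H *v v = a + 4 *s v"
    by (simp add: r(1) ds a_def v_def Finite_Cartesian_Product.vec_eq_iff)
  have Hv: "H *v v = 2 *s v"
  proof (rule vec_eqI)
    fix i
    show "(H *v v) $ i = (2 *s v) $ i"
      using comp_eq[OF e, of i] comp_eq[OF H0, of i] unfolding vec_component by (auto simp: complex_eq_iff)
  qed
  define v1 v2 v3 where "v1 = F *v v" and "v2 = F *v v1" and "v3 = F *v v2"
  have F: "F *v v = v1" "F *v v1 = v2"
    by (simp_all add: v1_def v2_def)
  have H: "H *v v1 = 0" "H *v v2 = (-2) *s v2" "H *v v3 = (-4) *s v3"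
    by (simp_all add: v1_def v2_def v3_def r(2) ds Hv Finite_Cartesian_Product.vec_eq_iff)
  have E: "E *v v1 = 2 *s v" "E *v v2 = 2 *s v1" "E *v v3 = 0"
    by (simp_all add: v1_def v2_def v3_def r(2) r(3) ds Hv Ev Finite_Cartesian_Product.vec_eq_iff)
  \<comment> \<open>\<open>v3\<close> has weight -4, but \<open>E\<close> kills it and
    \<open>F\<close> does so as well because F^4 = 0, so its weight would also be 0.\<close>
  have "H *v v3 = 0"
    using r(3)[of v3] by (simp add: E) (simp add: v3_def v2_def v1_def n)
  then have "v3 = 0" using H(3) by simp
  then have Fv2: "F *v v2 = 0" by (simp add: v3_def)
  obtain u0 where u0: "u0 \<notin> vec.span {v, v1, v2}" using fourth_vector by blast
  have sp: "v \<in> vec.span {v, v1, v2}" "v1 \<in> vec.span {v, v1, v2}" "v2 \<in> vec.span {v, v1, v2}"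
    by (simp_all add: vec.span_base)
  have indep: "indep4 v v1 v2 u" if u: "u \<notin> vec.span {v, v1, v2}" for u
  proof (rule indep4_span[OF u])
    fix a b c
    assume that: "a *s v + b *s v1 + c *s v2 = 0"
    have 1: "E *v (a *s v + b *s v1 + c *s v2) = (2*b) *s v + (2*c) *s v1"
      by (simp add: ds E Ev mult.commute)
    have 2: "E *v ((2*b) *s v + (2*c) *s v1) = (4*c) *s v"
      by (simp add: ds E Ev mult.commute)
    have "c = 0" using 1 2 v0 unfolding that by simp
    moreover have "b = 0" using 1 v0 \<open>c = 0\<close> unfolding that by simp
    moreover have "a = 0" using that v0 calculation by simp
    ultimately show "a = 0 \<and> b = 0 \<and> c = 0" by blast
  qed
  have indep0: "a = 0 \<and> b = 0 \<and> c = 0 \<and> d = 0"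
    if "a *s v + b *s v1 + c *s v2 + d *s u0 = 0" for a b c d
    using indep[OF u0] that unfolding indep4_def by blast
  have dec: "\<exists>a b c d. x = a *s v + b *s v1 + c *s v2 + d *s u0" for x
    by (rule basis_change[OF indep[OF u0]]) blast
  obtain a1 b1 c1 d1 where Eu0: "E *v u0 = a1 *s v + b1 *s v1 + c1 *s v2 + d1 *s u0" using dec by blast
  obtain a2 b2 c2 d2 where Fu0: "F *v u0 = a2 *s v + b2 *s v1 + c2 *s v2 + d2 *s u0" using dec by blast
  obtain a3 b3 c3 d3 where Hu0: "H *v u0 = a3 *s v + b3 *s v1 + c3 *s v2 + d3 *s u0" using dec by blast
  note act = Eu0 Fu0 Hu0 E F H Hv Ev Fv2 ds
  \<comment> \<open>The coefficient of \<open>u0\<close> in E^3 u0 is d1^3, and in F^4 u0 it is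
    d2^4; both powers vanish.\<close>
  have "(4 * c1 + 2 * b1 * d1 + a1 * d1 * d1) *s v + (2 * c1 * d1 + b1 * d1 * d1) *s v1 + (c1 * d1 * d1) *s v2 + (d1 * d1 * d1) *s u0
      = E *v (E *v (E *v u0))"
    by (simp add: act) (simp add: Finite_Cartesian_Product.vec_eq_iff algebra_simps)
  then have d1: "d1 = 0" unfolding E3 using indep0 by fastforce
  have "(a2 * d2 * d2 * d2) *s v + (b2 * d2 * d2 * d2 + a2 * d2 * d2) *s v1 + (c2 * d2 * d2 * d2 + b2 * d2 * d2 + a2 * d2) *s v2 + (d2 * d2 * d2 * d2) *s u0
      = F *v (F *v (F *v (F *v u0)))"
    by (simp add: act) (simp add: Finite_Cartesian_Product.vec_eq_iff algebra_simps)
  then have d2: "d2 = 0" unfolding n using indep0 by fastforce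
  have "(2 * b2 - a3) *s v + (2 * c2 - a1 - b3) *s v1 + (- b1 - c3) *s v2 + (- d3) *s u0 = E *v (F *v u0) - F *v (E *v u0) - H *v u0"
    by (simp add: act d1 d2) (simp add: Finite_Cartesian_Product.vec_eq_iff algebra_simps)
  also have "\<dots> = 0" using r(3)[of u0] by simp
  finally have 3: "2 * b2 - a3 = 0" "2 * c2 - a1 - b3 = 0" "- b1 - c3 = 0" "d3 = 0" using indep0 by fastforce+
  have "(- 2 * b3) *s v + (- 2 * c3 - 2 * b1) *s v1 + (- 4 * c1) *s v2 + 0 *s u0 = H *v (E *v u0) - E *v (H *v u0) - 2 *s (E *v u0)"
    by (simp add: act d1 d2 \<open>d3 = 0\<close>) (simp add: Finite_Cartesian_Product.vec_eq_iff algebra_simps)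
  also have "\<dots> = 0" using r(1)[of u0] by simp
  finally have 4: "b3 = 0" "c1 = 0" using indep0 by fastforce+
  have "(4 * a2) *s v + (2 * b2 - a3) *s v1 + (- b3) *s v2 + 0 *s u0 = H *v (F *v u0) - F *v (H *v u0) + 2 *s (F *v u0)"
    by (simp add: act d1 d2 \<open>d3 = 0\<close>) (simp add: Finite_Cartesian_Product.vec_eq_iff algebra_simps)
  also have "\<dots> = 0" using r(2)[of u0] by simp
  finally have 5: "a2 = 0" using indep0 by fastforce
  \<comment> \<open>The subtracted vector has the same images as \<open>u0\<close> under
    \<open>E\<close>, \<open>F\<close> and \<open>H\<close>. The half compensates for
    \<open>E *v v2 = 2 *s v1\<close>.\<close>
  define u where "u = u0 - (b2 *s v + c2 *s v1 + (b1 / 2) *s v2)"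
  have a1: "a1 = 2 * c2" and a3: "a3 = 2 * b2" and c3: "c3 = - b1"
    using 3 4 by (simp_all add: eq_neg_iff_add_eq_0 add.commute)
  have "u0 = u + (b2 *s v + c2 *s v1 + (b1 / 2) *s v2)" by (simp add: u_def)
  moreover have "b2 *s v + c2 *s v1 + (b1 / 2) *s v2 \<in> vec.span {v, v1, v2}"
    by (intro vec.span_add vec.span_scale sp)
  ultimately have us: "u \<notin> vec.span {v, v1, v2}"
    using u0 vec.span_add by metis
  have u: "E *v u = 0" "F *v u = 0" "H *v u = 0"
    unfolding u_def
    by (simp_all add: act d1 d2 \<open>d3 = 0\<close> 4 5 a1 a3 c3)
  obtain P Q where PQ: "P ** Q = Mat 1" "Q ** P = Mat 1"
    "\<And>M M0. matrix_wrt v v1 v2 u M M0 \<Longrightarrow> Q ** M ** P = M0"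
    by (rule basis_change[OF indep[OF us]]) blast
  have "type_31 (Q ** E ** P) (Q ** F ** P) (Q ** H ** P)"
    unfolding type_31_def by (intro conjI; rule PQ(3)) (simp_all add: matrix_wrt_def sup4_def sub4_def diag4_def E F H Hv Ev Fv2 u)
  then show ?thesis using PQ by blast
qed

context
  fixes E F H :: "complex^4^4"
  assumes sl: "sl2_triple E F H" and E2: "\<And>x. E *v (E *v x) = 0"
begin

text \<open>For E^2 = 0 every value of \<open>E\<close> has weight 1. Feeding this back into the
  relations gives F^2 = 0 and H^3 = H, so the weights are 1, 0, -1, and H^2 = EF + FE is the
  projection onto the nontrivial part.\<close>

lemma raise_square_zero:
  shows "H *v (E *v x) = E *v x" "2 *s (F *v (E *v x)) = H *v (H *v x) - H *v x"
    "H *v (F *v x) = - (F *v x)" "F *v (F *v x) = 0"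
    "H *v (H *v x) = E *v (F *v x) + F *v (E *v x)"
    "H *v (H *v (H *v x)) = H *v x"
proof -
  note r = sl2_triple_vec[OF sl]
  note ds = numeral_mult_vec mult_vec_neg vector_scalar_commute matrix_vector_right_distrib matrix_vector_mult_diff_distrib
  have 1: "H *v (E *v x) = E *v x" for x
  proof (rule vec_eqI)
    fix i
    have A: "E *v (E *v (F *v x)) = 2 *s (E *v (H *v x)) + 2 *s (E *v x)"
      by (simp add: r(3) ds r(1) E2 Finite_Cartesian_Product.vec_eq_iff)
    show "(H *v (E *v x)) $ i = (E *v x) $ i"
      using comp_eq[OF A[unfolded E2], of i] comp_eq[OF r(1)[of x], of i] unfolding vec_component by (auto simp: complex_eq_iff)
  qed
  have 2: "H *v (F *v (E *v x)) = - (F *v (E *v x))" for x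
    using r(2)[of "E *v x"] unfolding 1 by (simp add: Finite_Cartesian_Product.vec_eq_iff)
  have 3: "2 *s (F *v (E *v x)) = H *v (H *v x) - H *v x" for x
  proof (rule vec_eqI)
    fix i
    show "(2 *s (F *v (E *v x))) $ i = (H *v (H *v x) - H *v x) $ i"
      using comp_eq[OF 1[of "F *v x", unfolded r(3) ds 2], of i] unfolding vec_component by (auto simp: complex_eq_iff)
  qed
  have 4: "H *v (H *v (H *v x)) = H *v x" for x
  proof (rule vec_eqI)
    fix i
    show "(H *v (H *v (H *v x))) $ i = (H *v x) $ i"
      using comp_eq[OF arg_cong[OF 3[of x], of "\<lambda>y. H *v y", unfolded ds 2], of i] comp_eq[OF 3[of x], of i]
      unfolding vec_component by (auto simp: complex_eq_iff)
  qed
  have 5: "F *v (H *v x) = F *v x" for x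
  proof (rule vec_eqI)
    fix i
    have A: "2 *s (F *v (E *v (F *v x))) = H *v (H *v (F *v x)) - H *v (F *v x)" by (rule 3)
    have B: "2 *s (F *v (F *v (E *v x))) = F *v (H *v (H *v x)) - F *v (H *v x)"
      using arg_cong[OF 3[of x], of "\<lambda>y. F *v y"] unfolding ds .
    show "(F *v (H *v x)) $ i = (F *v x) $ i"
      using comp_eq[OF A[unfolded r(3) r(2) ds], of i] comp_eq[OF B, of i] unfolding vec_component by (auto simp: complex_eq_iff)
  qed
  have 6: "H *v (F *v x) = - (F *v x)" for x
    using r(2)[of x] unfolding 5 by (simp add: Finite_Cartesian_Product.vec_eq_iff)
  show "H *v (E *v x) = E *v x" "2 *s (F *v (E *v x)) = H *v (H *v x) - H *v x"
    "H *v (F *v x) = - (F *v x)" "H *v (H *v (H *v x)) = H *v x"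
    by (fact 1 3 6 4)+
  show "F *v (F *v x) = 0"
  proof (rule vec_eqI)
    fix i
    show "(F *v (F *v x)) $ i = 0 $ i"
      using comp_eq[OF 5[of "F *v x", unfolded r(2) ds 5], of i] unfolding vec_component by (auto simp: complex_eq_iff)
  qed
  show "H *v (H *v x) = E *v (F *v x) + F *v (E *v x)"
  proof (rule vec_eqI)
    fix i
    show "(H *v (H *v x)) $ i = (E *v (F *v x) + F *v (E *v x)) $ i"
      using comp_eq[OF r(3)[of x], of i] comp_eq[OF 3[of x], of i] unfolding vec_component by (auto simp: complex_eq_iff)
  qed
qed

text \<open>Each nonzero E y spans, together with F E y, a copy of the standard module. If the
  values of \<open>E\<close> do not lie on one line, two such copies fill the space; otherwise H^2
  maps into the single copy spanned by \<open>v\<close> and \<open>w\<close>, and the rest is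
  trivial.\<close>

lemma sl2_type_22_or_211:
  assumes x: "E *v x \<noteq> 0"
  shows "\<exists>P Q. P ** Q = Mat 1 \<and> Q ** P = Mat 1 \<and>
    (type_22 (Q ** E ** P) (Q ** F ** P) (Q ** H ** P) \<or> type_211 (Q ** E ** P) (Q ** F ** P) (Q ** H ** P))"
proof -
  note r = sl2_triple_vec[OF sl]
  note ds = numeral_mult_vec mult_vec_neg vector_scalar_commute matrix_vector_right_distrib matrix_vector_mult_diff_distrib
  have EF: "E *v (F *v (E *v y)) = E *v y" for y
    by (simp add: r(3) E2 raise_square_zero)
  define v where "v = E *v x"
  define w where "w = F *v v"
  have v0: "v \<noteq> 0" using x by (simp add: v_def)
  have act: "E *v v = 0" "H *v v = v" "F *v v = w" "F *v w = 0" "E *v w = v" "H *v w = - w"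
    by (simp_all add: v_def w_def E2 raise_square_zero EF)
  show ?thesis
  proof (cases "\<exists>y. E *v y \<notin> vec.span {v}")
    case True
    then obtain y where y: "E *v y \<notin> vec.span {v}" by blast
    define v' where "v' = E *v y"
    define w' where "w' = F *v v'"
    have act': "E *v v' = 0" "H *v v' = v'" "F *v v' = w'" "F *v w' = 0" "E *v w' = v'" "H *v w' = - w'"
      by (simp_all add: v'_def w'_def E2 raise_square_zero EF)
    have two: "a = 0 \<and> b = 0" if "a *s v + b *s v' = 0" for a b
    proof -
      have b: "b = 0"
      proof (rule ccontr)
        assume "b \<noteq> 0"
        have "v' = (- a / b) *s v"
        proof -
          have "b *s v' = (- a) *s v" using that by (simp add: add_eq_0_iff)
          then have "(1 / b) *s (b *s v') = (1 / b) *s ((- a) *s v)" by simp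
          then show ?thesis using \<open>b \<noteq> 0\<close> by simp
        qed
        then show False using y vec.span_scale vec.span_base v'_def by (metis singletonI)
      qed
      then show ?thesis using that v0 by simp
    qed
    have indep: "indep4 v w v' w'"
      unfolding indep4_def
    proof (intro allI impI)
      fix a b c d assume *: "a *s v + b *s w + c *s v' + d *s w' = 0"
      have "E *v (a *s v + b *s w + c *s v' + d *s w') = b *s v + d *s v'"
        by (simp add: ds act act')
      then have "b = 0 \<and> d = 0" using two unfolding * by simp
      moreover from this have "a = 0 \<and> c = 0" using two * by simp
      ultimately show "a = 0 \<and> b = 0 \<and> c = 0 \<and> d = 0" by blast
    qed
    obtain P Q where PQ: "P ** Q = Mat 1" "Q ** P = Mat 1"
      "\<And>M M0. matrix_wrt v w v' w' M M0 \<Longrightarrow> Q ** M ** P = M0"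
      by (rule basis_change[OF indep]) blast
    have "type_22 (Q ** E ** P) (Q ** F ** P) (Q ** H ** P)"
      unfolding type_22_def by (intro conjI; rule PQ(3)) (simp_all add: matrix_wrt_def sup4_def sub4_def diag4_def act act')
    then show ?thesis using PQ by blast
  next
    case False
    then have img: "E *v y \<in> vec.span {v}" for y by blast
    have HH: "H *v (H *v y) \<in> vec.span {v, w, z}" for y z
    proof -
      obtain k where k: "E *v (F *v y) = k *s v" using img[of "F *v y"] by (auto simp: vec.span_singleton)
      obtain l where l: "E *v y = l *s v" using img[of y] by (auto simp: vec.span_singleton)
      have "H *v (H *v y) = k *s v + l *s w"
        by (simp add: raise_square_zero(5) k l ds act)
      then show ?thesis
        by (simp add: vec.span_add vec.span_scale vec.span_base)
    qed
    \<comment> \<open>Since H^3 = H, the map 1 - H^2 sends every vector to an invariant one. The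
      free vector \<open>z\<close> lets the same claim supply both invariant vectors: first with
      \<open>z = 0\<close>, then with the first of them as \<open>z\<close>.\<close>
    have ker: "\<exists>u. u \<notin> vec.span {v, w, z} \<and> E *v u = 0 \<and> F *v u = 0 \<and> H *v u = 0" for z
    proof -
      obtain u0 where u0: "u0 \<notin> vec.span {v, w, z}" using fourth_vector by blast
      define u where "u = u0 - H *v (H *v u0)"
      have H: "H *v u = 0" by (simp add: u_def ds raise_square_zero(6))
      have E: "E *v u = 0"
        using r(1)[of u] unfolding raise_square_zero(1) H by (simp add: Finite_Cartesian_Product.vec_eq_iff)
      have F: "F *v u = 0"
        using r(2)[of u] unfolding raise_square_zero(3) H by (simp add: Finite_Cartesian_Product.vec_eq_iff)
      have "u0 = u + H *v (H *v u0)" by (simp add: u_def)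
      then have "u \<notin> vec.span {v, w, z}"
        using u0 HH vec.span_add by metis
      then show ?thesis using E F H by blast
    qed
    obtain u1 where u1: "u1 \<notin> vec.span {v, w, 0}" "E *v u1 = 0" "F *v u1 = 0" "H *v u1 = 0"
      using ker[of 0] by blast
    obtain u2 where u2: "u2 \<notin> vec.span {v, w, u1}" "E *v u2 = 0" "F *v u2 = 0" "H *v u2 = 0"
      using ker by blast
    have indep: "indep4 v w u1 u2"
    proof (rule indep4_span[OF u2(1)])
      fix a b c assume *: "a *s v + b *s w + c *s u1 = 0"
      have "E *v (a *s v + b *s w + c *s u1) = b *s v"
        by (simp add: ds act u1)
      then have b: "b = 0" using v0 unfolding * by simp
      have "F *v (a *s v + b *s w + c *s u1) = a *s w"
        by (simp add: ds act u1)
      moreover have "w \<noteq> 0" using act(5) v0 by auto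
      ultimately have a: "a = 0" unfolding * by simp
      have "u1 \<noteq> 0" using u1(1) vec.span_zero by blast
      then have "c = 0" using * a b by simp
      with a b show "a = 0 \<and> b = 0 \<and> c = 0" by blast
    qed
    obtain P Q where PQ: "P ** Q = Mat 1" "Q ** P = Mat 1"
      "\<And>M M0. matrix_wrt v w u1 u2 M M0 \<Longrightarrow> Q ** M ** P = M0"
      by (rule basis_change[OF indep]) blast
    have "type_211 (Q ** E ** P) (Q ** F ** P) (Q ** H ** P)"
      unfolding type_211_def by (intro conjI; rule PQ(3)) (simp_all add: matrix_wrt_def sup4_def sub4_def diag4_def act u1 u2)
    then show ?thesis using PQ by blast
  qed
qed

end

theorem sl2_classification:
  assumes sl: "sl2_triple E F H"
  obtains "E = 0" "F = 0" "H = 0"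
  | P Q where "P ** Q = Mat 1" "Q ** P = Mat 1" "type_4 (Q ** E ** P) (Q ** F ** P) (Q ** H ** P)"
  | P Q where "P ** Q = Mat 1" "Q ** P = Mat 1" "type_31 (Q ** E ** P) (Q ** F ** P) (Q ** H ** P)"
  | P Q where "P ** Q = Mat 1" "Q ** P = Mat 1" "type_22 (Q ** E ** P) (Q ** F ** P) (Q ** H ** P)"
  | P Q where "P ** Q = Mat 1" "Q ** P = Mat 1" "type_211 (Q ** E ** P) (Q ** F ** P) (Q ** H ** P)"
proof -
  \<comment> \<open>The digit is the largest exponent for which the power of \<open>E\<close> is
    nonzero, which is the highest weight that occurs.\<close>
  consider (e3) x where "E *v (E *v (E *v x)) \<noteq> 0"
    | (e2) x where "\<And>y. E *v (E *v (E *v y)) = 0" "E *v (E *v x) \<noteq> 0"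
    | (e1) x where "\<And>y. E *v (E *v y) = 0" "E *v x \<noteq> 0"
    | (e0) "\<And>y. E *v y = 0"
    by metis
  then show thesis
  proof cases
    case e3
    then show ?thesis using sl2_type_4[OF sl] that(2) by blast
  next
    case e2
    then show ?thesis using sl2_type_31[OF sl] that(3) by blast
  next
    case e1
    then show ?thesis using sl2_type_22_or_211[OF sl] that(4,5) by blast
  next
    case e0
    have E: "E = 0" by (simp add: matrix_eq e0)
    then have H: "H = 0" using sl by (simp add: sl2_triple_def cm_def)
    then have "F = 0" using sl by (simp add: sl2_triple_def cm_def)
    with E H show ?thesis using that(1) by blast
  qed
qed

section \<open>Constituents of the adjoint action\<close>

lemma conj_mult:
  assumes "P ** Q = Mat 1"
  shows "(Q ** X ** P) ** (Q ** Y ** P) = Q ** (X ** Y) ** P"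
proof -
  have "(Q ** X ** P) ** (Q ** Y ** P) = Q ** X ** (P ** Q) ** Y ** P"
    by (simp add: matrix_mul_assoc)
  then show ?thesis by (simp add: assms matrix_mul_assoc)
qed

lemma conj_cm:
  assumes "P ** Q = Mat 1"
  shows "cm (Q ** X ** P) (Q ** Y ** P) = Q ** cm X Y ** P"
  by (simp add: cm_def conj_mult[OF assms] mat_diff_distrib)

lemma conj_eq_iff:
  assumes "P ** Q = Mat 1"
  shows "Q ** X ** P = Q ** Y ** P \<longleftrightarrow> X = Y"
proof
  assume "Q ** X ** P = Q ** Y ** P"
  then have "P ** (Q ** X ** P) ** Q = P ** (Q ** Y ** P) ** Q" by simp
  moreover have "P ** (Q ** Z ** P) ** Q = Z" for Z
  proof -
    have "P ** (Q ** Z ** P) ** Q = (P ** Q) ** Z ** (P ** Q)" by (simp add: matrix_mul_assoc)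
    then show ?thesis by (simp add: assms)
  qed
  ultimately show "X = Y" by simp
qed simp

lemma conj_zero_iff:
  assumes "P ** Q = Mat 1"
  shows "Q ** X ** P = 0 \<longleftrightarrow> X = 0"
  using conj_eq_iff[OF assms, of X 0] by simp

lemma conj_scaleR: "Q ** (k *\<^sub>R X) ** P = k *\<^sub>R (Q ** X ** P)"
  for P Q X :: "complex^4^4"
  by (simp only: scaleR_mult_mat)

lemma conj_add: "Q ** (X + Y) ** P = Q ** X ** P + Q ** Y ** P"
  for P Q X :: "complex^4^4"
  by (simp add: mat_add_distrib)

lemma conj_Mat:
  fixes P Q :: "complex^4^4"
  assumes "Q ** P = Mat 1"
  shows "Q ** Mat a ** P = Mat a"
proof -
  have "Q ** Mat a ** P = Mat a ** (Q ** P)"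
    by (simp only: Mat_commute[of a Q, symmetric] matrix_mul_assoc)
  then show ?thesis by (simp add: assms)
qed

lemma conj_Mat_mult: "Q ** (Mat a ** X) ** P = Mat a ** (Q ** X ** P)" for P Q X :: "complex^4^4"
proof -
  have "Q ** (Mat a ** X) ** P = (Q ** Mat a) ** X ** P"
    by (simp only: matrix_mul_assoc)
  also have "\<dots> = Mat a ** (Q ** X ** P)"
    by (simp only: Mat_commute[of a Q, symmetric] matrix_mul_assoc)
  finally show ?thesis .
qed

text \<open>Bracketing with a diagonal matrix scales the entry (i, j) by the difference of the
  diagonal entries i and j. Having weight k thus becomes a condition on the support of a matrix, and
  all weight spaces below are read off from it.\<close>

lemma diag_weight:
  assumes "cm (diag4 a b c d) D = k *\<^sub>R D"
  shows "(vector [a, b, c, d] $ i - vector [a, b, c, d] $ j - of_real k) * D $ i $ j = 0"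
proof -
  have "cm (diag4 a b c d) D $ i $ j = (vector [a, b, c, d] $ i - vector [a, b, c, d] $ j) * D $ i $ j"
    using exhaust_4[of i] exhaust_4[of j]
    by (elim disjE) (simp_all add: cm_def diag4_def matrix_matrix_mult_def sum_4 algebra_simps)
  then show ?thesis
    unfolding assms by (simp add: scaleR_complex algebra_simps)
qed

lemmas mat4_eq = Finite_Cartesian_Product.vec_eq_iff forall_4

lemma diag_weight_all:
  assumes "cm (diag4 a b c d) D = k *\<^sub>R D"
  shows "\<forall>i j. (vector [a, b, c, d] $ i - vector [a, b, c, d] $ j - of_real k) * D $ i $ j = 0"
  using diag_weight[OF assms] by blast

text \<open>In these types the diagonal entries of \<open>H\<close> all have the same parity, so
  their differences are even.\<close>

lemma odd_weight_zero:
  assumes "type_4 E F H \<or> type_31 E F H \<or> type_22 E F H" "k = 1 \<or> k = 3" "cm H D = k *\<^sub>R D"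
  shows "D = 0"
proof -
  have "H = diag4 3 1 (-1) (-3) \<or> H = diag4 2 0 (-2) 0 \<or> H = diag4 1 (-1) 1 (-1)"
    using assms(1) by (auto simp: type_4_def type_31_def type_22_def)
  then have "\<forall>i j. D $ i $ j = 0"
  proof (elim disjE)
    assume "H = diag4 3 1 (-1) (-3)"
    from diag_weight_all[OF assms(3)[unfolded this]] show ?thesis
      using assms(2) unfolding forall_4 vector_4 by (elim disjE) simp_all
  next
    assume "H = diag4 2 0 (-2) 0"
    from diag_weight_all[OF assms(3)[unfolded this]] show ?thesis
      using assms(2) unfolding forall_4 vector_4 by (elim disjE) simp_all
  next
    assume "H = diag4 1 (-1) 1 (-1)"
    from diag_weight_all[OF assms(3)[unfolded this]] show ?thesis
      using assms(2) unfolding forall_4 vector_4 by (elim disjE) simp_all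
  qed
  then show ?thesis by (simp add: Finite_Cartesian_Product.vec_eq_iff)
qed

lemma no_weight_3:
  assumes sl: "sl2_triple E F H" and D: "cm H D = 3 *\<^sub>R D"
  shows "D = 0"
  using sl
proof (cases rule: sl2_classification)
  case 1
  then show ?thesis using D by (simp add: cm_def)
next
  case (2 P Q)
  have "cm (Q ** H ** P) (Q ** D ** P) = 3 *\<^sub>R (Q ** D ** P)"
    by (simp only: conj_cm[OF 2(1)] D conj_scaleR)
  then show ?thesis
    using odd_weight_zero 2 conj_zero_iff by metis
next
  case (3 P Q)
  have "cm (Q ** H ** P) (Q ** D ** P) = 3 *\<^sub>R (Q ** D ** P)"
    by (simp only: conj_cm[OF 3(1)] D conj_scaleR)
  then show ?thesis
    using odd_weight_zero 3 conj_zero_iff by metis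
next
  case (4 P Q)
  have "cm (Q ** H ** P) (Q ** D ** P) = 3 *\<^sub>R (Q ** D ** P)"
    by (simp only: conj_cm[OF 4(1)] D conj_scaleR)
  then show ?thesis
    using odd_weight_zero 4 conj_zero_iff by metis
next
  case (5 P Q)
  \<comment> \<open>Here the diagonal entries 1, -1, 0, 0 mix parities, but their differences stay
    between -2 and 2.\<close>
  have *: "cm (Q ** H ** P) (Q ** D ** P) = 3 *\<^sub>R (Q ** D ** P)"
    by (simp only: conj_cm[OF 5(1)] D conj_scaleR)
  have "Q ** H ** P = diag4 1 (-1) 0 0" using 5 by (simp add: type_211_def)
  from diag_weight_all[OF *[unfolded this]] have "Q ** D ** P = 0"
    unfolding mat4_eq vector_4 by auto
  then show ?thesis
    using 5 conj_zero_iff by metis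
qed

section \<open>Weight 1 and the type 2+1+1\<close>

lemma odd_weight_type_211:
  assumes sl: "sl2_triple E F H" and D: "cm H D = D" "D \<noteq> 0"
  obtains P Q where "P ** Q = Mat 1" "Q ** P = Mat 1" "type_211 (Q ** E ** P) (Q ** F ** P) (Q ** H ** P)"
  using sl
proof (cases rule: sl2_classification)
  case 1
  then show ?thesis using D by (simp add: cm_def)
next
  case (2 P Q)
  have "cm (Q ** H ** P) (Q ** D ** P) = 1 *\<^sub>R (Q ** D ** P)"
    by (simp only: conj_cm[OF 2(1)] D scaleR_one)
  then show ?thesis
    using odd_weight_zero 2 D conj_zero_iff by metis
next
  case (3 P Q)
  have "cm (Q ** H ** P) (Q ** D ** P) = 1 *\<^sub>R (Q ** D ** P)"
    by (simp only: conj_cm[OF 3(1)] D scaleR_one)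
  then show ?thesis
    using odd_weight_zero 3 D conj_zero_iff by metis
next
  case (4 P Q)
  have "cm (Q ** H ** P) (Q ** D ** P) = 1 *\<^sub>R (Q ** D ** P)"
    by (simp only: conj_cm[OF 4(1)] D scaleR_one)
  then show ?thesis
    using odd_weight_zero 4 D conj_zero_iff by metis
next
  case (5 P Q)
  then show ?thesis using that by blast
qed

text \<open>What survives is a row, the entries (1,3) and (1,4), mapping the trivial plane to the
  highest weight vector, and a column, the entries (3,2) and (4,2), mapping the lowest weight vector
  to the trivial plane.\<close>

lemma type_211_weight_1:
  assumes "type_211 E F H" "cm H D = D"
  shows "D $ 1 $ 1 = 0" "D $ 1 $ 2 = 0" "D $ 2 $ 1 = 0" "D $ 2 $ 2 = 0" "D $ 2 $ 3 = 0" "D $ 2 $ 4 = 0"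
    "D $ 3 $ 1 = 0" "D $ 3 $ 3 = 0" "D $ 3 $ 4 = 0" "D $ 4 $ 1 = 0" "D $ 4 $ 3 = 0" "D $ 4 $ 4 = 0"
proof -
  have "cm (diag4 1 (-1) 0 0) D = 1 *\<^sub>R D" using assms by (simp add: type_211_def)
  from diag_weight_all[OF this]
  show "D $ 1 $ 1 = 0" "D $ 1 $ 2 = 0" "D $ 2 $ 1 = 0" "D $ 2 $ 2 = 0" "D $ 2 $ 3 = 0" "D $ 2 $ 4 = 0"
    "D $ 3 $ 1 = 0" "D $ 3 $ 3 = 0" "D $ 3 $ 4 = 0" "D $ 4 $ 1 = 0" "D $ 4 $ 3 = 0" "D $ 4 $ 4 = 0"
    unfolding forall_4 vector_4 by auto
qed

text \<open>Schur's lemma in coordinates: a scalar on the standard constituent and an arbitrary 2 by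
  2 block on the trivial plane.\<close>

lemma type_211_commutant:
  assumes "type_211 E F H" "cm E Z = 0" "cm F Z = 0"
  shows "Z $ 1 $ 2 = 0" "Z $ 1 $ 3 = 0" "Z $ 1 $ 4 = 0" "Z $ 2 $ 1 = 0" "Z $ 2 $ 3 = 0" "Z $ 2 $ 4 = 0"
    "Z $ 3 $ 1 = 0" "Z $ 3 $ 2 = 0" "Z $ 4 $ 1 = 0" "Z $ 4 $ 2 = 0" "Z $ 2 $ 2 = Z $ 1 $ 1"
  using assms
  by (auto simp: type_211_def mat4_eq cm_def matrix_matrix_mult_def sum_4 sup4_def sub4_def)

text \<open>In a basis where the row (p, q) is (1, 0), a traceless matrix killed by it on the left
  is a multiple of the elementary matrix in position (2,1). A second matrix killed by the same row
  and commuting with it then has zero entry (2,2), so it is proportional to the first.\<close>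

lemma annihilator_2x2:
  fixes a b c d :: complex
  assumes p: "p \<noteq> 0 \<or> q \<noteq> 0"
    and f: "p * a + q * c = 0" "p * b + q * d = 0" "a + d = 0" "a \<noteq> 0 \<or> b \<noteq> 0 \<or> c \<noteq> 0 \<or> d \<noteq> 0"
    and g: "p * a' + q * c' = 0" "p * b' + q * d' = 0"
    and comm: "b * c' = b' * c" "a * b' + b * d' = a' * b + b' * d" "c * a' + d * c' = c' * a + d' * c"
  shows "\<exists>z. a' = z * a \<and> b' = z * b \<and> c' = z * c \<and> d' = z * d"
proof -
  have d: "d = - a" using f(3) by (simp add: eq_neg_iff_add_eq_0 add.commute)
  show ?thesis
  proof (cases "p = 0")
    case True
    then have "q \<noteq> 0" using p by blast
    then have "c = 0" "d = 0" "c' = 0" "d' = 0" using f g True by auto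
    then show ?thesis using f comm d by (intro exI[of _ "b' / b"]) auto
  next
    case False
    define t where "t = q / p"
    have t: "q = p * t" using False by (simp add: t_def)
    have "a = - (t * c)" "b = - (t * d)" "a' = - (t * c')" "b' = - (t * d')"
      using f g False unfolding t by (simp_all add: mult.assoc distrib_left[symmetric] eq_neg_iff_add_eq_0)
    note e = this
    have d2: "d = t * c" using d e(1) by simp
    have c0: "c \<noteq> 0" using f(4) e d2 by auto
    have "c * (d' - t * c') = 0"
      using comm(3) unfolding e d2 by (auto simp add: algebra_simps)
    then have "d' = t * c'" using c0 by simp
    then show ?thesis using c0 e d2 by (intro exI[of _ "c' / c"]) simp
  qed
qed

lemma Mat_nth: "Mat a $ i $ j = (if i = j then a else 0)"
  by (simp add: Finite_Cartesian_Product.mat_def)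

lemma cm_nth: "cm X Y $ i $ j =
    X $ i $ 1 * Y $ 1 $ j + X $ i $ 2 * Y $ 2 $ j + X $ i $ 3 * Y $ 3 $ j + X $ i $ 4 * Y $ 4 $ j -
    (Y $ i $ 1 * X $ 1 $ j + Y $ i $ 2 * X $ 2 $ j + Y $ i $ 3 * X $ 3 $ j + Y $ i $ 4 * X $ 4 $ j)"
  by (simp add: cm_def matrix_matrix_mult_def sum_4)

lemma mat4_eqI:
  fixes X Y :: "complex^4^4"
  assumes "X $ 1 $ 1 = Y $ 1 $ 1" "X $ 1 $ 2 = Y $ 1 $ 2" "X $ 1 $ 3 = Y $ 1 $ 3" "X $ 1 $ 4 = Y $ 1 $ 4"
    "X $ 2 $ 1 = Y $ 2 $ 1" "X $ 2 $ 2 = Y $ 2 $ 2" "X $ 2 $ 3 = Y $ 2 $ 3" "X $ 2 $ 4 = Y $ 2 $ 4"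
    "X $ 3 $ 1 = Y $ 3 $ 1" "X $ 3 $ 2 = Y $ 3 $ 2" "X $ 3 $ 3 = Y $ 3 $ 3" "X $ 3 $ 4 = Y $ 3 $ 4"
    "X $ 4 $ 1 = Y $ 4 $ 1" "X $ 4 $ 2 = Y $ 4 $ 2" "X $ 4 $ 3 = Y $ 4 $ 3" "X $ 4 $ 4 = Y $ 4 $ 4"
  shows "X = Y"
  using assms by (simp add: mat4_eq)

text \<open>Being a bracket inside the commutant, \<open>f\<close> is 0 on the standard constituent
  and traceless on the trivial plane. Commuting with \<open>D\<close> means that a nonzero row or
  column of \<open>D\<close> is annihilated by the block of \<open>f\<close>, and also by the block
  of \<open>g\<close> after subtraction of the scalar by which \<open>g\<close> acts on the standard
  constituent. This reduces the claim to the 2 by 2 case.\<close>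

lemma type_211_centralizer:
  assumes t: "type_211 E F H" and D: "cm H D = D" "D \<noteq> 0"
    and f: "cm E f = 0" "cm F f = 0" "cm D f = 0" and g: "cm E g = 0" "cm F g = 0" "cm D g = 0"
    and fg: "cm f g = 0" and K: "cm E K = 0" "cm F K = 0" and W: "cm E W = 0" "cm F W = 0"
    and fKW: "f = cm K W" and f0: "f \<noteq> 0"
  shows "\<exists>y z. g = Mat y + Mat z ** f"
proof -
  note d = type_211_weight_1[OF t D(1)]
  note f' = type_211_commutant[OF t f(1,2)] and g' = type_211_commutant[OF t g(1,2)]
  note K' = type_211_commutant[OF t K] and W' = type_211_commutant[OF t W]
  have f11: "f $ 1 $ 1 = 0"
    unfolding fKW cm_nth by (simp add: K' W')
  have tr: "f $ 3 $ 3 + f $ 4 $ 4 = 0"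
    unfolding fKW cm_nth by (simp add: K' W')
  have f1: "f $ 3 $ 3 \<noteq> 0 \<or> f $ 3 $ 4 \<noteq> 0 \<or> f $ 4 $ 3 \<noteq> 0 \<or> f $ 4 $ 4 \<noteq> 0"
    using f0 f' f11 by (auto simp: mat4_eq)
  have e: "cm D f $ i $ j = 0" "cm D g $ i $ j = 0" "cm f g $ i $ j = 0" for i j
    by (simp_all add: f g fg)
  have Df: "D $ 1 $ 3 * f $ 3 $ 3 + D $ 1 $ 4 * f $ 4 $ 3 = 0" "D $ 1 $ 3 * f $ 3 $ 4 + D $ 1 $ 4 * f $ 4 $ 4 = 0"
    "D $ 3 $ 2 * f $ 3 $ 3 + D $ 4 $ 2 * f $ 3 $ 4 = 0" "D $ 3 $ 2 * f $ 4 $ 3 + D $ 4 $ 2 * f $ 4 $ 4 = 0"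
    using e(1)[of 1 3] e(1)[of 1 4] e(1)[of 3 2] e(1)[of 4 2]
    unfolding cm_nth by (simp_all add: d f' f11 mult.commute add_eq_0_iff)
  have Dg: "D $ 1 $ 3 * (g $ 3 $ 3 - g $ 1 $ 1) + D $ 1 $ 4 * g $ 4 $ 3 = 0"
    "D $ 1 $ 3 * g $ 3 $ 4 + D $ 1 $ 4 * (g $ 4 $ 4 - g $ 1 $ 1) = 0"
    "D $ 3 $ 2 * (g $ 3 $ 3 - g $ 1 $ 1) + D $ 4 $ 2 * g $ 3 $ 4 = 0"
    "D $ 3 $ 2 * g $ 4 $ 3 + D $ 4 $ 2 * (g $ 4 $ 4 - g $ 1 $ 1) = 0"
    using e(2)[of 1 3] e(2)[of 1 4] e(2)[of 3 2] e(2)[of 4 2]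
    unfolding cm_nth by (simp_all add: d g' algebra_simps)
  have comm: "f $ 3 $ 4 * g $ 4 $ 3 = g $ 3 $ 4 * f $ 4 $ 3"
    "f $ 3 $ 3 * g $ 3 $ 4 + f $ 3 $ 4 * (g $ 4 $ 4 - g $ 1 $ 1) = (g $ 3 $ 3 - g $ 1 $ 1) * f $ 3 $ 4 + g $ 3 $ 4 * f $ 4 $ 4"
    "f $ 4 $ 3 * (g $ 3 $ 3 - g $ 1 $ 1) + f $ 4 $ 4 * g $ 4 $ 3 = g $ 4 $ 3 * f $ 3 $ 3 + (g $ 4 $ 4 - g $ 1 $ 1) * f $ 4 $ 3"
    using e(3)[of 3 3] e(3)[of 3 4] e(3)[of 4 3]
    unfolding cm_nth by (simp_all add: f' g' algebra_simps)
  have Dn: "D $ 1 $ 3 \<noteq> 0 \<or> D $ 1 $ 4 \<noteq> 0 \<or> D $ 3 $ 2 \<noteq> 0 \<or> D $ 4 $ 2 \<noteq> 0"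
    using D(2) d by (auto simp: mat4_eq)
  have "\<exists>z. g $ 3 $ 3 - g $ 1 $ 1 = z * f $ 3 $ 3 \<and> g $ 3 $ 4 = z * f $ 3 $ 4 \<and>
    g $ 4 $ 3 = z * f $ 4 $ 3 \<and> g $ 4 $ 4 - g $ 1 $ 1 = z * f $ 4 $ 4"
  proof -
    consider (row) "D $ 1 $ 3 \<noteq> 0 \<or> D $ 1 $ 4 \<noteq> 0" | (col) "D $ 3 $ 2 \<noteq> 0 \<or> D $ 4 $ 2 \<noteq> 0"
      using Dn by blast
    then show ?thesis
    proof cases
      case row
      show ?thesis by (rule annihilator_2x2[OF row Df(1,2) tr f1 Dg(1,2) comm])
    next
      case col
      \<comment> \<open>A column is a row for the transposed blocks, hence the exchange of the
        entries (3,4) and (4,3).\<close>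
      have "\<exists>z. g $ 3 $ 3 - g $ 1 $ 1 = z * f $ 3 $ 3 \<and> g $ 4 $ 3 = z * f $ 4 $ 3 \<and>
        g $ 3 $ 4 = z * f $ 3 $ 4 \<and> g $ 4 $ 4 - g $ 1 $ 1 = z * f $ 4 $ 4"
        by (rule annihilator_2x2[OF col Df(3,4) tr _ Dg(3,4)]) (use f1 comm in \<open>auto simp: algebra_simps\<close>)
      then show ?thesis by blast
    qed
  qed
  then obtain z where z: "g $ 3 $ 3 - g $ 1 $ 1 = z * f $ 3 $ 3" "g $ 3 $ 4 = z * f $ 3 $ 4"
    "g $ 4 $ 3 = z * f $ 4 $ 3" "g $ 4 $ 4 - g $ 1 $ 1 = z * f $ 4 $ 4" by blast
  have "g = Mat (g $ 1 $ 1) + Mat z ** f"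
    by (rule mat4_eqI) (simp_all add: Mat_mult_nth Mat_nth f' g' f11 z[symmetric])
  then show ?thesis by blast
qed

lemma odd_weight_centralizer:
  assumes sl: "sl2_triple E F H" and D: "cm H D = D" "D \<noteq> 0"
    and f: "cm E f = 0" "cm F f = 0" "cm D f = 0" and g: "cm E g = 0" "cm F g = 0" "cm D g = 0"
    and fg: "cm f g = 0" and K: "cm E K = 0" "cm F K = 0" and W: "cm E W = 0" "cm F W = 0"
    and fKW: "f = cm K W" and f0: "f \<noteq> 0"
  shows "\<exists>y z. g = Mat y + Mat z ** f"
proof -
  obtain P Q where PQ: "P ** Q = Mat 1" "Q ** P = Mat 1"
    and t: "type_211 (Q ** E ** P) (Q ** F ** P) (Q ** H ** P)"
    using odd_weight_type_211[OF sl D] .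
  have "\<exists>y z. Q ** g ** P = Mat y + Mat z ** (Q ** f ** P)"
    by (rule type_211_centralizer[OF t, where D = "Q ** D ** P" and K = "Q ** K ** P" and W = "Q ** W ** P"])
      (simp_all add: conj_cm[OF PQ(1)] conj_zero_iff[OF PQ(1)] D f g fg K W fKW[symmetric] f0)
  then obtain y z where "Q ** g ** P = Q ** (Mat y + Mat z ** f) ** P"
    by (auto simp: conj_add conj_Mat[OF PQ(2)] conj_Mat_mult)
  then show ?thesis using conj_eq_iff[OF PQ(1)] by blast
qed

text \<open>The weight 2 space is the line of \<open>E\<close>, which generates sl2 itself:
  \<open>cm E (cm F E)\<close> is twice \<open>E\<close>, so no nonzero multiple of \<open>E\<close>
  passes the second condition.\<close>

lemma type_211_no_abelian_weight_2:
  assumes t: "type_211 E F H" and X: "cm H X = 2 *\<^sub>R X" "cm X (cm F X) = 0"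
  shows "X = 0"
proof -
  have "cm (diag4 1 (-1) 0 0) X = 2 *\<^sub>R X"
    using t X by (simp add: type_211_def)
  from diag_weight_all[OF this] have y: "\<forall>i j. (i, j) \<noteq> (1, 2) \<longrightarrow> X $ i $ j = 0"
    unfolding forall_4 vector_4 by simp
  have "cm X (cm (sub4 1 0 0) X) = 0"
    using t X by (simp add: type_211_def)
  then have "cm X (cm (sub4 1 0 0) X) $ 1 $ 2 = 0" by simp
  then have "X $ 1 $ 2 = 0"
    unfolding cm_nth using y by (simp add: sub4_def)
  then show "X = 0"
    using y by (metis (no_types, opaque_lifting) Finite_Cartesian_Product.vec_eq_iff prod.inject zero_index)
qed

lemma odd_weight_no_abelian_weight_2:
  assumes sl: "sl2_triple E F H" and D: "cm H D = D" "D \<noteq> 0"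
    and X: "cm H X = 2 *\<^sub>R X" "cm X (cm F X) = 0"
  shows "X = 0"
proof -
  obtain P Q where PQ: "P ** Q = Mat 1" "Q ** P = Mat 1"
    and t: "type_211 (Q ** E ** P) (Q ** F ** P) (Q ** H ** P)"
    using odd_weight_type_211[OF sl D] .
  have "Q ** X ** P = 0"
    by (rule type_211_no_abelian_weight_2[OF t])
      (simp_all only: conj_cm[OF PQ(1)] X conj_scaleR conj_zero_iff[OF PQ(1)])
  then show ?thesis using conj_zero_iff[OF PQ(1)] by simp
qed

section \<open>Abelian constituents of dimension 3 and the type 2+2\<close>

lemma type_4_commutant_commute:
  assumes t: "type_4 E F H" and K: "cm E K = 0" "cm H K = 0" and G: "cm E G = 0" "cm H G = 0"
  shows "cm K G = 0"
proof -
  have H: "H = diag4 3 1 (-1) (-3)" and E: "E = sup4 3 4 3" using t by (simp_all add: type_4_def)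
  have *: "\<exists>x. Z = Mat x" if Z: "cm E Z = 0" "cm H Z = 0" for Z
  proof -
    have "cm (diag4 3 1 (-1) (-3)) Z = 0 *\<^sub>R Z" using Z H by simp
    from diag_weight_all[OF this]
    have off: "Z $ 1 $ 2 = 0" "Z $ 1 $ 3 = 0" "Z $ 1 $ 4 = 0" "Z $ 2 $ 1 = 0" "Z $ 2 $ 3 = 0" "Z $ 2 $ 4 = 0"
      "Z $ 3 $ 1 = 0" "Z $ 3 $ 2 = 0" "Z $ 3 $ 4 = 0" "Z $ 4 $ 1 = 0" "Z $ 4 $ 2 = 0" "Z $ 4 $ 3 = 0"
      unfolding forall_4 vector_4 by simp_all
    have e: "cm (sup4 3 4 3) Z $ i $ j = 0" for i j using Z E by simp
    have "Z $ 1 $ 1 = Z $ 2 $ 2" "Z $ 2 $ 2 = Z $ 3 $ 3" "Z $ 3 $ 3 = Z $ 4 $ 4"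
      using e[of 1 2] e[of 2 3] e[of 3 4] unfolding cm_nth by (simp_all add: sup4_def off)
    then have "Z = Mat (Z $ 1 $ 1)"
      by (intro mat4_eqI) (simp_all add: off Mat_nth)
    then show ?thesis by blast
  qed
  show ?thesis using *[OF G] by auto
qed

lemma type_31_commutant_commute:
  assumes t: "type_31 E F H" and K: "cm E K = 0" "cm H K = 0" and G: "cm E G = 0" "cm H G = 0"
  shows "cm K G = 0"
proof -
  have H: "H = diag4 2 0 (-2) 0" and E: "E = sup4 2 2 0" using t by (simp_all add: type_31_def)
  have *: "\<exists>x y. Z = diag4 x x x y" if Z: "cm E Z = 0" "cm H Z = 0" for Z
  proof -
    have "cm (diag4 2 0 (-2) 0) Z = 0 *\<^sub>R Z" using Z H by simp
    from diag_weight_all[OF this]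
    have off: "Z $ 1 $ 2 = 0" "Z $ 1 $ 3 = 0" "Z $ 1 $ 4 = 0" "Z $ 2 $ 1 = 0" "Z $ 2 $ 3 = 0"
      "Z $ 3 $ 1 = 0" "Z $ 3 $ 2 = 0" "Z $ 3 $ 4 = 0" "Z $ 4 $ 1 = 0" "Z $ 4 $ 3 = 0"
      unfolding forall_4 vector_4 by simp_all
    have e: "cm (sup4 2 2 0) Z $ i $ j = 0" for i j using Z E by simp
    have "Z $ 1 $ 1 = Z $ 2 $ 2" "Z $ 2 $ 2 = Z $ 3 $ 3" "Z $ 2 $ 4 = 0" "Z $ 4 $ 2 = 0"
      using e[of 1 2] e[of 2 3] e[of 1 4] e[of 4 3] unfolding cm_nth by (simp_all add: sup4_def off)
    then have "Z = diag4 (Z $ 1 $ 1) (Z $ 1 $ 1) (Z $ 1 $ 1) (Z $ 4 $ 4)"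
      by (intro mat4_eqI) (simp_all add: off diag4_def)
    then show ?thesis by blast
  qed
  show ?thesis using *[OF G] *[OF K] by (auto simp: mat4_eq cm_nth diag4_def)
qed

text \<open>By Schur's lemma the commutant is commutative when the constituents are pairwise
  non-isomorphic, so \<open>K\<close> and \<open>G\<close> exclude 4 and 3+1. The abelian
  \<open>X\<close> excludes 2+1+1, and its weight excludes the trivial action.\<close>

lemma abelian_weight_2_type_22:
  assumes sl: "sl2_triple E F H"
    and X: "cm H X = 2 *\<^sub>R X" "cm X (cm F X) = 0" "X \<noteq> 0"
    and K: "cm E K = 0" "cm H K = 0" and G: "cm E G = 0" "cm H G = 0"
    and KG: "cm K G \<noteq> 0"
  obtains P Q where "P ** Q = Mat 1" "Q ** P = Mat 1" "type_22 (Q ** E ** P) (Q ** F ** P) (Q ** H ** P)"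
  using sl
proof (cases rule: sl2_classification)
  case 1
  then show ?thesis using X by (simp add: cm_def)
next
  case (2 P Q)
  have "cm (Q ** K ** P) (Q ** G ** P) = 0"
    by (rule type_4_commutant_commute[OF 2(3)]) (simp_all add: conj_cm[OF 2(1)] K G)
  then show ?thesis using KG by (simp add: conj_cm[OF 2(1)] conj_zero_iff[OF 2(1)])
next
  case (3 P Q)
  have "cm (Q ** K ** P) (Q ** G ** P) = 0"
    by (rule type_31_commutant_commute[OF 3(3)]) (simp_all add: conj_cm[OF 3(1)] K G)
  then show ?thesis using KG by (simp add: conj_cm[OF 3(1)] conj_zero_iff[OF 3(1)])
next
  case (4 P Q)
  then show ?thesis using that by blast
next
  case (5 P Q)
  have "Q ** X ** P = 0"
    by (rule type_211_no_abelian_weight_2[OF 5(3)])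
      (simp_all only: conj_cm[OF 5(1)] X conj_scaleR conj_zero_iff[OF 5(1)])
  then show ?thesis using X conj_zero_iff[OF 5(1)] by simp
qed

text \<open>The module is the standard one tensored with a plane of multiplicities. A matrix of
  weight 2 is \<open>E\<close> tensored with a 2 by 2 matrix, whose entries stand at (1,2), (1,4),
  (3,2), (3,4). An element of the commutant is the identity tensored with a 2 by 2 matrix, read off
  at (1,1), (1,3), (3,1), (3,3).\<close>

lemma type_22_weight_2:
  assumes "type_22 E F H" "cm H X = 2 *\<^sub>R X"
  shows "X $ 1 $ 1 = 0" "X $ 1 $ 3 = 0" "X $ 2 $ 1 = 0" "X $ 2 $ 2 = 0" "X $ 2 $ 3 = 0" "X $ 2 $ 4 = 0"
    "X $ 3 $ 1 = 0" "X $ 3 $ 3 = 0" "X $ 4 $ 1 = 0" "X $ 4 $ 2 = 0" "X $ 4 $ 3 = 0" "X $ 4 $ 4 = 0"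
proof -
  have "cm (diag4 1 (-1) 1 (-1)) X = 2 *\<^sub>R X" using assms by (simp add: type_22_def)
  from diag_weight_all[OF this]
  show "X $ 1 $ 1 = 0" "X $ 1 $ 3 = 0" "X $ 2 $ 1 = 0" "X $ 2 $ 2 = 0" "X $ 2 $ 3 = 0" "X $ 2 $ 4 = 0"
    "X $ 3 $ 1 = 0" "X $ 3 $ 3 = 0" "X $ 4 $ 1 = 0" "X $ 4 $ 2 = 0" "X $ 4 $ 3 = 0" "X $ 4 $ 4 = 0"
    unfolding forall_4 vector_4 by simp_all
qed

lemma type_22_commutant:
  assumes "type_22 E F H" "cm E Z = 0" "cm F Z = 0"
  shows "Z $ 1 $ 2 = 0" "Z $ 1 $ 4 = 0" "Z $ 2 $ 1 = 0" "Z $ 2 $ 3 = 0"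
    "Z $ 3 $ 2 = 0" "Z $ 3 $ 4 = 0" "Z $ 4 $ 1 = 0" "Z $ 4 $ 3 = 0"
    "Z $ 2 $ 2 = Z $ 1 $ 1" "Z $ 2 $ 4 = Z $ 1 $ 3" "Z $ 4 $ 2 = Z $ 3 $ 1" "Z $ 4 $ 4 = Z $ 3 $ 3"
  using assms
  by (auto simp: type_22_def mat4_eq cm_def matrix_matrix_mult_def sum_4 sup4_def sub4_def)

text \<open>The equations express that the traceless matrices with rows (a, b), (c, -a) and (a',
  b'), (c', -a') commute.\<close>

lemma parallel_traceless_2x2:
  fixes a b c :: complex
  assumes "a \<noteq> 0 \<or> b \<noteq> 0 \<or> c \<noteq> 0" "b * c' = b' * c" "a * b' = a' * b" "a * c' = a' * c"
  shows "\<exists>z. a' = z * a \<and> b' = z * b \<and> c' = z * c"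
proof -
  consider "a \<noteq> 0" | "a = 0" "b \<noteq> 0" | "a = 0" "b = 0" "c \<noteq> 0" using assms(1) by blast
  then show ?thesis
  proof cases
    case 1
    then show ?thesis using assms by (intro exI[of _ "a' / a"]) (auto simp: field_simps)
  next
    case 2
    then show ?thesis using assms by (intro exI[of _ "b' / b"]) (auto simp: field_simps)
  next
    case 3
    then show ?thesis using assms by (intro exI[of _ "c' / c"]) (auto simp: field_simps)
  qed
qed

text \<open>On the plane of multiplicities let k, x, g correspond to \<open>K\<close>,
  \<open>X\<close>, \<open>G\<close>. Both x = [k, x] and p g = [k, g] are brackets, so x and g are
  traceless. As they commute, g is a multiple of x, and both have the same eigenvalue under
  bracketing with k.\<close>

lemma type_22_weight_one:
  assumes t: "type_22 E F H" and X: "cm H X = 2 *\<^sub>R X" "X \<noteq> 0"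
    and K: "cm E K = 0" "cm F K = 0" and G: "cm E G = 0" "cm F G = 0" "G \<noteq> 0"
    and KX: "cm K X = X" and GX: "cm G X = 0" and KG: "cm K G = p *\<^sub>R G" and p: "p \<noteq> 0"
  shows "p = 1"
proof -
  note x = type_22_weight_2[OF t X(1)] and k = type_22_commutant[OF t K] and g = type_22_commutant[OF t G(1,2)]
  have e: "cm K X $ i $ j = X $ i $ j" "cm G X $ i $ j = 0" "cm K G $ i $ j = complex_of_real p * G $ i $ j" for i j
    by (simp_all add: KX GX KG scaleR_complex)
  have X34: "X $ 3 $ 4 = - X $ 1 $ 2"
    using e(1)[of 1 2] e(1)[of 3 4] unfolding cm_nth by (simp add: x k algebra_simps) 
  have "complex_of_real p * (G $ 3 $ 3 + G $ 1 $ 1) = 0"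
    unfolding distrib_left e(3)[symmetric] cm_nth by (simp add: g k)
  then have G33: "G $ 3 $ 3 = - G $ 1 $ 1" using p by (simp add: eq_neg_iff_add_eq_0)
  have "\<exists>z. G $ 1 $ 1 = z * X $ 1 $ 2 \<and> G $ 1 $ 3 = z * X $ 1 $ 4 \<and> G $ 3 $ 1 = z * X $ 3 $ 2"
  proof (rule parallel_traceless_2x2)
    show "X $ 1 $ 2 \<noteq> 0 \<or> X $ 1 $ 4 \<noteq> 0 \<or> X $ 3 $ 2 \<noteq> 0"
      using X(2) x X34 by (auto simp: mat4_eq)
    show "X $ 1 $ 4 * G $ 3 $ 1 = G $ 1 $ 3 * X $ 3 $ 2"
      using e(2)[of 1 2] unfolding cm_nth by (simp add: g x algebra_simps)
    have "2 * (X $ 1 $ 2 * G $ 1 $ 3 - G $ 1 $ 1 * X $ 1 $ 4) = 0"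
      using e(2)[of 1 4] unfolding cm_nth by (simp add: g x X34 G33 algebra_simps)
    then show "X $ 1 $ 2 * G $ 1 $ 3 = G $ 1 $ 1 * X $ 1 $ 4" by simp
    have "2 * (X $ 1 $ 2 * G $ 3 $ 1 - G $ 1 $ 1 * X $ 3 $ 2) = 0"
      using e(2)[of 3 2] unfolding cm_nth by (simp add: g x X34 G33 algebra_simps)
    then show "X $ 1 $ 2 * G $ 3 $ 1 = G $ 1 $ 1 * X $ 3 $ 2" by simp
  qed
  then obtain z where z: "G $ 1 $ 1 = z * X $ 1 $ 2" "G $ 1 $ 3 = z * X $ 1 $ 4" "G $ 3 $ 1 = z * X $ 3 $ 2"
    by blast
  have "complex_of_real p * G $ 1 $ 1 = z * cm K X $ 1 $ 2"
    unfolding e(3)[symmetric] cm_nth by (simp add: g k x z algebra_simps)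
  then have 1: "complex_of_real p * G $ 1 $ 1 = G $ 1 $ 1" unfolding e z .
  have "complex_of_real p * G $ 1 $ 3 = z * cm K X $ 1 $ 4"
    unfolding e(3)[symmetric] cm_nth by (simp add: g k x G33 X34 z algebra_simps)
  then have 2: "complex_of_real p * G $ 1 $ 3 = G $ 1 $ 3" unfolding e z .
  have "complex_of_real p * G $ 3 $ 1 = z * cm K X $ 3 $ 2"
    unfolding e(3)[symmetric] cm_nth by (simp add: g k x G33 X34 z algebra_simps)
  then have 3: "complex_of_real p * G $ 3 $ 1 = G $ 3 $ 1" unfolding e z .
  have "G $ 1 $ 1 \<noteq> 0 \<or> G $ 1 $ 3 \<noteq> 0 \<or> G $ 3 $ 1 \<noteq> 0"
    using G(3) g G33 by (auto simp: mat4_eq)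
  then have "complex_of_real p = 1" using 1 2 3 by auto
  then show ?thesis by simp
qed

lemma abelian_weight_2_weight_one:
  assumes sl: "sl2_triple E F H"
    and X: "cm H X = 2 *\<^sub>R X" "cm X (cm F X) = 0" "X \<noteq> 0"
    and K: "cm E K = 0" "cm F K = 0" "cm H K = 0" and G: "cm E G = 0" "cm F G = 0" "cm H G = 0" "G \<noteq> 0"
    and KX: "cm K X = X" and GX: "cm G X = 0" and KG: "cm K G = p *\<^sub>R G" and p: "p \<noteq> 0"
  shows "p = 1"
proof -
  have "cm K G \<noteq> 0" using KG G p by simp
  then obtain P Q where PQ: "P ** Q = Mat 1" "Q ** P = Mat 1"
    and t: "type_22 (Q ** E ** P) (Q ** F ** P) (Q ** H ** P)"
    using abelian_weight_2_type_22[OF sl X K(1,3) G(1,3)] by blast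
  show ?thesis
    by (rule type_22_weight_one[OF t, where X = "Q ** X ** P" and K = "Q ** K ** P" and G = "Q ** G ** P"])
      (simp_all only: conj_cm[OF PQ(1)] conj_zero_iff[OF PQ(1)] X K G KX GX KG conj_scaleR p simp_thms)
qed

section \<open>The compact form and quaternions\<close>

text \<open>2A and 2B act as the quaternion units i and j. Only over the reals does positivity of
  the quaternion norm make the four vectors independent, so that they fill the space.\<close>

lemma quaternion_span:
  fixes A B :: "real^4^4"
  assumes AA: "A *v (A *v v) = - (1/4) *\<^sub>R v" and BB: "\<And>x. B *v (B *v x) = A *v (A *v x)"
    and AB: "\<And>x. B *v (A *v x) = - (A *v (B *v x))" and v: "v \<noteq> 0"
  shows "\<exists>a b c d. u = a *s v + b *s (A *v v) + c *s (B *v v) + d *s (A *v (B *v v))"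
proof -
  have neg: "A *v (- x) = - (A *v x)" for A :: "real^4^4" and x
    by (simp add: Finite_Cartesian_Product.vec_eq_iff matrix_vector_mult_def sum_negf)
  define p q r where "p = A *v v" and "q = B *v v" and "r = A *v (B *v v)"
  have act: "A *v v = p" "A *v p = (-1/4) *s v" "A *v q = r" "A *v r = (-1/4) *s q"
    "B *v v = q" "B *v p = - r" "B *v q = (-1/4) *s v" "B *v r = (1/4) *s p"
  proof -
    have h: "A *v (A *v v) = (-1/4) *s v"
      by (simp add: AA Finite_Cartesian_Product.vec_eq_iff)
    show "A *v p = (-1/4) *s v" by (simp add: p_def h)
    show "B *v q = (-1/4) *s v" by (simp add: q_def BB h)
    have "A *v r = A *v (- (B *v (A *v v)))" by (simp add: r_def AB)
    also have "\<dots> = B *v (A *v (A *v v))" by (simp add: neg AB)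
    finally show "A *v r = (-1/4) *s q" by (simp add: h neg vector_scalar_commute q_def)
    have "B *v r = - (A *v (A *v (A *v v)))" by (simp add: r_def AB BB)
    then show "B *v r = (1/4) *s p"
      by (simp only: h vector_scalar_commute p_def) (simp add: Finite_Cartesian_Product.vec_eq_iff)
  qed (simp_all add: p_def q_def r_def AB)
  have "indep4 v p q r"
    unfolding indep4_def
  proof (intro allI impI)
    fix a b c d assume 0: "a *s v + b *s p + c *s q + d *s r = 0"
    define s where "s = a *s v + b *s p + c *s q + d *s r"
    \<comment> \<open>This is multiplication by the conjugate quaternion; the result is the norm
      times \<open>v\<close>. The denominators come from A^2 = B^2 = -1/4 and (AB)^2 = -1/16 on
      \<open>v\<close>.\<close>
    have "a *s s - b *s (A *v s) - c *s (B *v s) - d *s (A *v (B *v s)) = (a*a + b*b/4 + c*c/4 + d*d/16) *s v"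
      by (simp add: s_def act neg matrix_vector_right_distrib matrix_vector_mult_diff_distrib vector_scalar_commute)
        (simp add: Finite_Cartesian_Product.vec_eq_iff algebra_simps)
    moreover have s0: "s = 0" using 0 by (simp only: s_def)
    ultimately have "(a*a + b*b/4 + c*c/4 + d*d/16) *s v = 0"
      by (simp only: s0 matrix_vector_mult_0_right vec.scale_zero_right diff_zero)
    then have "a*a + b*b/4 + c*c/4 + d*d/16 = 0"
      using v vec.scale_eq_0_iff by blast
    then show "a = 0 \<and> b = 0 \<and> c = 0 \<and> d = 0"
      by (smt (verit) zero_le_square mult_eq_0_iff divide_nonneg_pos zero_less_numeral divide_eq_0_iff)
  qed
  then have "\<exists>a b c d. u = a *s v + b *s p + c *s q + d *s r"
    by (rule basis_change) blast
  then show ?thesis by (simp add: p_def q_def r_def)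
qed

section \<open>Complexification and the sl2-triple of so3\<close>

definition cpx :: "real^4^4 \<Rightarrow> complex^4^4" where
  "cpx A = (\<chi> i j. complex_of_real (A $ i $ j))"

lemma cpx_nth [simp]: "cpx A $ i $ j = complex_of_real (A $ i $ j)"
  by (simp add: cpx_def)

lemma cpx_mult: "cpx A ** cpx B = cpx (A ** B)"
  by (simp add: Finite_Cartesian_Product.vec_eq_iff matrix_matrix_mult_def)

lemma cpx_add: "cpx A + cpx B = cpx (A + B)"
  by (simp add: Finite_Cartesian_Product.vec_eq_iff)

lemma cpx_scaleR: "k *\<^sub>R cpx A = cpx (k *\<^sub>R A)"
  by (simp add: Finite_Cartesian_Product.vec_eq_iff scaleR_complex)

lemma cpx_cm: "cm (cpx A) (cpx B) = cpx (A ** B - B ** A)"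
  by (simp add: Finite_Cartesian_Product.vec_eq_iff cm_def cpx_mult)

lemma cpx_eq_iff [simp]: "cpx A = cpx B \<longleftrightarrow> A = B"
  by (simp add: Finite_Cartesian_Product.vec_eq_iff)

lemma cpx_0 [simp]: "cpx 0 = 0"
  by (simp add: Finite_Cartesian_Product.vec_eq_iff)

lemma cpx_eq_0_iff [simp]: "cpx A = 0 \<longleftrightarrow> A = 0"
  using cpx_eq_iff[of A 0] by simp

lemma cm_Mat_mult:
  "cm (Mat s ** X) Y = Mat s ** cm X Y" "cm X (Mat s ** Y) = Mat s ** cm X Y"
proof -
  have "Y ** (Mat s ** X) = Mat s ** (Y ** X)" for X Y :: "complex^4^4"
    by (metis Mat_commute matrix_mul_assoc)
  then show "cm (Mat s ** X) Y = Mat s ** cm X Y" "cm X (Mat s ** Y) = Mat s ** cm X Y"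
    by (simp_all add: cm_def mat_diff_distrib matrix_mul_assoc)
qed

lemma cm_linear:
  "cm (X + Y) Z = cm X Z + cm Y Z" "cm X (Y + Z) = cm X Y + cm X Z"
  "cm (X - Y) Z = cm X Z - cm Y Z" "cm X (Y - Z) = cm X Y - cm X Z"
  by (simp_all add: cm_def mat_diff_distrib mat_add_distrib)

definition so3_triple :: "real^4^4 \<Rightarrow> real^4^4 \<Rightarrow> real^4^4 \<Rightarrow> bool" where
  "so3_triple A B C \<longleftrightarrow> A ** B - B ** A = C \<and> B ** C - C ** B = A \<and> C ** A - A ** C = B"

text \<open>Since [C, A] = B and [C, B] = -A, the combinations iA - B and iA + B are eigenvectors of
  the bracket with 2iC, with eigenvalues 2 and -2, and their bracket is 2iC.\<close>

definition raise :: "real^4^4 \<Rightarrow> real^4^4 \<Rightarrow> complex^4^4" where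
  "raise A B = Mat \<i> ** cpx A - cpx B"

definition lower :: "real^4^4 \<Rightarrow> real^4^4 \<Rightarrow> complex^4^4" where
  "lower A B = Mat \<i> ** cpx A + cpx B"

lemma so3_triple_cm:
  assumes "so3_triple A B C"
  shows "cm (cpx A) (cpx B) = cpx C" "cm (cpx B) (cpx C) = cpx A" "cm (cpx C) (cpx A) = cpx B"
    "cm (cpx B) (cpx A) = - cpx C" "cm (cpx C) (cpx B) = - cpx A" "cm (cpx A) (cpx C) = - cpx B"
    "cm (cpx A) (cpx A) = 0" "cm (cpx B) (cpx B) = 0"
proof -
  show 1: "cm (cpx A) (cpx B) = cpx C" "cm (cpx B) (cpx C) = cpx A" "cm (cpx C) (cpx A) = cpx B"
    using assms by (auto simp: so3_triple_def cpx_cm)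
  have "cm X Y = - cm Y X" for X Y by (simp add: cm_def)
  then show "cm (cpx B) (cpx A) = - cpx C" "cm (cpx C) (cpx B) = - cpx A" "cm (cpx A) (cpx C) = - cpx B"
    using 1 by metis+
qed (simp_all add: cm_def)

lemma so3_sl2:
  assumes "so3_triple A B C"
  shows "sl2_triple (raise A B) (lower A B) (Mat (2 * \<i>) ** cpx C)"
  unfolding sl2_triple_def raise_def lower_def cm_linear cm_Mat_mult so3_triple_cm[OF assms]
  by (auto simp: Finite_Cartesian_Product.vec_eq_iff Mat_mult_nth scaleR_complex mat_diff_distrib mat_add_distrib algebra_simps)

lemma Mat_i_mult_left: "(Mat \<i> ** X) ** Y = Mat \<i> ** (X ** Y)" "cpx Z ** (Mat \<i> ** Y) = Mat \<i> ** (cpx Z ** Y)"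
  for X Y :: "complex^4^4"
  by (simp only: matrix_mul_assoc) (metis Mat_commute matrix_mul_assoc)

lemma Mat_i_Mat_i: "Mat \<i> ** (Mat \<i> ** X) = - X" for X :: "complex^4^4"
  by (simp add: Finite_Cartesian_Product.vec_eq_iff Mat_mult_nth)

text \<open>When E^2 = 0, the matrix EF + FE is the projection onto the nontrivial part. Its
  expression through the real matrix A^2 + B^2 allows a comparison with the quaternion
  relations.\<close>

lemma raise_lower_anticommutator:
  "raise A B ** lower A B + lower A B ** raise A B = (-2) *\<^sub>R cpx (A ** A + B ** B)"
  unfolding raise_def lower_def mat_diff_distrib mat_add_distrib Mat_i_mult_left Mat_i_Mat_i cpx_mult
  by (simp add: Finite_Cartesian_Product.vec_eq_iff Mat_mult_nth scaleR_complex)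

text \<open>These are the real and imaginary parts of (iA - B)^2 = B^2 - A^2 - i(AB + BA).\<close>

lemma raise_square_zero_imp:
  assumes "raise A B ** raise A B = 0"
  shows "A ** A = B ** B" "A ** B + B ** A = 0"
proof -
  define R S where "R = B ** B - A ** A" and "S = A ** B + B ** A"
  have "raise A B ** raise A B = cpx R - Mat \<i> ** cpx S"
    unfolding raise_def mat_diff_distrib mat_add_distrib Mat_i_mult_left Mat_i_Mat_i cpx_mult R_def S_def
    by (simp add: Finite_Cartesian_Product.vec_eq_iff Mat_mult_nth algebra_simps)
  then have "(cpx R - Mat \<i> ** cpx S) $ i $ j = 0" for i j
    using assms by simp
  then have "complex_of_real (R $ i $ j) - \<i> * complex_of_real (S $ i $ j) = 0" for i j
    by (simp only: vector_minus_component Mat_mult_nth cpx_nth)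
  then have "R $ i $ j = 0 \<and> S $ i $ j = 0" for i j
    by (auto simp: complex_eq_iff)
  then have "R = 0" "S = 0"
    by (simp_all add: Finite_Cartesian_Product.vec_eq_iff)
  then show "A ** A = B ** B" "A ** B + B ** A = 0"
    by (simp_all add: R_def S_def)
qed

text \<open>If the raising operator squares to zero, then \<open>2 *\<^sub>R A\<close> and \<open>2 *\<^sub>R B\<close> are anticommuting with
  equal squares, so a vector outside the kernel generates a copy of the quaternions, which has
  real dimension 4.\<close>

lemma so3_quaternionic:
  assumes so: "so3_triple A B C" and sq: "raise A B ** raise A B = 0" and A0: "A \<noteq> 0"
  shows "A ** A = (-1/4) *\<^sub>R Mat 1"
    "v \<noteq> 0 \<Longrightarrow> \<exists>a b c d. u = a *s v + b *s (A *v v) + c *s (B *v v) + d *s (A *v (B *v v))"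
proof -
  note sq' = raise_square_zero_imp[OF sq]
  have BB: "B *v (B *v x) = A *v (A *v x)" for x
    by (simp add: matrix_vector_mul_assoc sq'(1))
  have "B ** A = - (A ** B)" using sq'(2) by (simp add: eq_neg_iff_add_eq_0 add.commute)
  then have AB: "B *v (A *v x) = - (A *v (B *v x))" for x
    by (simp add: matrix_vector_mul_assoc) (simp add: Finite_Cartesian_Product.vec_eq_iff matrix_vector_mult_def sum_negf)
  have neg: "A *v (- x) = - (A *v x)" for A :: "real^4^4" and x
    by (simp add: Finite_Cartesian_Product.vec_eq_iff matrix_vector_mult_def sum_negf)
  have C: "C *v x = 2 *s (A *v (B *v x))" for x
  proof -
    have "C *v x = (A ** B - B ** A) *v x"
      using so unfolding so3_triple_def by metis
    also have "\<dots> = A *v (B *v x) - B *v (A *v x)"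
      by (simp only: matrix_vector_mult_diff_rdistrib matrix_vector_mul_assoc)
    finally have "C *v x = A *v (B *v x) - B *v (A *v x)" .
    then show ?thesis by (simp add: AB Finite_Cartesian_Product.vec_eq_iff)
  qed
  have A3: "A *v x = - 4 *s (A *v (A *v (A *v x)))" for x
  proof -
    have "A *v x = (B ** C - C ** B) *v x"
      using so unfolding so3_triple_def by metis
    also have "\<dots> = B *v (C *v x) - C *v (B *v x)"
      by (simp only: matrix_vector_mult_diff_rdistrib matrix_vector_mul_assoc)
    also have "\<dots> = - 4 *s (A *v (A *v (A *v x)))"
      by (simp add: C vector_scalar_commute AB BB) (simp add: Finite_Cartesian_Product.vec_eq_iff)
    finally show ?thesis .
  qed
  \<comment> \<open>So far A^2 = -1/4 holds only on the image of \<open>A\<close>. A nonzero vector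
    of that image already generates the whole space under the quaternions, which carries the
    identity over to every vector.\<close>
  obtain x where "A *v x \<noteq> 0" using A0 by (metis matrix_eq matrix_vector_mult_0)
  have AA1: "A *v (A *v (A *v x)) = - (1/4) *\<^sub>R (A *v x)" for x
    using A3[of x] by (simp add: Finite_Cartesian_Product.vec_eq_iff)
  note span = quaternion_span[OF AA1 BB AB \<open>A *v x \<noteq> 0\<close>]
  have AA: "A *v (A *v u) = - (1/4) *\<^sub>R u" for u
  proof -
    obtain a b c d where u: "u = a *s (A *v x) + b *s (A *v (A *v x)) + c *s (B *v (A *v x)) + d *s (A *v (B *v (A *v x)))"
      using span by blast
    have 1: "A *v (A *v (A *v y)) = (-1/4) *s (A *v y)" for y
      using AA1[of y] by (simp add: Finite_Cartesian_Product.vec_eq_iff)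
    have 2: "A *v (A *v (B *v (A *v x))) = (-1/4) *s (B *v (A *v x))"
    proof -
      have "A *v (A *v (B *v (A *v x))) = B *v (A *v (A *v (A *v x)))"
        by (simp add: AB neg)
      then show ?thesis by (simp only: 1 vector_scalar_commute)
    qed
    have "A *v (A *v u) = (-1/4) *s u"
      unfolding u matrix_vector_right_distrib vector_scalar_commute 1 2
      by (simp add: Finite_Cartesian_Product.vec_eq_iff algebra_simps)
    then show ?thesis by (simp add: Finite_Cartesian_Product.vec_eq_iff)
  qed
  show "A ** A = (-1/4) *\<^sub>R Mat 1"
  proof (rule matrix_eq[THEN iffD2, rule_format])
    fix y :: "real^4"
    have "((-1/4) *\<^sub>R Mat 1) *v y = (-1/4) *\<^sub>R y"
      by (simp only: scaleR_matrix_vector_assoc[symmetric] matrix_vector_mul_lid)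
    then show "(A ** A) *v y = ((-1/4) *\<^sub>R Mat 1) *v y"
      by (simp add: matrix_vector_mul_assoc[symmetric] AA)
  qed
  show "\<exists>a b c d. u = a *s v + b *s (A *v v) + c *s (B *v v) + d *s (A *v (B *v v))" if "v \<noteq> 0"
    by (rule quaternion_span[OF AA BB AB that])
qed

text \<open>\<open>U\<close> and \<open>W\<close> span a plane that the bracket with
  \<open>C\<close> rotates at half speed, so U + iW has weight 1 under 2iC and forces 2+1+1. There
  EF + FE is a projection of rank 2, whereas the quaternion relations A^2 = B^2 = -1/4 make it the
  identity.\<close>

lemma so3_no_half_spin:
  assumes so: "so3_triple A B C"
    and U: "C ** U - U ** C = (1/2) *\<^sub>R W" and W: "C ** W - W ** C = (-1/2) *\<^sub>R U"
  shows "U = 0"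
proof (rule ccontr)
  assume U0: "U \<noteq> 0"
  define D where "D = cpx U + Mat \<i> ** cpx W"
  have "cm (Mat (2 * \<i>) ** cpx C) D = D"
    unfolding D_def cm_linear cm_Mat_mult cpx_cm U W
    by (auto simp: Finite_Cartesian_Product.vec_eq_iff Mat_mult_nth mat_add_distrib algebra_simps)
  moreover have "D \<noteq> 0"
  proof
    assume "D = 0"
    then have "Re (D $ i $ j) = 0" for i j by simp
    then have "U = 0" by (simp add: D_def Mat_mult_nth Finite_Cartesian_Product.vec_eq_iff)
    with U0 show False by simp
  qed
  ultimately obtain P Q where PQ: "P ** Q = Mat 1" "Q ** P = Mat 1"
    and t: "type_211 (Q ** raise A B ** P) (Q ** lower A B ** P) (Q ** (Mat (2 * \<i>) ** cpx C) ** P)"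
    by (rule odd_weight_type_211[OF so3_sl2[OF so]])
  have "(Q ** raise A B ** P) ** (Q ** raise A B ** P) = 0"
    using t by (simp add: type_211_def mat4_eq matrix_matrix_mult_def sum_4 sup4_def)
  then have sq: "raise A B ** raise A B = 0"
    by (simp add: conj_mult[OF PQ(1)] conj_zero_iff[OF PQ(1)])
  have "(Q ** raise A B ** P) ** (Q ** lower A B ** P) + (Q ** lower A B ** P) ** (Q ** raise A B ** P) = diag4 1 1 0 0"
    using t by (simp add: type_211_def mat4_eq matrix_matrix_mult_def sum_4 sup4_def sub4_def diag4_def)
  then have d: "Q ** ((-2) *\<^sub>R cpx (A ** A + B ** B)) ** P = diag4 1 1 0 0"
    by (simp only: conj_mult[OF PQ(1)] conj_add[symmetric] raise_lower_anticommutator)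
  have "A \<noteq> 0"
  proof
    assume "A = 0"
    then have "diag4 1 1 0 0 = 0"
      using d raise_square_zero_imp[OF sq] by simp
    then have "diag4 1 1 0 0 $ 1 $ 1 = 0" by simp
    then show False by (simp add: diag4_def)
  qed
  note q = so3_quaternionic(1)[OF so sq this]
  have "(-2) *\<^sub>R cpx (A ** A + B ** B) = Mat 1"
    unfolding raise_square_zero_imp(1)[OF sq, symmetric] q
    by (simp add: Finite_Cartesian_Product.vec_eq_iff scaleR_complex Finite_Cartesian_Product.mat_def)
  then have "Q ** Mat 1 ** P = diag4 1 1 0 0" using d by simp
  then have "Mat 1 = diag4 1 1 0 0" using conj_Mat[OF PQ(2)] by metis
  then have "Mat 1 $ 3 $ 3 = diag4 1 1 0 0 $ 3 $ 3" by simp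
  then show False by (simp add: Mat_nth diag4_def)
qed

lemma type_22_squares:
  assumes t: "type_22 E F H" and X: "cm H X = 2 *\<^sub>R X"
  shows "E ** E = 0" "X ** X = 0" "E \<noteq> 0"
proof -
  show "E ** E = 0"
    using t by (simp add: type_22_def mat4_eq matrix_matrix_mult_def sum_4 sup4_def)
  have "E $ 1 $ 2 = 1" using t by (simp add: type_22_def sup4_def)
  then show "E \<noteq> 0" by auto
  note x = type_22_weight_2[OF t X]
  show "X ** X = 0"
    by (simp add: mat4_eq matrix_matrix_mult_def sum_4 x)
qed

text \<open>X1 + iX2 has weight 2 under 2iC and its constituent is abelian, so the type is 2+2 and
  (X1 + iX2)^2 = 0. This makes \<open>X1\<close>, \<open>X2\<close>, \<open>X3\<close> commuting
  nilpotent matrices with a common kernel vector. The common kernel is stable under \<open>A\<close>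
  and \<open>B\<close>, hence it is everything by the quaternion span.\<close>

lemma so3_no_abelian_vector:
  assumes so: "so3_triple A B C"
    and AX: "A ** X1 - X1 ** A = 0" "A ** X2 - X2 ** A = X3" "A ** X3 - X3 ** A = - X2"
    and BX: "B ** X1 - X1 ** B = - X3" "B ** X2 - X2 ** B = 0" "B ** X3 - X3 ** B = X1"
    and CX: "C ** X1 - X1 ** C = X2" "C ** X2 - X2 ** C = - X1" "C ** X3 - X3 ** C = 0"
    and XX: "X1 ** X2 = X2 ** X1" "X1 ** X3 = X3 ** X1" "X2 ** X3 = X3 ** X2"
    and K: "A ** K - K ** A = 0" "B ** K - K ** B = 0" "C ** K - K ** C = 0"
    and G: "A ** G - G ** A = 0" "B ** G - G ** B = 0" "C ** G - G ** C = 0"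
    and KG: "K ** G - G ** K \<noteq> 0"
  shows "X1 = 0"
proof (rule ccontr)
  assume X10: "X1 \<noteq> 0"
  define X where "X = cpx X1 + Mat \<i> ** cpx X2"
  note sl = so3_sl2[OF so]
  have wX: "cm (Mat (2 * \<i>) ** cpx C) X = 2 *\<^sub>R X"
    unfolding X_def cm_linear cm_Mat_mult cpx_cm CX
    by (auto simp: Finite_Cartesian_Product.vec_eq_iff Mat_mult_nth mat_add_distrib scaleR_complex algebra_simps)
  have FX: "cm (lower A B) X = (-2) *\<^sub>R cpx X3"
    unfolding lower_def X_def cm_linear cm_Mat_mult cpx_cm AX BX
    by (auto simp: Finite_Cartesian_Product.vec_eq_iff Mat_mult_nth mat_add_distrib scaleR_complex algebra_simps)
  have "cm (cpx X1) ((-2) *\<^sub>R cpx X3) = 0" "cm (cpx X2) ((-2) *\<^sub>R cpx X3) = 0"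
    unfolding cpx_scaleR cpx_cm by (simp_all only: scalar_matrix_assoc[symmetric] matrix_scalar_ac XX diff_self cpx_0)
  then have XFX: "cm X (cm (lower A B) X) = 0"
    unfolding FX by (simp add: X_def cm_linear cm_Mat_mult)
  have "X \<noteq> 0"
  proof
    assume "X = 0"
    then have "Re (X $ i $ j) = 0" for i j by simp
    then have "X1 = 0" by (simp add: X_def Mat_mult_nth Finite_Cartesian_Product.vec_eq_iff)
    with X10 show False by simp
  qed
  moreover have "cm (raise A B) (cpx K) = 0" "cm (Mat (2 * \<i>) ** cpx C) (cpx K) = 0"
    "cm (raise A B) (cpx G) = 0" "cm (Mat (2 * \<i>) ** cpx C) (cpx G) = 0"
    by (simp_all add: raise_def cm_linear cm_Mat_mult cpx_cm K G)
  moreover have "cm (cpx K) (cpx G) \<noteq> 0" using KG by (simp add: cpx_cm)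
  ultimately obtain P Q where PQ: "P ** Q = Mat 1" "Q ** P = Mat 1"
    and t: "type_22 (Q ** raise A B ** P) (Q ** lower A B ** P) (Q ** (Mat (2 * \<i>) ** cpx C) ** P)"
    using abelian_weight_2_type_22[OF sl wX XFX] by blast
  have "cm (Q ** (Mat (2 * \<i>) ** cpx C) ** P) (Q ** X ** P) = 2 *\<^sub>R (Q ** X ** P)"
    by (simp only: conj_cm[OF PQ(1)] wX conj_scaleR)
  note sq' = type_22_squares[OF t this]
  have sq: "raise A B ** raise A B = 0" "X ** X = 0" "raise A B \<noteq> 0"
    using sq' by (auto simp: conj_mult[OF PQ(1)] conj_zero_iff[OF PQ(1)])
  have "A \<noteq> 0"
  proof
    assume "A = 0"
    moreover have "B = 0" using so calculation by (simp add: so3_triple_def)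
    ultimately show False using sq(3) by (simp add: raise_def)
  qed
  note span = so3_quaternionic(2)[OF so sq(1) this]
  define R S where "R = X1 ** X1 - X2 ** X2" and "S = X1 ** X2"
  have "X ** X = cpx R + Mat (2 * \<i>) ** cpx S"
    unfolding X_def mat_diff_distrib mat_add_distrib Mat_i_mult_left Mat_i_Mat_i cpx_mult R_def S_def XX(1)
    by (simp add: Finite_Cartesian_Product.vec_eq_iff Mat_mult_nth algebra_simps)
  then have "(cpx R + Mat (2 * \<i>) ** cpx S) $ i $ j = 0" for i j
    using sq(2) by simp
  then have "complex_of_real (R $ i $ j) + 2 * \<i> * complex_of_real (S $ i $ j) = 0" for i j
    by (simp only: vector_add_component Mat_mult_nth cpx_nth)
  then have "R $ i $ j = 0 \<and> S $ i $ j = 0" for i j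
    by (auto simp: complex_eq_iff)
  then have RS: "R = 0" "S = 0"
    by (simp_all add: Finite_Cartesian_Product.vec_eq_iff)
  have X12: "X1 ** X2 = 0" and X1122: "X1 ** X1 = X2 ** X2" using RS by (simp_all add: R_def S_def)
  \<comment> \<open>Brackets with \<open>A\<close> and \<open>B\<close> are derivations, so they
    turn X1 X2 = 0 into the vanishing of the other mixed products and then into the equality of all
    squares.\<close>
  have der: "M ** (Y ** Z) - (Y ** Z) ** M = (M ** Y - Y ** M) ** Z + Y ** (M ** Z - Z ** M)"
    for M Y Z :: "real^4^4"
    by (simp add: mat_diff_distrib matrix_mul_assoc)
  have X13: "X1 ** X3 = 0"
    using der[of A X1 X2] by (simp add: AX X12)
  have "- X3 ** X2 = 0"
    using der[of B X1 X2] by (simp add: BX X12)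
  moreover have "- X3 ** X2 = - (X3 ** X2)"
    using mat_diff_distrib(2)[of 0 X3 X2] by simp
  ultimately have X23: "X2 ** X3 = 0" using XX by simp
  have "X3 ** X3 + X2 ** (- X2) = 0"
    using der[of A X2 X3] by (simp add: AX X23)
  moreover have "X2 ** (- X2) = - (X2 ** X2)"
    using mat_diff_distrib(1)[of X2 0 X2] by simp
  ultimately have X33: "X3 ** X3 = X2 ** X2" by simp
  \<comment> \<open>A nonzero value of the last nonvanishing power of \<open>X1\<close> works: X1^3
    = X1 X2^2 = 0, and the mixed products let \<open>X2\<close> and \<open>X3\<close> kill every
    value of \<open>X1\<close>.\<close>
  have "\<exists>v. v \<noteq> 0 \<and> X1 *v v = 0 \<and> X2 *v v = 0 \<and> X3 *v v = 0"
  proof (cases "X1 ** X1 = 0")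
    case True
    obtain x where "X1 *v x \<noteq> 0" using X10 by (metis matrix_eq matrix_vector_mult_0)
    moreover have "X1 *v (X1 *v x) = 0" "X2 *v (X1 *v x) = 0" "X3 *v (X1 *v x) = 0"
      by (simp_all add: matrix_vector_mul_assoc True XX[symmetric] X12 X13)
    ultimately show ?thesis by blast
  next
    case False
    then obtain x where x: "(X1 ** X1) *v x \<noteq> 0" by (metis matrix_eq matrix_vector_mult_0)
    have "X1 ** (X2 ** X2) = 0" "X2 ** (X1 ** X1) = 0" "X3 ** (X1 ** X1) = 0"
      by (simp_all add: matrix_mul_assoc XX[symmetric] X12 X13)
    then have "X1 *v ((X1 ** X1) *v x) = 0" "X2 *v ((X1 ** X1) *v x) = 0" "X3 *v ((X1 ** X1) *v x) = 0"
      by (simp_all add: matrix_vector_mul_assoc X1122)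
    with x show ?thesis by blast
  qed
  then obtain v where v: "v \<noteq> 0" "X1 *v v = 0" "X2 *v v = 0" "X3 *v v = 0" by blast
  \<comment> \<open>With \<open>M\<close> equal to \<open>A\<close> or \<open>B\<close>, the bracket
    is 0 or, up to sign, one of \<open>X1\<close>, \<open>X2\<close>, \<open>X3\<close> again; hence
    the common kernel is invariant.\<close>
  have swap: "X *v (M *v y) = M *v (X *v y) - (M ** X - X ** M) *v y" for X M :: "real^4^4" and y
    by (simp add: matrix_vector_mult_diff_rdistrib matrix_vector_mul_assoc)
  have neg: "(- M) *v y = - (M *v y)" for M :: "real^4^4" and y
    using matrix_vector_mult_diff_rdistrib[of 0 M y] by simp
  have "X1 *v u = 0" for u
  proof -
    obtain a b c d where u: "u = a *s v + b *s (A *v v) + c *s (B *v v) + d *s (A *v (B *v v))"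
      using span[OF v(1)] by blast
    show ?thesis
      unfolding u by (simp add: matrix_vector_right_distrib vector_scalar_commute
          swap[of X1 A] swap[of X1 B] swap[of X2 A] swap[of X2 B] swap[of X3 A] swap[of X3 B] AX BX neg v)
  qed
  then have "X1 = 0" by (simp add: matrix_eq)
  with X10 show False by simp
qed

section \<open>Faithful representations of degree at most 4\<close>

text \<open>Faithfulness in degree exactly 4, with the size in the type, so that the results on
  \<open>real^4^4\<close> apply. Nothing is required of \<open>R\<close> outside
  \<open>L\<close>.\<close>

definition faithful_4 :: "(real^5^5) set \<Rightarrow> (real^5^5 \<Rightarrow> real^4^4) \<Rightarrow> bool" where
  "faithful_4 L R \<longleftrightarrow> subspace L \<and>
    (\<forall>x\<in>L. \<forall>y\<in>L. R (x + y) = R x + R y) \<and>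
    (\<forall>r. \<forall>x\<in>L. R (r *\<^sub>R x) = r *\<^sub>R R x) \<and>
    (\<forall>x\<in>L. \<forall>y\<in>L. R (commutator x y) = R x ** R y - R y ** R x) \<and> inj_on R L"

section \<open>Degree at most 4 reduced to degree 4, and the degree 5 representation\<close>

definition idx4 :: "4 \<Rightarrow> nat" where
  "idx4 i = (if i = 1 then 0 else if i = 2 then 1 else if i = 3 then 2 else 3)"

lemma idx4_simps [simp]: "idx4 1 = 0" "idx4 2 = 1" "idx4 3 = 2" "idx4 4 = 3"
  by (simp_all add: idx4_def)

text \<open>Adding trivial summands keeps a representation faithful, so only the degree 4 has to be
  excluded.\<close>

definition pad4 :: "nat \<Rightarrow> real mat \<Rightarrow> real^4^4" where
  "pad4 N A = (\<chi> i j. if idx4 i < N \<and> idx4 j < N then A $$ (idx4 i, idx4 j) else 0)"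

lemma pad4_mult:
  assumes A: "A \<in> carrier_mat N N" and B: "B \<in> carrier_mat N N" and N: "N \<le> 4"
  shows "pad4 N (A * B) = pad4 N A ** pad4 N B"
proof -
  have s: "(A * B) $$ (i, j) = (\<Sum>k<N. A $$ (i, k) * B $$ (k, j))" if "i < N" "j < N" for i j
    using A B that by (auto simp: scalar_prod_def lessThan_atLeast0 intro!: sum.cong)
  have "N = 0 \<or> N = 1 \<or> N = 2 \<or> N = 3 \<or> N = 4" using N by auto
  moreover have "(\<Sum>k<N. if k < M then f k else 0) = (\<Sum>k<N. f k)" if "N \<le> M" for M and f :: "nat \<Rightarrow> real"
    using that by (intro sum.cong) auto
  ultimately have "pad4 N (A * B) $ i $ j = (pad4 N A ** pad4 N B) $ i $ j" for i j
    by (auto simp: pad4_def matrix_matrix_mult_def sum_4 s numeral_eq_Suc)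
  then show ?thesis by (simp add: Finite_Cartesian_Product.vec_eq_iff)
qed

lemma pad4_inj:
  assumes A: "A \<in> carrier_mat N N" and B: "B \<in> carrier_mat N N" and N: "N \<le> 4"
    and eq: "pad4 N A = pad4 N B"
  shows "A = B"
proof (rule eq_matI)
  fix i j assume "i < dim_row B" "j < dim_col B"
  then have ij: "i < N" "j < N" using B by auto
  have "\<exists>k. idx4 k = n" if "n < 4" for n
  proof -
    have "n = 0 \<or> n = 1 \<or> n = 2 \<or> n = 3" using that by auto
    then show ?thesis using idx4_simps by metis
  qed
  then obtain k l where "idx4 k = i" "idx4 l = j" using ij N by (meson order_less_le_trans)
  moreover have "pad4 N A $ k $ l = pad4 N B $ k $ l" using eq by simp
  ultimately show "A $$ (i, j) = B $$ (i, j)" using ij by (simp add: pad4_def)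
qed (use A B in auto)

lemma pad4_add:
  assumes "A \<in> carrier_mat N N" "B \<in> carrier_mat N N"
  shows "pad4 N (A + B) = pad4 N A + pad4 N B"
  using assms by (auto simp: pad4_def Finite_Cartesian_Product.vec_eq_iff)

lemma pad4_minus:
  assumes "A \<in> carrier_mat N N" "B \<in> carrier_mat N N"
  shows "pad4 N (A - B) = pad4 N A - pad4 N B"
  using assms by (auto simp: pad4_def Finite_Cartesian_Product.vec_eq_iff)

lemma pad4_smult:
  assumes "A \<in> carrier_mat N N"
  shows "pad4 N (r \<cdot>\<^sub>m A) = r *\<^sub>R pad4 N A"
  using assms by (auto simp: pad4_def Finite_Cartesian_Product.vec_eq_iff)

lemma faithful_4I:
  assumes L: "lie_algebra L commutator" and \<rho>: "faithful_lie_representation L commutator N \<rho>" and N: "N \<le> 4"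
  shows "faithful_4 L (\<lambda>x. pad4 N (\<rho> x))"
proof -
  have c: "\<rho> x \<in> carrier_mat N N" if "x \<in> L" for x
    using \<rho> that by (auto simp: faithful_lie_representation_def lie_representation_def)
  have "inj_on (\<lambda>x. pad4 N (\<rho> x)) L"
  proof (rule inj_onI)
    fix x y assume xy: "x \<in> L" "y \<in> L" "pad4 N (\<rho> x) = pad4 N (\<rho> y)"
    then have "\<rho> x = \<rho> y" using pad4_inj c N by blast
    then show "x = y" using \<rho> xy by (auto simp: faithful_lie_representation_def inj_on_def)
  qed
  moreover have "pad4 N (\<rho> (commutator x y)) = pad4 N (\<rho> x) ** pad4 N (\<rho> y) - pad4 N (\<rho> y) ** pad4 N (\<rho> x)"
    if xy: "x \<in> L" "y \<in> L" for x y
  proof -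
    have "\<rho> (commutator x y) = \<rho> x * \<rho> y - \<rho> y * \<rho> x"
      using \<rho> xy by (auto simp: faithful_lie_representation_def lie_representation_def)
    then show ?thesis
      using c[OF xy(1)] c[OF xy(2)] N by (simp add: pad4_minus[of _ N] pad4_mult)
  qed
  ultimately show ?thesis
    using \<rho> L c by (auto simp: faithful_4_def faithful_lie_representation_def lie_representation_def
        lie_algebra_def pad4_add pad4_smult)
qed

definition idx5 :: "nat \<Rightarrow> 5" where
  "idx5 k = (if k = 0 then 1 else if k = 1 then 2 else if k = 2 then 3 else if k = 3 then 4 else 5)"

lemma idx5_surj: "\<exists>k<5. idx5 k = i"
proof -
  have "idx5 0 = 1" "idx5 1 = 2" "idx5 2 = 3" "idx5 3 = 4" "idx5 4 = 5" by (simp_all add: idx5_def)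
  moreover have "(0::nat) < 5" "(1::nat) < 5" "(2::nat) < 5" "(3::nat) < 5" "(4::nat) < 5" by simp_all
  ultimately show ?thesis using exhaust_5[of i] by metis
qed

text \<open>The upper bound: the algebras consist of 5 by 5 matrices, so the inclusion is faithful,
  and only the matrix type changes.\<close>

definition unpad5 :: "real^5^5 \<Rightarrow> real mat" where
  "unpad5 M = Matrix.mat 5 5 (\<lambda>(i, j). M $ idx5 i $ idx5 j)"

lemma unpad5_faithful: "faithful_lie_representation L commutator 5 unpad5"
proof -
  have mult: "unpad5 (A ** B) = unpad5 A * unpad5 B" for A B
  proof (rule eq_matI)
    fix i j assume "i < dim_row (unpad5 A * unpad5 B)" "j < dim_col (unpad5 A * unpad5 B)"
    then have ij: "i < 5" "j < 5" by (simp_all add: unpad5_def)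
    have "(unpad5 A * unpad5 B) $$ (i, j) = (\<Sum>k<5. A $ idx5 i $ idx5 k * B $ idx5 k $ idx5 j)"
      using ij by (auto simp: unpad5_def scalar_prod_def lessThan_atLeast0 intro!: sum.cong)
    also have "\<dots> = (\<Sum>k\<in>UNIV. A $ idx5 i $ k * B $ k $ idx5 j)"
      by (simp add: sum_5 numeral_eq_Suc idx5_def[of "Suc _"] idx5_def[of 0])
    finally show "unpad5 (A ** B) $$ (i, j) = (unpad5 A * unpad5 B) $$ (i, j)"
      using ij by (simp add: unpad5_def matrix_matrix_mult_def)
  qed (simp_all add: unpad5_def)
  have minus: "unpad5 (A - B) = unpad5 A - unpad5 B" for A B
    by (rule eq_matI) (simp_all add: unpad5_def)
  have "inj unpad5"
  proof (rule injI)
    fix A B :: "real^5^5" assume eq: "unpad5 A = unpad5 B"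
    have "A $ i $ j = B $ i $ j" for i j
    proof -
      obtain k l where kl: "k < 5" "l < 5" "idx5 k = i" "idx5 l = j" using idx5_surj by metis
      have "unpad5 A $$ (k, l) = unpad5 B $$ (k, l)" using eq by simp
      then show ?thesis using kl by (simp add: unpad5_def)
    qed
    then show "A = B" by (simp add: Finite_Cartesian_Product.vec_eq_iff)
  qed
  moreover have "unpad5 x \<in> carrier_mat 5 5" "unpad5 (x + y) = unpad5 x + unpad5 y"
    "unpad5 (r *\<^sub>R x) = r \<cdot>\<^sub>m unpad5 x" for x y r
    by (auto simp: unpad5_def intro!: eq_matI)
  ultimately show ?thesis
    by (auto simp: faithful_lie_representation_def lie_representation_def commutator_def mult minus
        intro: inj_on_subset)
qed

lemma mu_eq_5:
  assumes "lie_algebra L commutator" "\<And>R. \<not> faithful_4 L R"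
  shows "mu L commutator = 5"
  unfolding mu_def
proof (rule Least_equality)
  show "\<exists>\<rho>. faithful_lie_representation L commutator 5 \<rho>" using unpad5_faithful by blast
  fix N assume "\<exists>\<rho>. faithful_lie_representation L commutator N \<rho>"
  then show "5 \<le> N" using faithful_4I[OF assms(1)] assms(2) by (metis not_less_eq_eq eval_nat_numeral(3) semiring_norm(26,27,28) Suc_numeral)
qed

section \<open>The eleven algebras\<close>

lemma faithful_4_zero:
  assumes "faithful_4 L R"
  shows "0 \<in> L" "R 0 = 0"
proof -
  show "0 \<in> L" using assms by (simp add: faithful_4_def subspace_0)
  then have "R (0 *\<^sub>R 0) = 0 *\<^sub>R R 0" using assms unfolding faithful_4_def by blast
  then show "R 0 = 0" by simp
qed

lemma faithful_4_eq_zero: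
  assumes "faithful_4 L R" "x \<in> L" "R x = 0"
  shows "x = 0"
  using assms faithful_4_zero[OF assms(1)] unfolding faithful_4_def inj_on_def by metis

lemma faithful_4_linear:
  assumes "faithful_4 L R" "x \<in> L" "y \<in> L"
  shows "R (k *\<^sub>R x + l *\<^sub>R y) = k *\<^sub>R R x + l *\<^sub>R R y" "R (k *\<^sub>R x) = k *\<^sub>R R x"
    "k *\<^sub>R x + l *\<^sub>R y \<in> L"
proof -
  have "k *\<^sub>R x \<in> L" "l *\<^sub>R y \<in> L" using assms by (simp_all add: faithful_4_def subspace_scale)
  then show "R (k *\<^sub>R x + l *\<^sub>R y) = k *\<^sub>R R x + l *\<^sub>R R y" "R (k *\<^sub>R x) = k *\<^sub>R R x" "k *\<^sub>R x + l *\<^sub>R y \<in> L"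
    using assms by (simp_all add: faithful_4_def subspace_add)
qed

lemma faithful_4_bracket:
  assumes "faithful_4 L R" "x \<in> L" "y \<in> L"
  shows "R x ** R y - R y ** R x = R (commutator x y)"
  using assms by (simp add: faithful_4_def)

lemma faithful_4_bracket_scale:
  assumes "faithful_4 L R" "x \<in> L" "y \<in> L" "z \<in> L" "commutator x y = k *\<^sub>R z"
  shows "R x ** R y - R y ** R x = k *\<^sub>R R z"
  using assms faithful_4_bracket[OF assms(1-3)] faithful_4_linear(2)[OF assms(1,4,4)] by simp

lemma faithful_4_bracket_zero:
  assumes "faithful_4 L R" "x \<in> L" "y \<in> L" "commutator x y = 0"
  shows "R x ** R y - R y ** R x = 0"
  using assms faithful_4_bracket[OF assms(1-3)] faithful_4_zero[OF assms(1)] by simp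

lemma faithful_4_cm:
  assumes "faithful_4 L R" "x \<in> L" "y \<in> L"
  shows "z \<in> L \<Longrightarrow> commutator x y = k *\<^sub>R z \<Longrightarrow> cm (cpx (R x)) (cpx (R y)) = k *\<^sub>R cpx (R z)"
    "commutator x y = 0 \<Longrightarrow> cm (cpx (R x)) (cpx (R y)) = 0"
    "z \<in> L \<Longrightarrow> commutator x y = z \<Longrightarrow> cm (cpx (R x)) (cpx (R y)) = cpx (R z)"
  unfolding cpx_cm cpx_scaleR
  by (simp only: faithful_4_bracket_scale[OF assms], simp only: faithful_4_bracket_zero[OF assms] cpx_0,
      simp only: faithful_4_bracket[OF assms])

lemma faithful_4_sl2:
  assumes "faithful_4 L R" "a \<in> L" "b \<in> L" "c \<in> L"
    and "commutator a b = 2 *\<^sub>R b" "commutator a c = (-2) *\<^sub>R c" "commutator b c = a"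
  shows "sl2_triple (cpx (R b)) (cpx (R c)) (cpx (R a))"
  unfolding sl2_triple_def by (intro conjI faithful_4_cm[OF assms(1)] assms)

text \<open>The images satisfy g = y + z f with complex y, z. Bracketing with \<open>h\<close>
  removes y, so the image of [h, g] is z times that of [h, f]. Real and imaginary parts of this
  equation are real relations between \<open>f\<close> and \<open>g\<close>, so coefficients may be
  compared. Each application below reaches a contradiction from the resulting proportionality. The
  element \<open>w\<close> exhibits \<open>f\<close> as a bracket within the commutant.\<close>

lemma half_spin_centralizer:
  assumes rep: "faithful_4 L R"
    and mem: "a \<in> L" "b \<in> L" "c \<in> L" "d \<in> L" "f \<in> L" "g \<in> L" "h \<in> L" "w \<in> L"
    and sl: "commutator a b = 2 *\<^sub>R b" "commutator a c = (-2) *\<^sub>R c" "commutator b c = a"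
    and d: "commutator a d = d" "d \<noteq> 0"
    and f: "commutator b f = 0" "commutator c f = 0" "commutator d f = 0"
    and g: "commutator b g = 0" "commutator c g = 0" "commutator d g = 0"
    and fg: "commutator f g = 0"
    and h: "commutator b h = 0" "commutator c h = 0" and w: "commutator b w = 0" "commutator c w = 0"
    and hw: "commutator h w = f"
    and hf: "commutator h f = \<gamma> *\<^sub>R f + \<delta> *\<^sub>R g" and hg: "commutator h g = \<alpha> *\<^sub>R f + \<beta> *\<^sub>R g"
    and indep: "\<And>x y. x *\<^sub>R f + y *\<^sub>R g = 0 \<Longrightarrow> x = 0 \<and> y = 0"
  shows "\<exists>z::complex. of_real \<alpha> = z * of_real \<gamma> \<and> of_real \<beta> = z * of_real \<delta>"
proof -
  note [intro] = mem
  define \<rho> where "\<rho> x = cpx (R x)" for x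
  note cm3 = faithful_4_cm(3)[OF rep, folded \<rho>_def] and cm2 = faithful_4_cm(2)[OF rep, folded \<rho>_def]
  have f0: "f \<noteq> 0" using indep[of 1 0] by auto
  have nz: "\<rho> x \<noteq> 0" if "x \<in> L" "x \<noteq> 0" for x
    using faithful_4_eq_zero[OF rep] that by (auto simp: \<rho>_def)
  have "\<exists>y z. \<rho> g = Mat y + Mat z ** \<rho> f"
    by (rule odd_weight_centralizer[OF faithful_4_sl2[OF rep mem(1-3) sl, folded \<rho>_def], where D = "\<rho> d" and K = "\<rho> h" and W = "\<rho> w"])
      (simp_all add: cm3[OF mem(1,4,4) d(1)] cm3[OF mem(7,8,5) hw] nz mem d f0 cm2 f g fg h w)
  then obtain y z where yz: "\<rho> g = Mat y + Mat z ** \<rho> f" by blast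
  have G: "cm (\<rho> h) (\<rho> g) = \<alpha> *\<^sub>R \<rho> f + \<beta> *\<^sub>R \<rho> g"
    using cm3[OF mem(7,6) _ hg] faithful_4_linear[OF rep mem(5,6)] by (simp add: \<rho>_def cpx_add cpx_scaleR)
  have F: "cm (\<rho> h) (\<rho> f) = \<gamma> *\<^sub>R \<rho> f + \<delta> *\<^sub>R \<rho> g"
    using cm3[OF mem(7,5) _ hf] faithful_4_linear[OF rep mem(5,6)] by (simp add: \<rho>_def cpx_add cpx_scaleR)
  have "cm (\<rho> h) (\<rho> g) = Mat z ** cm (\<rho> h) (\<rho> f)"
    unfolding yz by (simp add: cm_linear cm_Mat_mult)
  then have eq: "\<alpha> *\<^sub>R \<rho> f + \<beta> *\<^sub>R \<rho> g = Mat z ** (\<gamma> *\<^sub>R \<rho> f + \<delta> *\<^sub>R \<rho> g)"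
    unfolding F G .
  define u v where "u = of_real \<alpha> - z * of_real \<gamma>" and "v = of_real \<beta> - z * of_real \<delta>"
  have "u * of_real (R f $ i $ j) + v * of_real (R g $ i $ j) = 0" for i j
  proof -
    have "(\<alpha> *\<^sub>R \<rho> f + \<beta> *\<^sub>R \<rho> g) $ i $ j = (Mat z ** (\<gamma> *\<^sub>R \<rho> f + \<delta> *\<^sub>R \<rho> g)) $ i $ j"
      unfolding eq ..
    then show ?thesis by (simp add: Mat_mult_nth \<rho>_def scaleR_complex u_def v_def algebra_simps)
  qed
  then have "Re u * R f $ i $ j + Re v * R g $ i $ j = 0 \<and> Im u * R f $ i $ j + Im v * R g $ i $ j = 0" for i j
    by (simp add: complex_eq_iff)
  then have "Re u *\<^sub>R R f + Re v *\<^sub>R R g = 0" "Im u *\<^sub>R R f + Im v *\<^sub>R R g = 0"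
    by (simp_all add: Finite_Cartesian_Product.vec_eq_iff)
  then have "Re u *\<^sub>R f + Re v *\<^sub>R g = 0" "Im u *\<^sub>R f + Im v *\<^sub>R g = 0"
    using faithful_4_linear[OF rep mem(5,6)] faithful_4_eq_zero[OF rep] by metis+
  then have "u = 0" "v = 0" using indep by (auto simp: complex_eq_iff)
  then show ?thesis by (intro exI[of _ z]) (simp add: u_def v_def)
qed

lemmas mat5_eq = Finite_Cartesian_Product.vec_eq_iff forall_5

lemmas bracket_entries = commutator_def matrix_matrix_mult_def sum_5

section \<open>The algebras over sl2\<close>

lemma no_faithful_4_L8_7:
  assumes "p * q \<noteq> 0"
  shows "\<not> faithful_4 (L8_7 p q) R"
proof
  assume rep: "faithful_4 (L8_7 p q) R"
  define M :: "real \<Rightarrow> real \<Rightarrow> real \<Rightarrow> real \<Rightarrow> real \<Rightarrow> real \<Rightarrow> real \<Rightarrow> real \<Rightarrow> real^5^5" where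
    "M a b c d e f g h = vector [
      vector [h+a, b, 0, 0, d],
      vector [c, h-a, 0, 0, e],
      vector [0, 0, p*h, 0, f],
      vector [0, 0, 0, q*h, g],
      vector [0, 0, 0, 0, 0]]" for a b c d e f g h
  have mem: "M a b c d e f g h \<in> L8_7 p q" for a b c d e f g h
    unfolding M_def L8_7_def by blast
  \<comment> \<open>The witness solves [h, w] = f; here \<open>h\<close> scales \<open>f\<close> by
    \<open>p\<close>.\<close>
  have w: "M 0 0 0 0 0 (1 / p) 0 0 \<in> L8_7 p q" by (rule mem)
  have "\<exists>z::complex. of_real 0 = z * of_real p \<and> of_real q = z * of_real 0"
    by (rule half_spin_centralizer[OF rep mem[of 1 0 0 0 0 0 0 0] mem[of 0 1 0 0 0 0 0 0] mem[of 0 0 1 0 0 0 0 0]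
          mem[of 0 0 0 1 0 0 0 0] mem[of 0 0 0 0 0 1 0 0] mem[of 0 0 0 0 0 0 1 0] mem[of 0 0 0 0 0 0 0 1] w])
      (use assms in \<open>auto simp: M_def param_simps field_simps power2_eq_square\<close>)
  then show False using assms by auto
qed

lemma no_faithful_4_L8_8:
  shows "\<not> faithful_4 (L8_8 p) R"
proof
  assume rep: "faithful_4 (L8_8 p) R"
  define M :: "real \<Rightarrow> real \<Rightarrow> real \<Rightarrow> real \<Rightarrow> real \<Rightarrow> real \<Rightarrow> real \<Rightarrow> real \<Rightarrow> real^5^5" where
    "M a b c d e f g h = vector [
      vector [a+h, b, 0, 0, d],
      vector [c, h-a, 0, 0, e],
      vector [0, 0, p*h, h, f],
      vector [0, 0, 0, p*h, g],
      vector [0, 0, 0, 0, 0]]" for a b c d e f g h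
  have mem: "M a b c d e f g h \<in> L8_8 p" for a b c d e f g h
    unfolding M_def L8_8_def by blast
  have w: "(if p = 0 then M 0 0 0 0 0 0 1 0 else M 0 0 0 0 0 (1 / p) 0 0) \<in> L8_8 p"
    by (split if_split) (intro conjI impI mem)
  have "\<exists>z::complex. of_real 1 = z * of_real p \<and> of_real p = z * of_real 0"
    by (rule half_spin_centralizer[OF rep mem[of 1 0 0 0 0 0 0 0] mem[of 0 1 0 0 0 0 0 0] mem[of 0 0 1 0 0 0 0 0]
          mem[of 0 0 0 1 0 0 0 0] mem[of 0 0 0 0 0 1 0 0] mem[of 0 0 0 0 0 0 1 0] mem[of 0 0 0 0 0 0 0 1] w])
      (auto simp: M_def param_simps)
  then show False by auto
qed

lemma no_faithful_4_L8_9: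
  assumes "q \<noteq> 0"
  shows "\<not> faithful_4 (L8_9 p q) R"
proof
  assume rep: "faithful_4 (L8_9 p q) R"
  define M :: "real \<Rightarrow> real \<Rightarrow> real \<Rightarrow> real \<Rightarrow> real \<Rightarrow> real \<Rightarrow> real \<Rightarrow> real \<Rightarrow> real^5^5" where
    "M a b c d e f g h = vector [
      vector [a+h, b, 0, 0, d],
      vector [c, h-a, 0, 0, e],
      vector [0, 0, p*h, q*h, f],
      vector [0, 0, -(q*h), p*h, g],
      vector [0, 0, 0, 0, 0]]" for a b c d e f g h
  have mem: "M a b c d e f g h \<in> L8_9 p q" for a b c d e f g h
    unfolding M_def L8_9_def by blast
  have pq: "p^2 + q^2 \<noteq> 0" using assms by (simp add: sum_power2_eq_zero_iff)
  \<comment> \<open>This solves [h, x f + y g] = f: the bracket with \<open>h\<close> acts on the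
    plane of \<open>f\<close> and \<open>g\<close> by a matrix of determinant p^2 + q^2.\<close>
  define x y where "x = p / (p^2 + q^2)" and "y = q / (p^2 + q^2)"
  have xy: "p * x + q * y = 1" "p * y = q * x"
    using pq by (simp_all add: x_def y_def add_divide_distrib[symmetric] power2_eq_square[symmetric])
  have w: "M 0 0 0 0 0 x y 0 \<in> L8_9 p q" by (rule mem)
  have "\<exists>z::complex. of_real q = z * of_real p \<and> of_real p = z * of_real (- q)"
    by (rule half_spin_centralizer[OF rep mem[of 1 0 0 0 0 0 0 0] mem[of 0 1 0 0 0 0 0 0] mem[of 0 0 1 0 0 0 0 0]
          mem[of 0 0 0 1 0 0 0 0] mem[of 0 0 0 0 0 1 0 0] mem[of 0 0 0 0 0 0 1 0] mem[of 0 0 0 0 0 0 0 1] w])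
      (use xy in \<open>auto simp: M_def param_simps\<close>)
  then obtain z :: complex where z: "of_real q = z * of_real p" "of_real p = z * of_real (- q)" by blast
  have "of_real p * (z * of_real (- q)) + of_real q * (z * of_real p) = 0"
    by simp
  then have "complex_of_real (p^2 + q^2) = 0"
    unfolding z[symmetric] by (simp add: power2_eq_square)
  then show False using pq of_real_eq_0_iff by blast
qed

lemma no_faithful_4_L8_10:
  assumes "p \<noteq> 0"
  shows "\<not> faithful_4 (L8_10 p) R"
proof
  assume rep: "faithful_4 (L8_10 p) R"
  define M :: "real \<Rightarrow> real \<Rightarrow> real \<Rightarrow> real \<Rightarrow> real \<Rightarrow> real \<Rightarrow> real \<Rightarrow> real \<Rightarrow> real^5^5" where
    "M a b c d e f g h = vector [
      vector [a+h, b, 0, 0, d],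
      vector [c, h-a, 0, 0, e],
      vector [-e, d, 2*h, 0, f],
      vector [0, 0, 0, p*h, p*g],
      vector [0, 0, 0, 0, 0]]" for a b c d e f g h
  have mem: "M a b c d e f g h \<in> L8_10 p" for a b c d e f g h
    unfolding M_def L8_10_def by blast
  \<comment> \<open>Here \<open>f\<close> spans the centre of the Heisenberg ideal of
    \<open>d\<close>, \<open>e\<close>, \<open>f\<close>; it commutes with sl2 and \<open>h\<close>
    scales it by 2.\<close>
  have w: "M 0 0 0 0 0 (1/2) 0 0 \<in> L8_10 p" by (rule mem)
  have "\<exists>z::complex. of_real 0 = z * of_real 2 \<and> of_real p = z * of_real 0"
    by (rule half_spin_centralizer[OF rep mem[of 1 0 0 0 0 0 0 0] mem[of 0 1 0 0 0 0 0 0] mem[of 0 0 1 0 0 0 0 0]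
          mem[of 0 0 0 1 0 0 0 0] mem[of 0 0 0 0 0 1 0 0] mem[of 0 0 0 0 0 0 1 0] mem[of 0 0 0 0 0 0 0 1] w])
      (use assms in \<open>auto simp: M_def param_simps field_simps power2_eq_square\<close>)
  then show False using assms by auto
qed

lemma no_faithful_4_L8_11:
  shows "\<not> faithful_4 L8_11 R"
proof
  assume rep: "faithful_4 L8_11 R"
  define M :: "real \<Rightarrow> real \<Rightarrow> real \<Rightarrow> real \<Rightarrow> real \<Rightarrow> real \<Rightarrow> real \<Rightarrow> real \<Rightarrow> real^5^5" where
    "M a b c d e f g h = vector [
      vector [a+h, b, 0, 0, d],
      vector [c, h-a, 0, 0, e],
      vector [-e, d, 2*h, h, f],
      vector [0, 0, 0, 2*h, g],
      vector [0, 0, 0, 0, 0]]" for a b c d e f g h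
  have mem: "M a b c d e f g h \<in> L8_11" for a b c d e f g h
    unfolding M_def L8_11_def by blast
  have w: "M 0 0 0 0 0 (1/2) 0 0 \<in> L8_11" by (rule mem)
  have "\<exists>z::complex. of_real 1 = z * of_real 2 \<and> of_real 2 = z * of_real 0"
    by (rule half_spin_centralizer[OF rep mem[of 1 0 0 0 0 0 0 0] mem[of 0 1 0 0 0 0 0 0] mem[of 0 0 1 0 0 0 0 0]
          mem[of 0 0 0 1 0 0 0 0] mem[of 0 0 0 0 0 1 0 0] mem[of 0 0 0 0 0 0 1 0] mem[of 0 0 0 0 0 0 0 1] w])
      (auto simp: M_def param_simps)
  then show False by auto
qed

text \<open>\<open>d\<close> is the highest weight vector of the four-dimensional irreducible
  constituent of the radical, so it has weight 3.\<close>

lemma no_faithful_4_L8_20: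
  shows "\<not> faithful_4 L8_20 R"
proof
  assume rep: "faithful_4 L8_20 R"
  define M :: "real \<Rightarrow> real \<Rightarrow> real \<Rightarrow> real \<Rightarrow> real \<Rightarrow> real \<Rightarrow> real \<Rightarrow> real \<Rightarrow> real^5^5" where
    "M a b c d e f g h = vector [
      vector [h+3*a, 3*b, 0, 0, d],
      vector [c, h+a, 2*b, 0, e],
      vector [0, 2*c, h-a, b, f],
      vector [0, 0, 3*c, h-3*a, g],
      vector [0, 0, 0, 0, 0]]" for a b c d e f g h
  have mem: "M a b c d e f g h \<in> L8_20" for a b c d e f g h
    unfolding M_def L8_20_def by blast
  have sl: "sl2_triple (cpx (R (M 0 1 0 0 0 0 0 0))) (cpx (R (M 0 0 1 0 0 0 0 0))) (cpx (R (M 1 0 0 0 0 0 0 0)))"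
    by (rule faithful_4_sl2[OF rep mem mem mem]) (unfold mat5_eq, simp_all add: M_def bracket_entries)
  have "cm (cpx (R (M 1 0 0 0 0 0 0 0))) (cpx (R (M 0 0 0 1 0 0 0 0))) = 3 *\<^sub>R cpx (R (M 0 0 0 1 0 0 0 0))"
    by (rule faithful_4_cm(1)[OF rep mem mem mem]) (unfold mat5_eq, simp add: M_def bracket_entries)
  then have "cpx (R (M 0 0 0 1 0 0 0 0)) = 0" by (rule no_weight_3[OF sl])
  moreover have "cpx (R (M 0 0 0 1 0 0 0 0)) \<noteq> 0"
    using faithful_4_eq_zero[OF rep mem, of 0 0 0 1 0 0 0 0] by (auto simp: M_def param_simps)
  ultimately show False by blast
qed

text \<open>\<open>g\<close> has weight 1 and forces 2+1+1. The abelian constituent of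
  \<open>d\<close>, \<open>e\<close>, \<open>f\<close> has the highest weight vector
  \<open>e\<close>, of weight 2, for which that type leaves no room.\<close>

lemma no_faithful_4_L8_22:
  shows "\<not> faithful_4 L8_22 R"
proof
  assume rep: "faithful_4 L8_22 R"
  define M :: "real \<Rightarrow> real \<Rightarrow> real \<Rightarrow> real \<Rightarrow> real \<Rightarrow> real \<Rightarrow> real \<Rightarrow> real \<Rightarrow> real^5^5" where
    "M a b c d e f g h = vector [
      vector [a, b, d, e, g],
      vector [c, -a, f, -d, h],
      vector [0, 0, a, b, 0],
      vector [0, 0, c, -a, 0],
      vector [0, 0, 0, 0, 0]]" for a b c d e f g h
  have mem: "M a b c d e f g h \<in> L8_22" for a b c d e f g h
    unfolding M_def L8_22_def by blast
  have sl: "sl2_triple (cpx (R (M 0 1 0 0 0 0 0 0))) (cpx (R (M 0 0 1 0 0 0 0 0))) (cpx (R (M 1 0 0 0 0 0 0 0)))"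
    by (rule faithful_4_sl2[OF rep mem mem mem]) (unfold mat5_eq, simp_all add: M_def bracket_entries)
  have 1: "cm (cpx (R (M 1 0 0 0 0 0 0 0))) (cpx (R (M 0 0 0 0 0 0 1 0))) = cpx (R (M 0 0 0 0 0 0 1 0))"
    by (rule faithful_4_cm(3)[OF rep mem mem mem]) (unfold mat5_eq, simp add: M_def bracket_entries)
  have 2: "cm (cpx (R (M 1 0 0 0 0 0 0 0))) (cpx (R (M 0 0 0 0 1 0 0 0))) = 2 *\<^sub>R cpx (R (M 0 0 0 0 1 0 0 0))"
    by (rule faithful_4_cm(1)[OF rep mem mem mem]) (unfold mat5_eq, simp add: M_def bracket_entries)
  have 3: "cm (cpx (R (M 0 0 1 0 0 0 0 0))) (cpx (R (M 0 0 0 0 1 0 0 0))) = cpx (R (M 0 0 0 (-1) 0 0 0 0))"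
    by (rule faithful_4_cm(3)[OF rep mem mem mem]) (unfold mat5_eq, simp add: M_def bracket_entries)
  have 4: "cm (cpx (R (M 0 0 0 0 1 0 0 0))) (cm (cpx (R (M 0 0 1 0 0 0 0 0))) (cpx (R (M 0 0 0 0 1 0 0 0)))) = 0"
    unfolding 3 by (rule faithful_4_cm(2)[OF rep mem mem]) (unfold mat5_eq, simp add: M_def bracket_entries)
  have 5: "cpx (R (M 0 0 0 0 0 0 1 0)) \<noteq> 0"
    using faithful_4_eq_zero[OF rep mem, of 0 0 0 0 0 0 1 0] by (auto simp: M_def param_simps)
  have 6: "cpx (R (M 0 0 0 0 1 0 0 0)) \<noteq> 0"
    using faithful_4_eq_zero[OF rep mem, of 0 0 0 0 1 0 0 0] by (auto simp: M_def param_simps)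
  show False using odd_weight_no_abelian_weight_2[OF sl 1 5 2 4] 6 by blast
qed

text \<open>\<open>d\<close> is the highest weight vector of the abelian constituent of
  \<open>d\<close>, \<open>e\<close>, \<open>f\<close>, while \<open>h\<close> and \<open>g\<close>
  commute with sl2. On these, \<open>h\<close> has the eigenvalues 1 and \<open>p\<close>, which the
  type 2+2 forces to agree.\<close>

lemma no_faithful_4_L8_12:
  assumes "p \<noteq> 0" "p \<noteq> 1"
  shows "\<not> faithful_4 (L8_12 p) R"
proof
  assume rep: "faithful_4 (L8_12 p) R"
  define M :: "real \<Rightarrow> real \<Rightarrow> real \<Rightarrow> real \<Rightarrow> real \<Rightarrow> real \<Rightarrow> real \<Rightarrow> real \<Rightarrow> real^5^5" where
    "M a b c d e f g h = vector [
      vector [h+2*a, 2*b, 0, 0, d],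
      vector [c, h, b, 0, e],
      vector [0, 2*c, h-2*a, 0, f],
      vector [0, 0, 0, p*h, g],
      vector [0, 0, 0, 0, 0]]" for a b c d e f g h
  have mem: "M a b c d e f g h \<in> L8_12 p" for a b c d e f g h
    unfolding M_def L8_12_def by blast
  have sl: "sl2_triple (cpx (R (M 0 1 0 0 0 0 0 0))) (cpx (R (M 0 0 1 0 0 0 0 0))) (cpx (R (M 1 0 0 0 0 0 0 0)))"
    by (rule faithful_4_sl2[OF rep mem mem mem]) (unfold mat5_eq, simp_all add: M_def bracket_entries)
  have X: "cm (cpx (R (M 1 0 0 0 0 0 0 0))) (cpx (R (M 0 0 0 1 0 0 0 0))) = 2 *\<^sub>R cpx (R (M 0 0 0 1 0 0 0 0))"
    by (rule faithful_4_cm(1)[OF rep mem mem mem]) (unfold mat5_eq, simp add: M_def bracket_entries)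
  have X1: "cm (cpx (R (M 0 0 1 0 0 0 0 0))) (cpx (R (M 0 0 0 1 0 0 0 0))) = cpx (R (M 0 0 0 0 1 0 0 0))"
    by (rule faithful_4_cm(3)[OF rep mem mem mem]) (unfold mat5_eq, simp add: M_def bracket_entries)
  have X2: "cm (cpx (R (M 0 0 0 1 0 0 0 0))) (cm (cpx (R (M 0 0 1 0 0 0 0 0))) (cpx (R (M 0 0 0 1 0 0 0 0)))) = 0"
    unfolding X1 by (rule faithful_4_cm(2)[OF rep mem mem]) (unfold mat5_eq, simp add: M_def bracket_entries)
  have X3: "cpx (R (M 0 0 0 1 0 0 0 0)) \<noteq> 0"
    using faithful_4_eq_zero[OF rep mem, of 0 0 0 1 0 0 0 0] by (auto simp: M_def param_simps)
  have G0: "cpx (R (M 0 0 0 0 0 0 1 0)) \<noteq> 0"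
    using faithful_4_eq_zero[OF rep mem, of 0 0 0 0 0 0 1 0] by (auto simp: M_def param_simps)
  have K1: "cm (cpx (R (M 0 1 0 0 0 0 0 0))) (cpx (R (M 0 0 0 0 0 0 0 1))) = 0"
    by (rule faithful_4_cm(2)[OF rep mem mem]) (unfold mat5_eq, simp add: M_def bracket_entries)
  have K2: "cm (cpx (R (M 0 0 1 0 0 0 0 0))) (cpx (R (M 0 0 0 0 0 0 0 1))) = 0"
    by (rule faithful_4_cm(2)[OF rep mem mem]) (unfold mat5_eq, simp add: M_def bracket_entries)
  have K3: "cm (cpx (R (M 1 0 0 0 0 0 0 0))) (cpx (R (M 0 0 0 0 0 0 0 1))) = 0"
    by (rule faithful_4_cm(2)[OF rep mem mem]) (unfold mat5_eq, simp add: M_def bracket_entries)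
  have G1: "cm (cpx (R (M 0 1 0 0 0 0 0 0))) (cpx (R (M 0 0 0 0 0 0 1 0))) = 0"
    by (rule faithful_4_cm(2)[OF rep mem mem]) (unfold mat5_eq, simp add: M_def bracket_entries)
  have G2: "cm (cpx (R (M 0 0 1 0 0 0 0 0))) (cpx (R (M 0 0 0 0 0 0 1 0))) = 0"
    by (rule faithful_4_cm(2)[OF rep mem mem]) (unfold mat5_eq, simp add: M_def bracket_entries)
  have G3: "cm (cpx (R (M 1 0 0 0 0 0 0 0))) (cpx (R (M 0 0 0 0 0 0 1 0))) = 0"
    by (rule faithful_4_cm(2)[OF rep mem mem]) (unfold mat5_eq, simp add: M_def bracket_entries)
  have KX: "cm (cpx (R (M 0 0 0 0 0 0 0 1))) (cpx (R (M 0 0 0 1 0 0 0 0))) = cpx (R (M 0 0 0 1 0 0 0 0))"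
    by (rule faithful_4_cm(3)[OF rep mem mem mem]) (unfold mat5_eq, simp add: M_def bracket_entries)
  have GX: "cm (cpx (R (M 0 0 0 0 0 0 1 0))) (cpx (R (M 0 0 0 1 0 0 0 0))) = 0"
    by (rule faithful_4_cm(2)[OF rep mem mem]) (unfold mat5_eq, simp add: M_def bracket_entries)
  have KG: "cm (cpx (R (M 0 0 0 0 0 0 0 1))) (cpx (R (M 0 0 0 0 0 0 1 0))) = p *\<^sub>R cpx (R (M 0 0 0 0 0 0 1 0))"
    by (rule faithful_4_cm(1)[OF rep mem mem mem]) (unfold mat5_eq, simp add: M_def bracket_entries)
  have "p = 1"
    by (rule abelian_weight_2_weight_one[OF sl X X2 X3 K1 K2 K3 G1 G2 G3 G0 KX GX KG assms(1)])
  with assms show False by blast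
qed

section \<open>The algebras over so3\<close>

lemma no_faithful_4_L8_3:
  shows "\<not> faithful_4 L8_3 R"
proof
  assume rep: "faithful_4 L8_3 R"
  define M :: "real \<Rightarrow> real \<Rightarrow> real \<Rightarrow> real \<Rightarrow> real \<Rightarrow> real \<Rightarrow> real \<Rightarrow> real \<Rightarrow> real^5^5" where
    "M a b c d e f g h = vector [
      vector [0, -(b/2), -(c/2), -(a/2), d],
      vector [b/2, 0, -(a/2), c/2, e],
      vector [c/2, a/2, 0, -(b/2), f],
      vector [a/2, -(c/2), b/2, 0, g],
      vector [0, 0, 0, 0, h]]" for a b c d e f g h
  have mem: "M a b c d e f g h \<in> L8_3" for a b c d e f g h
    unfolding M_def L8_3_def by blast
  have so: "so3_triple (R (M 1 0 0 0 0 0 0 0)) (R (M 0 1 0 0 0 0 0 0)) (R (M 0 0 1 0 0 0 0 0))"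
    unfolding so3_triple_def
    by (intro conjI; rule faithful_4_bracket[OF rep mem mem, THEN trans]; rule arg_cong[where f = R]; unfold mat5_eq; simp add: M_def bracket_entries)
  \<comment> \<open>Under so3 the plane of \<open>d\<close> and \<open>f\<close> is turned by the
    generator \<open>c\<close> with angular speed 1/2.\<close>
  have 1: "R (M 0 0 1 0 0 0 0 0) ** R (M 0 0 0 1 0 0 0 0) - R (M 0 0 0 1 0 0 0 0) ** R (M 0 0 1 0 0 0 0 0) = (1/2) *\<^sub>R R (M 0 0 0 0 0 1 0 0)"
    by (rule faithful_4_bracket_scale[OF rep mem mem mem]) (unfold mat5_eq, simp add: M_def bracket_entries)
  have 2: "R (M 0 0 1 0 0 0 0 0) ** R (M 0 0 0 0 0 1 0 0) - R (M 0 0 0 0 0 1 0 0) ** R (M 0 0 1 0 0 0 0 0) = (-1/2) *\<^sub>R R (M 0 0 0 1 0 0 0 0)"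
    by (rule faithful_4_bracket_scale[OF rep mem mem mem]) (unfold mat5_eq, simp add: M_def bracket_entries)
  have "R (M 0 0 0 1 0 0 0 0) = 0" by (rule so3_no_half_spin[OF so 1 2])
  then have "M 0 0 0 1 0 0 0 0 = 0" using faithful_4_eq_zero[OF rep mem] by blast
  then show False by (unfold mat5_eq, simp add: M_def bracket_entries)
qed

lemma no_faithful_4_L8_4:
  shows "\<not> faithful_4 (L8_4 p) R"
proof
  assume rep: "faithful_4 (L8_4 p) R"
  define M :: "real \<Rightarrow> real \<Rightarrow> real \<Rightarrow> real \<Rightarrow> real \<Rightarrow> real \<Rightarrow> real \<Rightarrow> real \<Rightarrow> real^5^5" where
    "M a b c d e f g h = vector [
      vector [p*h, b, c+h, a, d],
      vector [-b, p*h, a, h-c, e],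
      vector [-c-h, -a, p*h, b, f],
      vector [-a, c-h, -b, p*h, g],
      vector [0, 0, 0, 0, 0]]" for a b c d e f g h
  have mem: "M a b c d e f g h \<in> L8_4 p" for a b c d e f g h
    unfolding M_def L8_4_def by blast
  \<comment> \<open>The displayed generators satisfy [a, b] = -2c and its cyclic images, hence the
    factor -1/2.\<close>
  have so: "so3_triple (R (M (-1/2) 0 0 0 0 0 0 0)) (R (M 0 (-1/2) 0 0 0 0 0 0)) (R (M 0 0 (-1/2) 0 0 0 0 0))"
    unfolding so3_triple_def
    by (intro conjI; rule faithful_4_bracket[OF rep mem mem, THEN trans]; rule arg_cong[where f = R]; unfold mat5_eq; simp add: M_def bracket_entries)
  have 1: "R (M 0 0 (-1/2) 0 0 0 0 0) ** R (M 0 0 0 1 0 0 0 0) - R (M 0 0 0 1 0 0 0 0) ** R (M 0 0 (-1/2) 0 0 0 0 0) = (1/2) *\<^sub>R R (M 0 0 0 0 0 1 0 0)"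
    by (rule faithful_4_bracket_scale[OF rep mem mem mem]) (unfold mat5_eq, simp add: M_def bracket_entries)
  have 2: "R (M 0 0 (-1/2) 0 0 0 0 0) ** R (M 0 0 0 0 0 1 0 0) - R (M 0 0 0 0 0 1 0 0) ** R (M 0 0 (-1/2) 0 0 0 0 0) = (-1/2) *\<^sub>R R (M 0 0 0 1 0 0 0 0)"
    by (rule faithful_4_bracket_scale[OF rep mem mem mem]) (unfold mat5_eq, simp add: M_def bracket_entries)
  have "R (M 0 0 0 1 0 0 0 0) = 0" by (rule so3_no_half_spin[OF so 1 2])
  then have "M 0 0 0 1 0 0 0 0 = 0" using faithful_4_eq_zero[OF rep mem] by blast
  then show False by (unfold mat5_eq, simp add: M_def bracket_entries)
qed

text \<open>\<open>d\<close>, \<open>e\<close>, \<open>f\<close> form the abelian vector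
  constituent, and \<open>h\<close>, \<open>g\<close> commute with so3 but not with each other. The
  value \<open>p = 1\<close> needs no exception, because the real structure excludes 2+2 as a
  whole.\<close>

lemma no_faithful_4_L8_1:
  assumes "p \<noteq> 0"
  shows "\<not> faithful_4 (L8_1 p) R"
proof
  assume rep: "faithful_4 (L8_1 p) R"
  define M :: "real \<Rightarrow> real \<Rightarrow> real \<Rightarrow> real \<Rightarrow> real \<Rightarrow> real \<Rightarrow> real \<Rightarrow> real \<Rightarrow> real^5^5" where
    "M a b c d e f g h = vector [
      vector [h, c, -b, 0, d],
      vector [-c, h, a, 0, e],
      vector [b, -a, h, 0, f],
      vector [0, 0, 0, p*h, p*g],
      vector [0, 0, 0, 0, 0]]" for a b c d e f g h
  have mem: "M a b c d e f g h \<in> L8_1 p" for a b c d e f g h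
    unfolding M_def L8_1_def by blast
  \<comment> \<open>The displayed generators satisfy [a, b] = -c and its cyclic images, hence the
    signs.\<close>
  have so: "so3_triple (R (M (-1) 0 0 0 0 0 0 0)) (R (M 0 (-1) 0 0 0 0 0 0)) (R (M 0 0 (-1) 0 0 0 0 0))"
    unfolding so3_triple_def
    by (intro conjI; rule faithful_4_bracket[OF rep mem mem, THEN trans]; rule arg_cong[where f = R]; unfold mat5_eq; simp add: M_def bracket_entries)
  have br: "R (M a b c d e f g h) ** R (M a' b' c' d' e' f' g' h') - R (M a' b' c' d' e' f' g' h') ** R (M a b c d e f g h) = k *\<^sub>R R (M a'' b'' c'' d'' e'' f'' g'' h'')"
    if "commutator (M a b c d e f g h) (M a' b' c' d' e' f' g' h') = k *\<^sub>R M a'' b'' c'' d'' e'' f'' g'' h''"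
    for a b c d e f g h a' b' c' d' e' f' g' h' a'' b'' c'' d'' e'' f'' g'' h'' k
    by (rule faithful_4_bracket_scale[OF rep mem mem mem that])
  have "R (M 0 0 0 1 0 0 0 0) = 0"
  proof (rule so3_no_abelian_vector[OF so, where ?X2.0 = "R (M 0 0 0 0 1 0 0 0)" and ?X3.0 = "R (M 0 0 0 0 0 1 0 0)"
        and K = "R (M 0 0 0 0 0 0 0 1)" and G = "R (M 0 0 0 0 0 0 1 0)"])
    have KG: "R (M 0 0 0 0 0 0 0 1) ** R (M 0 0 0 0 0 0 1 0) - R (M 0 0 0 0 0 0 1 0) ** R (M 0 0 0 0 0 0 0 1) = p *\<^sub>R R (M 0 0 0 0 0 0 1 0)"
      by (rule br) (unfold mat5_eq, simp add: M_def bracket_entries)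
    have "R (M 0 0 0 0 0 0 1 0) \<noteq> 0"
      using faithful_4_eq_zero[OF rep mem, of 0 0 0 0 0 0 1 0] assms by (auto simp: M_def param_simps)
    then show "R (M 0 0 0 0 0 0 0 1) ** R (M 0 0 0 0 0 0 1 0) - R (M 0 0 0 0 0 0 1 0) ** R (M 0 0 0 0 0 0 0 1) \<noteq> 0"
      using assms by (simp add: KG)
    show "R (M (-1) 0 0 0 0 0 0 0) ** R (M 0 0 0 1 0 0 0 0) - R (M 0 0 0 1 0 0 0 0) ** R (M (-1) 0 0 0 0 0 0 0) = 0"
      by (rule faithful_4_bracket_zero[OF rep mem mem]) (unfold mat5_eq, simp add: M_def bracket_entries)
    show "R (M (-1) 0 0 0 0 0 0 0) ** R (M 0 0 0 0 1 0 0 0) - R (M 0 0 0 0 1 0 0 0) ** R (M (-1) 0 0 0 0 0 0 0) = R (M 0 0 0 0 0 1 0 0)"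
      by (rule faithful_4_bracket[OF rep mem mem, THEN trans], rule arg_cong[where f = R]) (unfold mat5_eq, simp add: M_def bracket_entries)
    have "R (M (-1) 0 0 0 0 0 0 0) ** R (M 0 0 0 0 0 1 0 0) - R (M 0 0 0 0 0 1 0 0) ** R (M (-1) 0 0 0 0 0 0 0) = (-1) *\<^sub>R R (M 0 0 0 0 1 0 0 0)"
      by (rule br) (unfold mat5_eq, simp add: M_def bracket_entries)
    then show "R (M (-1) 0 0 0 0 0 0 0) ** R (M 0 0 0 0 0 1 0 0) - R (M 0 0 0 0 0 1 0 0) ** R (M (-1) 0 0 0 0 0 0 0) = - R (M 0 0 0 0 1 0 0 0)" by simp
    have "R (M 0 (-1) 0 0 0 0 0 0) ** R (M 0 0 0 1 0 0 0 0) - R (M 0 0 0 1 0 0 0 0) ** R (M 0 (-1) 0 0 0 0 0 0) = (-1) *\<^sub>R R (M 0 0 0 0 0 1 0 0)"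
      by (rule br) (unfold mat5_eq, simp add: M_def bracket_entries)
    then show "R (M 0 (-1) 0 0 0 0 0 0) ** R (M 0 0 0 1 0 0 0 0) - R (M 0 0 0 1 0 0 0 0) ** R (M 0 (-1) 0 0 0 0 0 0) = - R (M 0 0 0 0 0 1 0 0)" by simp
    show "R (M 0 (-1) 0 0 0 0 0 0) ** R (M 0 0 0 0 1 0 0 0) - R (M 0 0 0 0 1 0 0 0) ** R (M 0 (-1) 0 0 0 0 0 0) = 0"
      by (rule faithful_4_bracket_zero[OF rep mem mem]) (unfold mat5_eq, simp add: M_def bracket_entries)
    show "R (M 0 (-1) 0 0 0 0 0 0) ** R (M 0 0 0 0 0 1 0 0) - R (M 0 0 0 0 0 1 0 0) ** R (M 0 (-1) 0 0 0 0 0 0) = R (M 0 0 0 1 0 0 0 0)"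
      by (rule faithful_4_bracket[OF rep mem mem, THEN trans], rule arg_cong[where f = R]) (unfold mat5_eq, simp add: M_def bracket_entries)
    show "R (M 0 0 (-1) 0 0 0 0 0) ** R (M 0 0 0 1 0 0 0 0) - R (M 0 0 0 1 0 0 0 0) ** R (M 0 0 (-1) 0 0 0 0 0) = R (M 0 0 0 0 1 0 0 0)"
      by (rule faithful_4_bracket[OF rep mem mem, THEN trans], rule arg_cong[where f = R]) (unfold mat5_eq, simp add: M_def bracket_entries)
    have "R (M 0 0 (-1) 0 0 0 0 0) ** R (M 0 0 0 0 1 0 0 0) - R (M 0 0 0 0 1 0 0 0) ** R (M 0 0 (-1) 0 0 0 0 0) = (-1) *\<^sub>R R (M 0 0 0 1 0 0 0 0)"
      by (rule br) (unfold mat5_eq, simp add: M_def bracket_entries)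
    then show "R (M 0 0 (-1) 0 0 0 0 0) ** R (M 0 0 0 0 1 0 0 0) - R (M 0 0 0 0 1 0 0 0) ** R (M 0 0 (-1) 0 0 0 0 0) = - R (M 0 0 0 1 0 0 0 0)" by simp
    show "R (M 0 0 (-1) 0 0 0 0 0) ** R (M 0 0 0 0 0 1 0 0) - R (M 0 0 0 0 0 1 0 0) ** R (M 0 0 (-1) 0 0 0 0 0) = 0"
      by (rule faithful_4_bracket_zero[OF rep mem mem]) (unfold mat5_eq, simp add: M_def bracket_entries)
    show "R (M (-1) 0 0 0 0 0 0 0) ** R (M 0 0 0 0 0 0 0 1) - R (M 0 0 0 0 0 0 0 1) ** R (M (-1) 0 0 0 0 0 0 0) = 0"
      by (rule faithful_4_bracket_zero[OF rep mem mem]) (unfold mat5_eq, simp add: M_def bracket_entries)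
    show "R (M 0 (-1) 0 0 0 0 0 0) ** R (M 0 0 0 0 0 0 0 1) - R (M 0 0 0 0 0 0 0 1) ** R (M 0 (-1) 0 0 0 0 0 0) = 0"
      by (rule faithful_4_bracket_zero[OF rep mem mem]) (unfold mat5_eq, simp add: M_def bracket_entries)
    show "R (M 0 0 (-1) 0 0 0 0 0) ** R (M 0 0 0 0 0 0 0 1) - R (M 0 0 0 0 0 0 0 1) ** R (M 0 0 (-1) 0 0 0 0 0) = 0"
      by (rule faithful_4_bracket_zero[OF rep mem mem]) (unfold mat5_eq, simp add: M_def bracket_entries)
    show "R (M (-1) 0 0 0 0 0 0 0) ** R (M 0 0 0 0 0 0 1 0) - R (M 0 0 0 0 0 0 1 0) ** R (M (-1) 0 0 0 0 0 0 0) = 0"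
      by (rule faithful_4_bracket_zero[OF rep mem mem]) (unfold mat5_eq, simp add: M_def bracket_entries)
    show "R (M 0 (-1) 0 0 0 0 0 0) ** R (M 0 0 0 0 0 0 1 0) - R (M 0 0 0 0 0 0 1 0) ** R (M 0 (-1) 0 0 0 0 0 0) = 0"
      by (rule faithful_4_bracket_zero[OF rep mem mem]) (unfold mat5_eq, simp add: M_def bracket_entries)
    show "R (M 0 0 (-1) 0 0 0 0 0) ** R (M 0 0 0 0 0 0 1 0) - R (M 0 0 0 0 0 0 1 0) ** R (M 0 0 (-1) 0 0 0 0 0) = 0"
      by (rule faithful_4_bracket_zero[OF rep mem mem]) (unfold mat5_eq, simp add: M_def bracket_entries)
    have "R (M 0 0 0 1 0 0 0 0) ** R (M 0 0 0 0 1 0 0 0) - R (M 0 0 0 0 1 0 0 0) ** R (M 0 0 0 1 0 0 0 0) = 0"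
      by (rule faithful_4_bracket_zero[OF rep mem mem]) (unfold mat5_eq, simp add: M_def bracket_entries)
    then show "R (M 0 0 0 1 0 0 0 0) ** R (M 0 0 0 0 1 0 0 0) = R (M 0 0 0 0 1 0 0 0) ** R (M 0 0 0 1 0 0 0 0)" by simp
    have "R (M 0 0 0 1 0 0 0 0) ** R (M 0 0 0 0 0 1 0 0) - R (M 0 0 0 0 0 1 0 0) ** R (M 0 0 0 1 0 0 0 0) = 0"
      by (rule faithful_4_bracket_zero[OF rep mem mem]) (unfold mat5_eq, simp add: M_def bracket_entries)
    then show "R (M 0 0 0 1 0 0 0 0) ** R (M 0 0 0 0 0 1 0 0) = R (M 0 0 0 0 0 1 0 0) ** R (M 0 0 0 1 0 0 0 0)" by simp
    have "R (M 0 0 0 0 1 0 0 0) ** R (M 0 0 0 0 0 1 0 0) - R (M 0 0 0 0 0 1 0 0) ** R (M 0 0 0 0 1 0 0 0) = 0"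
      by (rule faithful_4_bracket_zero[OF rep mem mem]) (unfold mat5_eq, simp add: M_def bracket_entries)
    then show "R (M 0 0 0 0 1 0 0 0) ** R (M 0 0 0 0 0 1 0 0) = R (M 0 0 0 0 0 1 0 0) ** R (M 0 0 0 0 1 0 0 0)" by simp
  qed
  then have "M 0 0 0 1 0 0 0 0 = 0" using faithful_4_eq_zero[OF rep mem] by blast
  then show False by (unfold mat5_eq, simp add: M_def bracket_entries)
qed

theorem mainTheorem3:
  shows
    "(\<forall>p. p \<noteq> 0 \<longrightarrow> mu (L8_1 p) commutator = 5) \<and>
     mu L8_3 commutator = 5 \<and>
     (\<forall>p. mu (L8_4 p) commutator = 5) \<and>
     (\<forall>p q. p * q \<noteq> 0 \<longrightarrow> mu (L8_7 p q) commutator = 5) \<and>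
     (\<forall>p. mu (L8_8 p) commutator = 5) \<and>
     (\<forall>p q. q \<noteq> 0 \<longrightarrow> mu (L8_9 p q) commutator = 5) \<and>
     (\<forall>p. p \<noteq> 0 \<longrightarrow> mu (L8_10 p) commutator = 5) \<and>
     mu L8_11 commutator = 5 \<and>
     (\<forall>p. p \<noteq> 0 \<and> p \<noteq> 1 \<longrightarrow> mu (L8_12 p) commutator = 5) \<and>
     mu L8_20 commutator = 5 \<and>
     mu L8_22 commutator = 5"
proof (intro conjI allI impI; (elim conjE)?)
  show "mu (L8_1 p) commutator = 5" if "p \<noteq> 0" for p
    using lie_algebra_L8_1[OF that] no_faithful_4_L8_1[OF that] by (intro mu_eq_5) auto
  show "mu L8_3 commutator = 5"
    using lie_algebra_L8_3 no_faithful_4_L8_3 by (intro mu_eq_5) auto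
  show "mu (L8_4 p) commutator = 5" for p
    using lie_algebra_L8_4 no_faithful_4_L8_4 by (intro mu_eq_5) auto
  show "mu (L8_7 p q) commutator = 5" if "p * q \<noteq> 0" for p q
    using lie_algebra_L8_7 no_faithful_4_L8_7[OF that] by (intro mu_eq_5) auto
  show "mu (L8_8 p) commutator = 5" for p
    using lie_algebra_L8_8 no_faithful_4_L8_8 by (intro mu_eq_5) auto
  show "mu (L8_9 p q) commutator = 5" if "q \<noteq> 0" for p q
    using lie_algebra_L8_9 no_faithful_4_L8_9[OF that] by (intro mu_eq_5) auto
  show "mu (L8_10 p) commutator = 5" if "p \<noteq> 0" for p
    using lie_algebra_L8_10[OF that] no_faithful_4_L8_10[OF that] by (intro mu_eq_5) auto
  show "mu L8_11 commutator = 5"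
    using lie_algebra_L8_11 no_faithful_4_L8_11 by (intro mu_eq_5) auto
  show "mu (L8_12 p) commutator = 5" if "p \<noteq> 0" "p \<noteq> 1" for p
    using lie_algebra_L8_12 no_faithful_4_L8_12[OF that] by (intro mu_eq_5) auto
  show "mu L8_20 commutator = 5"
    using lie_algebra_L8_20 no_faithful_4_L8_20 by (intro mu_eq_5) auto
  show "mu L8_22 commutator = 5"
    using lie_algebra_L8_22 no_faithful_4_L8_22 by (intro mu_eq_5) auto
qed

end
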